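(* Let $\kappa$ be a $C^\infty$ function germ at $0\in\mathbb{R}$, let $\theta(s)=\int_0^s\kappa(u)\,du$ with Taylor expansion $\sum_{i\ge1}\theta_i s^i/i!$, and let $\phi_4(s)=\int_0^s \frac{u^3}{3!}\,(\cos\theta(u),\sin\theta(u))\,du$. (i) $\phi_4$ defines a $W_{12}$ singularity at $0$ if and only if $\theta_1\ne0$. Moreover, in this case, setting $$w_{12}=\theta_1\theta_3-\tfrac{77}{48}\,\theta_2^2+\tfrac52\,\theta_1^4,$$ $\phi_4$ is $\mathcal A$-equivalent at $0$ to $(t^4,t^5\pm t^7)$ if $\pm w_{12}>0$, and to $(t^4,t^5)$ if $w_{12}=0$. (ii) For an integer $q\ge1$, $\phi_4$ defines a $W^\#_{1,2q-1}$ singularity at $0$ if and only if $$\theta_1=0,\quad \theta_2\ne0,\quad \theta_3=\theta_5=\cdots=\theta_{2q-1}=0\quad\text{and}\quad \theta_{2q+1}\ne0.$$ (iii) $\phi_4$ defines a $W_{18}$ singularity at $0$ if and only if $\theta_1=\theta_2=0$ and $\theta_3\ne0$. Moreover, in this case, setting $$w_{18}=\theta_3\theta_9-\tfrac{4641}{1000}\,\theta_6^2+812\,\theta_3^4,$$ $\phi_4$ is $\mathcal A$-equivalent at $0$ to - $(t^4,t^7\pm t^9)$ if $\pm\theta_5/\theta_3>0$, - $(t^4,t^7\pm t^{13})$ if $\theta_5=0$ and $\pm w_{18}>0$, - $(t^4,t^7)$ if $\theta_5=w_{18}=0$. (In each item the upper signs correspond to each other and the lower signs correspond to each other.)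
   Context: Two $C^\infty$ map germs $f,g:(\mathbb{R},0)\to(\mathbb{R}^2,0)$ are $\mathcal A$-equivalent if there are diffeomorphism germs $h$ of $(\mathbb{R},0)$ and $\psi$ of $(\mathbb{R}^2,0)$ with $f\circ h=\psi\circ g$. A map germ $(\mathbb{R},0)\to(\mathbb{R}^2,0)$ defines at $0$ a singularity of type: $W_{12}$ if it is $\mathcal A$-equivalent to one of $(t^4,t^5+t^7)$, $(t^4,t^5-t^7)$, $(t^4,t^5)$; $W^\#_{1,2q-1}$ ($q\ge1$) if it is $\mathcal A$-equivalent to $(t^4,t^6+t^{2q+5})$; $W_{18}$ if it is $\mathcal A$-equivalent to one of $(t^4,t^7\pm t^9)$, $(t^4,t^7\pm t^{13})$, $(t^4,t^7)$. *)

theory Defs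
  imports "HOL-Analysis.Analysis"
begin

(* Germs at 0 are represented by total functions of which only the behaviour near 0 is used. *)

(* Meant for open sets U: the derivative is the unrestricted one at each point of U.
   In finite dimension this is the usual class C^k. *)
primrec Ck_on :: "nat \<Rightarrow> 'a::real_normed_vector set \<Rightarrow> ('a \<Rightarrow> 'b::real_normed_vector) \<Rightarrow> bool" where
  "Ck_on 0 U f \<longleftrightarrow> continuous_on U f"
| "Ck_on (Suc k) U f \<longleftrightarrow>
     (\<forall>x\<in>U. f differentiable (at x)) \<and> (\<forall>v. Ck_on k U (\<lambda>x. frechet_derivative f (at x) v))"

definition smooth_on :: "'a::real_normed_vector set \<Rightarrow> ('a \<Rightarrow> 'b::real_normed_vector) \<Rightarrow> bool" where
  "smooth_on U f \<longleftrightarrow> (\<forall>k. Ck_on k U f)"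

definition smooth_germ :: "('a::real_normed_vector \<Rightarrow> 'b::real_normed_vector) \<Rightarrow> bool" where
  "smooth_germ f \<longleftrightarrow> (\<exists>U. open U \<and> 0 \<in> U \<and> smooth_on U f)"

definition smooth_map_germ :: "('a::real_normed_vector \<Rightarrow> 'b::real_normed_vector) \<Rightarrow> bool" where
  "smooth_map_germ f \<longleftrightarrow> smooth_germ f \<and> f 0 = 0"

definition diffeo_germ :: "('a::real_normed_vector \<Rightarrow> 'a) \<Rightarrow> bool" where
  "diffeo_germ h \<longleftrightarrow> h 0 = 0 \<and>
     (\<exists>U V h'. open U \<and> open V \<and> 0 \<in> U \<and> homeomorphism U V h h' \<and>
        smooth_on U h \<and> smooth_on V h')"

definition A_equivalent :: "(real \<Rightarrow> real \<times> real) \<Rightarrow> (real \<Rightarrow> real \<times> real) \<Rightarrow> bool" where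
  "A_equivalent f g \<longleftrightarrow> smooth_map_germ f \<and> smooth_map_germ g \<and>
     (\<exists>h \<psi>. diffeo_germ h \<and> diffeo_germ \<psi> \<and> (\<forall>\<^sub>F t in nhds 0. f (h t) = \<psi> (g t)))"

definition W12_singularity :: "(real \<Rightarrow> real \<times> real) \<Rightarrow> bool" where
  "W12_singularity f \<longleftrightarrow>
     A_equivalent f (\<lambda>t. (t^4, t^5 + t^7)) \<or>
     A_equivalent f (\<lambda>t. (t^4, t^5 - t^7)) \<or>
     A_equivalent f (\<lambda>t. (t^4, t^5))"

(* Type W^#_{1,2q-1}; only meant for q \<ge> 1. *)
definition W1_sharp_singularity :: "nat \<Rightarrow> (real \<Rightarrow> real \<times> real) \<Rightarrow> bool" where
  "W1_sharp_singularity q f \<longleftrightarrow> A_equivalent f (\<lambda>t. (t^4, t^6 + t^(2*q+5)))"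

definition W18_singularity :: "(real \<Rightarrow> real \<times> real) \<Rightarrow> bool" where
  "W18_singularity f \<longleftrightarrow>
     A_equivalent f (\<lambda>t. (t^4, t^7 + t^9)) \<or>
     A_equivalent f (\<lambda>t. (t^4, t^7 - t^9)) \<or>
     A_equivalent f (\<lambda>t. (t^4, t^7 + t^13)) \<or>
     A_equivalent f (\<lambda>t. (t^4, t^7 - t^13)) \<or>
     A_equivalent f (\<lambda>t. (t^4, t^7))"

(* The interval integral is oriented, so s < 0 gives the usual sign. *)
definition theta :: "(real \<Rightarrow> real) \<Rightarrow> real \<Rightarrow> real" where
  "theta \<kappa> s = (LBINT u=0..ereal s. \<kappa> u)"

definition theta_coeff :: "(real \<Rightarrow> real) \<Rightarrow> nat \<Rightarrow> real" where
  "theta_coeff \<kappa> i = (deriv ^^ i) (theta \<kappa>) 0"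

definition phi4 :: "(real \<Rightarrow> real) \<Rightarrow> real \<Rightarrow> real \<times> real" where
  "phi4 \<kappa> s = (LBINT u=0..ereal s. (u^3 / fact 3) *\<^sub>R (cos (theta \<kappa> u), sin (theta \<kappa> u)))"

definition w12 :: "(real \<Rightarrow> real) \<Rightarrow> real" where
  "w12 \<kappa> = theta_coeff \<kappa> 1 * theta_coeff \<kappa> 3 - 77/48 * (theta_coeff \<kappa> 2)^2
     + 5/2 * (theta_coeff \<kappa> 1)^4"

definition w18 :: "(real \<Rightarrow> real) \<Rightarrow> real" where
  "w18 \<kappa> = theta_coeff \<kappa> 3 * theta_coeff \<kappa> 9 - 4641/1000 * (theta_coeff \<kappa> 6)^2
     + 812 * (theta_coeff \<kappa> 3)^4"

end

theory Submission
  imports Defs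
begin

text \<open>
  A curve germ with first component of order 4 is brought to the form \<open>(t^4, y t)\<close> by taking the
  fourth root of the first component as parameter.  From then on a coordinate change \<open>(X, Y)\<close> of
  the plane forces the reparametrization, and one removes the coefficients of \<open>y\<close> one order at a time:
  exponents in the semigroup of the curve by changing \<open>Y\<close>, the gaps by changing \<open>X\<close>.  The
  coefficient that cannot be removed at the first obstructed order is a multiple of \<open>w12\<close>,
  \<open>\<theta>\<^sub>5 / \<theta>\<^sub>3\<close> or \<open>w18\<close>.  Beyond the conductor of the semigroup every smooth remainder is a smooth
  function of the two components, so that it is absorbed in the plane diffeomorphism all at once.

  Conversely, the order of the second component determines which of \<open>\<theta>\<^sub>1, \<theta>\<^sub>2, \<theta>\<^sub>3\<close> is the
  first nonzero one.  For \<open>(t^4, t^6 + t^(2 * q + 5))\<close> one compares the two sides at \<open>t\<close> and \<open>- t\<close>: the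
  difference has order exactly \<open>2 * q + 5\<close>, and this is also the order at which the curve fails to be
  symmetric, which is governed by the first nonzero \<open>\<theta>\<^sub>i\<close> with \<open>i\<close> odd.
\<close>

section \<open>Smooth functions\<close>

text \<open>Smoothness instead of analyticity is the obstacle: eliminating coefficients one at a
  time leaves a remainder that no power series describes. It is absorbed by dividing smooth germs in
  t by 1, t, t^2, t^3 over the smooth germs in t^4, which rests on Borel's theorem and on flat
  functions staying smooth after a fourth root. The constants in \<open>w12\<close> and
  \<open>w18\<close> have three sources: the cubic term of the sine, the reparametrization forced by
  the cosine, and the second-order cost b^2 (1 + w/(2n)) of removing a gap term b t^(n+w), n = 4 +
  w, by adding a multiple of the second coordinate to the first. In the converse for W^#, neither
  diffeomorphism is known beyond first order. Two comparisons avoid expanding them: the target map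
  is evaluated at two points with equal first coordinate, where its linear part decides to the order
  needed, and h(-t) is compared with -h(t) through the slope of the chord between their
  images.\<close>

named_theorems smooth_intros

section \<open>Calculus of the classes C^k on open sets\<close>

lemma Ck_on_cong:
  assumes "open U" "\<And>x. x \<in> U \<Longrightarrow> f x = g x" "Ck_on k U f"
  shows "Ck_on k U g"
  using assms(2,3)
proof (induction k arbitrary: f g)
  case 0
  then show ?case by (metis Ck_on.simps(1) continuous_on_cong)
next
  case (Suc k)
  have d: "(g has_derivative frechet_derivative f (at x)) (at x)" if "x \<in> U" for x
  proof -
    have "(f has_derivative frechet_derivative f (at x)) (at x)"
      using Suc.prems that frechet_derivative_works by auto
    then show ?thesis
      by (rule has_derivative_transform_within_open[OF _ assms(1) that]) (use Suc.prems in auto)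
  qed
  have e: "frechet_derivative g (at x) = frechet_derivative f (at x)" if "x \<in> U" for x
    using frechet_derivative_at[OF d[OF that]] by simp
  have "Ck_on k U (\<lambda>x. frechet_derivative g (at x) v)" for v
    by (rule Suc.IH[of "\<lambda>x. frechet_derivative f (at x) v"]) (use e Suc.prems in auto)
  with d show ?case by (auto simp: differentiable_def)
qed

text \<open>The definition of \<open>Ck_on\<close> speaks of the chosen operator
  \<open>frechet_derivative\<close>; through this rule any explicit family of derivatives can serve
  in the closure proofs below.\<close>

lemma Ck_on_SucI:
  assumes "open U" "\<And>x. x \<in> U \<Longrightarrow> (f has_derivative f' x) (at x)"
    "\<And>v. Ck_on k U (\<lambda>x. f' x v)"
  shows "Ck_on (Suc k) U f"
proof -
  have "frechet_derivative f (at x) = f' x" if "x \<in> U" for x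
    using frechet_derivative_at[OF assms(2)[OF that]] by simp
  then have "Ck_on k U (\<lambda>x. frechet_derivative f (at x) v)" for v
    by (intro Ck_on_cong[OF assms(1) _ assms(3)[of v]]) auto
  with assms(2) show ?thesis by (auto simp: differentiable_def)
qed

lemma Ck_on_SucD:
  assumes "Ck_on (Suc k) U f"
  shows "x \<in> U \<Longrightarrow> (f has_derivative frechet_derivative f (at x)) (at x)"
    and "Ck_on k U (\<lambda>x. frechet_derivative f (at x) v)"
  using assms frechet_derivative_works by auto

lemma Ck_on_Suc_imp: "Ck_on (Suc k) U f \<Longrightarrow> Ck_on k U f"
proof (induction k arbitrary: f)
  case 0
  then show ?case
    by (auto intro!: continuous_at_imp_continuous_on differentiable_imp_continuous_within)
next
  case (Suc k)
  then show ?case by (metis Ck_on.simps(2))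
qed

lemma Ck_on_subset: "Ck_on k U f \<Longrightarrow> V \<subseteq> U \<Longrightarrow> Ck_on k V f"
  by (induction k arbitrary: f) (auto intro: continuous_on_subset)

lemma Ck_on_const: "open U \<Longrightarrow> Ck_on k U (\<lambda>x. c)"
proof (induction k arbitrary: c)
  case (Suc k)
  show ?case by (rule Ck_on_SucI[where f'="\<lambda>x v. 0"]) (use Suc in auto)
qed auto

lemma Ck_on_linear:
  assumes "bounded_linear L" "open U" "Ck_on k U f"
  shows "Ck_on k U (\<lambda>x. L (f x))"
  using assms(3)
proof (induction k arbitrary: f)
  case 0
  then show ?case using assms(1) by (auto intro: bounded_linear.continuous_on)
next
  case (Suc k)
  show ?case
  proof (rule Ck_on_SucI[OF assms(2)])
    show "((\<lambda>x. L (f x)) has_derivative (\<lambda>v. L (frechet_derivative f (at x) v))) (at x)" if "x \<in> U" for x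
      using bounded_linear.has_derivative[OF assms(1) Ck_on_SucD(1)[OF Suc.prems that]] .
    show "Ck_on k U (\<lambda>x. L (frechet_derivative f (at x) v))" for v
      by (rule Suc.IH) (rule Ck_on_SucD(2)[OF Suc.prems])
  qed
qed

lemma Ck_on_id: "open U \<Longrightarrow> Ck_on k U (\<lambda>x. x)"
proof (cases k)
  case (Suc j)
  assume "open U"
  show ?thesis unfolding Suc
    by (rule Ck_on_SucI[where f'="\<lambda>x v. v"]) (use \<open>open U\<close> in \<open>auto intro: Ck_on_const\<close>)
qed auto

lemma Ck_on_add:
  assumes "open U" "Ck_on k U f" "Ck_on k U g"
  shows "Ck_on k U (\<lambda>x. f x + g x)"
  using assms(2,3)
proof (induction k arbitrary: f g)
  case 0
  then show ?case by (auto intro: continuous_on_add)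
next
  case (Suc k)
  show ?case
  proof (rule Ck_on_SucI[OF assms(1)])
    show "((\<lambda>x. f x + g x) has_derivative (\<lambda>v. frechet_derivative f (at x) v + frechet_derivative g (at x) v)) (at x)"
      if "x \<in> U" for x
      using Suc.prems that by (intro has_derivative_add Ck_on_SucD(1)[OF _ that])
    show "Ck_on k U (\<lambda>x. frechet_derivative f (at x) v + frechet_derivative g (at x) v)" for v
      using Suc.prems by (intro Suc.IH Ck_on_SucD(2))
  qed
qed

lemma Ck_on_sum:
  assumes "open U" "\<And>i. i \<in> I \<Longrightarrow> Ck_on k U (f i)"
  shows "Ck_on k U (\<lambda>x. \<Sum>i\<in>I. f i x)"
  using assms(2)
  by (induction I rule: infinite_finite_induct) (auto intro: Ck_on_const Ck_on_add assms(1))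

lemma Ck_on_bilinear:
  assumes "bounded_bilinear B" "open U" "Ck_on k U f" "Ck_on k U g"
  shows "Ck_on k U (\<lambda>x. B (f x) (g x))"
  using assms(3,4)
proof (induction k arbitrary: f g)
  case 0
  then show ?case using bounded_bilinear.continuous_on[OF assms(1)] by auto
next
  case (Suc k)
  show ?case
  proof (rule Ck_on_SucI[OF assms(2)])
    show "((\<lambda>x. B (f x) (g x)) has_derivative (\<lambda>v. B (f x) (frechet_derivative g (at x) v) +
        B (frechet_derivative f (at x) v) (g x))) (at x)" if "x \<in> U" for x
      using Suc.prems that by (intro bounded_bilinear.FDERIV[OF assms(1)] Ck_on_SucD(1)[OF _ that])
    show "Ck_on k U (\<lambda>x. B (f x) (frechet_derivative g (at x) v) +
        B (frechet_derivative f (at x) v) (g x))" for v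
      by (rule Ck_on_add[OF assms(2) Suc.IH[OF Ck_on_Suc_imp[OF Suc.prems(1)] Ck_on_SucD(2)[OF Suc.prems(2)]]
            Suc.IH[OF Ck_on_SucD(2)[OF Suc.prems(1)] Ck_on_Suc_imp[OF Suc.prems(2)]]])
  qed
qed

text \<open>\<open>Ck_on\<close> controls derivatives in fixed directions only, while the chain rule
  applies the derivative of \<open>f\<close> to the moving direction \<open>?E x v\<close>.
  Expanding that direction in a basis of the middle space gives a sum of products covered by the
  induction hypothesis; hence the euclidean middle space.\<close>

lemma Ck_on_compose:
  fixes f :: "'b::euclidean_space \<Rightarrow> 'c::real_normed_vector"
  assumes "open U" "open V" "\<And>x. x \<in> U \<Longrightarrow> g x \<in> V" "Ck_on k U g" "Ck_on k V f"
  shows "Ck_on k U (\<lambda>x. f (g x))"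
  using assms(4,5)
proof (induction k arbitrary: f)
  case 0
  then show ?case
    by (auto intro!: continuous_on_compose2[of V f U g] assms(3))
next
  case (Suc k)
  let ?D = "\<lambda>x. frechet_derivative f (at x)"
  let ?E = "\<lambda>x. frechet_derivative g (at x)"
  show ?case
  proof (rule Ck_on_SucI[OF assms(1)])
    show "((\<lambda>x. f (g x)) has_derivative (\<lambda>v. \<Sum>b\<in>Basis. (?E x v \<bullet> b) *\<^sub>R ?D (g x) b)) (at x)" if "x \<in> U" for x
    proof -
      have 1: "(g has_derivative ?E x) (at x)"
        using Ck_on_SucD(1)[OF Suc.prems(1)] that by blast
      have 2: "(f has_derivative ?D (g x)) (at (g x))"
        using Ck_on_SucD(1)[OF Suc.prems(2)] that assms(3) by blast
      have "(f \<circ> g has_derivative (?D (g x) \<circ> ?E x)) (at x)"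
        by (rule diff_chain_at[OF 1 2])
      moreover have "?D (g x) (?E x v) = (\<Sum>b\<in>Basis. (?E x v \<bullet> b) *\<^sub>R ?D (g x) b)" for v
      proof -
        interpret linear "?D (g x)" using 2 has_derivative_linear by blast
        have "?D (g x) (?E x v) = ?D (g x) (\<Sum>b\<in>Basis. (?E x v \<bullet> b) *\<^sub>R b)"
          by (simp add: euclidean_representation)
        then show ?thesis by (simp add: sum scale)
      qed
      ultimately show ?thesis by (simp add: o_def)
    qed
    show "Ck_on k U (\<lambda>x. \<Sum>b\<in>Basis. (?E x v \<bullet> b) *\<^sub>R ?D (g x) b)" for v
    proof (intro Ck_on_sum Ck_on_bilinear[OF bounded_bilinear_scaleR] assms(1))
      fix b :: 'b
      show "Ck_on k U (\<lambda>x. ?E x v \<bullet> b)"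
        by (rule Ck_on_linear[OF bounded_linear_inner_left assms(1)]) (rule Ck_on_SucD(2)[OF Suc.prems(1)])
      show "Ck_on k U (\<lambda>x. ?D (g x) b)"
        by (rule Suc.IH[OF Ck_on_Suc_imp[OF Suc.prems(1)] Ck_on_SucD(2)[OF Suc.prems(2)]])
    qed
  qed
qed

lemma Ck_on_Pair:
  fixes f :: "'a::real_normed_vector \<Rightarrow> 'b::real_normed_vector" and g :: "'a \<Rightarrow> 'c::real_normed_vector"
  assumes "open U" "Ck_on k U f" "Ck_on k U g"
  shows "Ck_on k U (\<lambda>x. (f x, g x))"
proof -
  have "bounded_linear (\<lambda>a::'b. (a, 0::'c))" "bounded_linear (\<lambda>b::'c. (0::'b, b))"
    by (auto intro!: bounded_linear_Pair bounded_linear_ident bounded_linear_zero)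
  from Ck_on_add[OF assms(1) Ck_on_linear[OF this(1) assms(1,2)] Ck_on_linear[OF this(2) assms(1,3)]]
  show ?thesis by simp
qed

lemma smooth_on_subset: "smooth_on U f \<Longrightarrow> V \<subseteq> U \<Longrightarrow> smooth_on V f"
  by (auto simp: smooth_on_def intro: Ck_on_subset)

lemma smooth_on_cong: "open U \<Longrightarrow> (\<And>x. x \<in> U \<Longrightarrow> f x = g x) \<Longrightarrow> smooth_on U f \<Longrightarrow> smooth_on U g"
  unfolding smooth_on_def by (metis Ck_on_cong)

lemma smooth_on_compose:
  fixes f :: "'b::euclidean_space \<Rightarrow> 'c::real_normed_vector"
  assumes "open U" "open V" "\<And>x. x \<in> U \<Longrightarrow> g x \<in> V" "smooth_on U g" "smooth_on V f"
  shows "smooth_on U (\<lambda>x. f (g x))"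
  using assms unfolding smooth_on_def by (metis Ck_on_compose)

lemma smooth_on_has_derivative:
  "smooth_on U f \<Longrightarrow> x \<in> U \<Longrightarrow> (f has_derivative frechet_derivative f (at x)) (at x)"
  unfolding smooth_on_def by (metis Ck_on_SucD(1))

lemma smooth_on_frechet: "smooth_on U f \<Longrightarrow> smooth_on U (\<lambda>x. frechet_derivative f (at x) v)"
  unfolding smooth_on_def by (metis Ck_on_SucD(2))

lemma smooth_on_continuous: "smooth_on U f \<Longrightarrow> continuous_on U f"
  unfolding smooth_on_def by (metis Ck_on.simps(1))

text \<open>Concrete functions are shown smooth by naming a class closed under differentiation:
  multiples of powers, combinations of sine and cosine, a sequence of parameter integrals, a
  sequence of termwise differentiated series.\<close>

lemma smooth_on_coinduct:
  fixes f :: "real \<Rightarrow> real"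
  assumes "open U" "P f"
    and step: "\<And>g. P g \<Longrightarrow> \<exists>g'. P g' \<and> (\<forall>x\<in>U. (g has_real_derivative g' x) (at x))"
  shows "smooth_on U f"
proof -
  have "Ck_on k U g" if "P g" for k g
    using that
  proof (induction k arbitrary: g)
    case 0
    then obtain g' where "\<forall>x\<in>U. (g has_real_derivative g' x) (at x)" using step by blast
    then show ?case by (auto intro!: continuous_at_imp_continuous_on DERIV_isCont)
  next
    case (Suc k)
    then obtain g' where g': "P g'" "\<forall>x\<in>U. (g has_real_derivative g' x) (at x)" using step by blast
    show ?case
    proof (rule Ck_on_SucI[OF assms(1)])
      show "(g has_derivative (\<lambda>v. v * g' x)) (at x)" if "x \<in> U" for x
        using g'(2) that by (simp add: has_field_derivative_def mult_commute_abs)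
      show "Ck_on k U (\<lambda>x. v * g' x)" for v
        using Ck_on_linear[OF bounded_linear_mult_right assms(1) Suc.IH[OF g'(1)]] .
    qed
  qed
  then show ?thesis using assms(2) by (simp add: smooth_on_def)
qed

lemma smooth_on_DERIV:
  fixes f :: "real \<Rightarrow> real"
  assumes "smooth_on U f" "x \<in> U"
  shows "(f has_real_derivative deriv f x) (at x)"
proof -
  have "f differentiable (at x)"
    using smooth_on_has_derivative[OF assms] by (auto simp: differentiable_def)
  then show ?thesis using DERIV_deriv_iff_real_differentiable by blast
qed

lemma smooth_on_deriv:
  fixes f :: "real \<Rightarrow> real"
  assumes "open U" "smooth_on U f"
  shows "smooth_on U (deriv f)"
proof (rule smooth_on_cong[OF assms(1) _ smooth_on_frechet[OF assms(2), of 1]])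
  fix x assume "x \<in> U"
  then have "(f has_derivative (*) (deriv f x)) (at x)"
    using smooth_on_DERIV[OF assms(2)] by (simp add: has_field_derivative_def)
  then show "frechet_derivative f (at x) 1 = deriv f x"
    using frechet_derivative_at by (metis mult.right_neutral)
qed

section \<open>Closure properties of smooth germs\<close>

lemma smooth_germ_cong:
  assumes "smooth_germ f" "\<forall>\<^sub>F x in nhds 0. f x = g x"
  shows "smooth_germ g"
proof -
  obtain U where U: "open U" "0 \<in> U" "smooth_on U f" using assms(1) by (auto simp: smooth_germ_def)
  obtain V where V: "open V" "0 \<in> V" "\<And>x. x \<in> V \<Longrightarrow> f x = g x"
    using assms(2) by (auto simp: eventually_nhds)
  have "smooth_on (U \<inter> V) g"
    by (rule smooth_on_cong[of _ f]) (use U V in \<open>auto intro: smooth_on_subset\<close>)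
  then show ?thesis unfolding smooth_germ_def using U V by (intro exI[of _ "U \<inter> V"]) auto
qed

lemma smooth_germ_const [smooth_intros]: "smooth_germ (\<lambda>x. c)"
  unfolding smooth_germ_def smooth_on_def by (intro exI[of _ UNIV]) (auto intro: Ck_on_const)

lemma smooth_germ_ident [smooth_intros]: "smooth_germ (\<lambda>x. x)"
  unfolding smooth_germ_def smooth_on_def by (intro exI[of _ UNIV]) (auto intro: Ck_on_id)

lemma smooth_germ_linear:
  assumes "bounded_linear L" "smooth_germ f"
  shows "smooth_germ (\<lambda>x. L (f x))"
  using assms unfolding smooth_germ_def smooth_on_def by (metis Ck_on_linear)

lemma smooth_germ_bilinear:
  assumes "bounded_bilinear B" "smooth_germ f" "smooth_germ g"
  shows "smooth_germ (\<lambda>x. B (f x) (g x))"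
proof -
  obtain U V where "open U" "0 \<in> U" "smooth_on U f" "open V" "0 \<in> V" "smooth_on V g"
    using assms(2,3) by (auto simp: smooth_germ_def)
  then have "smooth_on (U \<inter> V) (\<lambda>x. B (f x) (g x))" "open (U \<inter> V)" "0 \<in> U \<inter> V"
    by (auto simp: smooth_on_def intro!: Ck_on_bilinear[OF assms(1)] intro: Ck_on_subset)
  then show ?thesis unfolding smooth_germ_def by blast
qed

lemma smooth_germ_add [smooth_intros]:
  assumes "smooth_germ f" "smooth_germ g"
  shows "smooth_germ (\<lambda>x. f x + g x)"
proof -
  obtain U V where "open U" "0 \<in> U" "smooth_on U f" "open V" "0 \<in> V" "smooth_on V g"
    using assms by (auto simp: smooth_germ_def)
  then have "smooth_on (U \<inter> V) (\<lambda>x. f x + g x)" "open (U \<inter> V)" "0 \<in> U \<inter> V"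
    by (auto simp: smooth_on_def intro!: Ck_on_add intro: Ck_on_subset)
  then show ?thesis unfolding smooth_germ_def by blast
qed

lemma smooth_germ_Pair [smooth_intros]:
  assumes "smooth_germ f" "smooth_germ g"
  shows "smooth_germ (\<lambda>x. (f x, g x))"
proof -
  obtain U V where "open U" "0 \<in> U" "smooth_on U f" "open V" "0 \<in> V" "smooth_on V g"
    using assms by (auto simp: smooth_germ_def)
  then have "smooth_on (U \<inter> V) (\<lambda>x. (f x, g x))" "open (U \<inter> V)" "0 \<in> U \<inter> V"
    by (auto simp: smooth_on_def intro!: Ck_on_Pair intro: Ck_on_subset)
  then show ?thesis unfolding smooth_germ_def by blast
qed

lemma smooth_germ_mult [smooth_intros]:
  fixes f g :: "'a::real_normed_vector \<Rightarrow> real"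
  shows "smooth_germ f \<Longrightarrow> smooth_germ g \<Longrightarrow> smooth_germ (\<lambda>x. f x * g x)"
  by (rule smooth_germ_bilinear[OF bounded_bilinear_mult])

lemma smooth_germ_minus [smooth_intros]: "smooth_germ f \<Longrightarrow> smooth_germ (\<lambda>x. - f x)"
  by (rule smooth_germ_linear[of uminus]) (auto intro: bounded_linear_minus bounded_linear_ident)

lemma smooth_germ_diff [smooth_intros]: "smooth_germ f \<Longrightarrow> smooth_germ g \<Longrightarrow> smooth_germ (\<lambda>x. f x - g x)"
  using smooth_germ_add[of f "\<lambda>x. - g x"] smooth_germ_minus[of g] by simp

lemma smooth_germ_cmult [smooth_intros]:
  fixes f :: "'a::real_normed_vector \<Rightarrow> real"
  shows "smooth_germ f \<Longrightarrow> smooth_germ (\<lambda>x. c * f x)"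
  by (intro smooth_intros)

lemma smooth_germ_divide_const [smooth_intros]:
  fixes f :: "'a::real_normed_vector \<Rightarrow> real"
  shows "smooth_germ f \<Longrightarrow> smooth_germ (\<lambda>x. f x / c)"
  using smooth_germ_cmult[of f "1/c"] by simp

lemma smooth_germ_power [smooth_intros]:
  fixes f :: "'a::real_normed_vector \<Rightarrow> real"
  shows "smooth_germ f \<Longrightarrow> smooth_germ (\<lambda>x. f x ^ n)"
  by (induction n) (auto intro: smooth_intros)

lemma smooth_germ_sum [smooth_intros]:
  "(\<And>i. i \<in> I \<Longrightarrow> smooth_germ (f i)) \<Longrightarrow> smooth_germ (\<lambda>x. \<Sum>i\<in>I. f i x)"
  by (induction I rule: infinite_finite_induct) (auto intro: smooth_intros)

lemma smooth_germ_fst [smooth_intros]: "smooth_germ f \<Longrightarrow> smooth_germ (\<lambda>x. fst (f x))"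
  by (rule smooth_germ_linear[OF bounded_linear_fst])

lemma smooth_germ_snd [smooth_intros]: "smooth_germ f \<Longrightarrow> smooth_germ (\<lambda>x. snd (f x))"
  by (rule smooth_germ_linear[OF bounded_linear_snd])

lemma smooth_germ_continuous: "smooth_germ f \<Longrightarrow> isCont f 0"
  unfolding smooth_germ_def
  by (metis continuous_on_eq_continuous_at smooth_on_continuous)

lemma smooth_germ_tendsto: "smooth_germ f \<Longrightarrow> (f \<longlongrightarrow> f 0) (nhds 0)"
  using smooth_germ_continuous continuous_at_imp_continuous_at_within
  by (metis isCont_def tendsto_at_iff_tendsto_nhds)

lemma smooth_germ_eventually:
  assumes "smooth_germ g" "g 0 = 0" "\<forall>\<^sub>F x in nhds 0. P x"
  shows "\<forall>\<^sub>F x in nhds 0. P (g x)"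
  using smooth_germ_tendsto[OF assms(1)] assms(2,3)
  by (simp add: filterlim_iff)

lemma smooth_germ_compose:
  fixes f :: "'b::euclidean_space \<Rightarrow> 'c::real_normed_vector"
  assumes "smooth_germ f" "smooth_germ g" "g 0 = 0"
  shows "smooth_germ (\<lambda>x. f (g x))"
proof -
  obtain U V where U: "open U" "0 \<in> U" "smooth_on U f" and V: "open V" "0 \<in> V" "smooth_on V g"
    using assms by (auto simp: smooth_germ_def)
  let ?W = "V \<inter> g -` U"
  have "open ?W" using smooth_on_continuous[OF V(3)] V(1) U(1) by (rule continuous_open_preimage)
  moreover have "smooth_on ?W (\<lambda>x. f (g x))"
    by (rule smooth_on_compose[OF \<open>open ?W\<close> U(1)]) (use U V in \<open>auto intro: smooth_on_subset\<close>)
  ultimately show ?thesis unfolding smooth_germ_def using U V assms(3)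
    by (intro exI[of _ ?W]) auto
qed

lemma smooth_germ_powr: "smooth_germ (\<lambda>z::real. (1 + z) powr p)"
proof -
  let ?P = "\<lambda>g. \<exists>a q. g = (\<lambda>z::real. a * (1 + z) powr q)"
  have "smooth_on (ball 0 1) (\<lambda>z::real. (1 + z) powr p)"
  proof (rule smooth_on_coinduct[where P = ?P])
    show "?P (\<lambda>z. (1 + z) powr p)" by (intro exI[of _ 1] exI[of _ p]) auto
    fix g assume "?P g"
    then obtain a q where g: "g = (\<lambda>z::real. a * (1 + z) powr q)" by auto
    show "\<exists>g'. ?P g' \<and> (\<forall>x\<in>ball 0 1. (g has_real_derivative g' x) (at x))"
      unfolding g
      by (intro exI[of _ "\<lambda>z. (a * q) * (1 + z) powr (q - 1)"] conjI exI[of _ "a * q"] exI[of _ "q - 1"] refl ballI)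
        (auto intro!: derivative_eq_intros simp: dist_real_def)
  qed auto
  then show ?thesis unfolding smooth_germ_def by (intro exI[of _ "ball 0 1"]) auto
qed

lemma smooth_on_sin: "smooth_on UNIV (sin :: real \<Rightarrow> real)"
  and smooth_on_cos: "smooth_on UNIV (cos :: real \<Rightarrow> real)"
proof -
  let ?P = "\<lambda>g. \<exists>a b. g = (\<lambda>z::real. a * sin z + b * cos z)"
  have *: "smooth_on UNIV g" if "?P g" for g
  proof (rule smooth_on_coinduct[where P = ?P])
    show "?P g" using that .
    fix g assume "?P g"
    then obtain a b where g: "g = (\<lambda>z::real. a * sin z + b * cos z)" by auto
    show "\<exists>g'. ?P g' \<and> (\<forall>x\<in>UNIV. (g has_real_derivative g' x) (at x))"
      unfolding g
      by (intro exI[of _ "\<lambda>z. (- b) * sin z + a * cos z"] conjI exI[of _ "- b"] exI[of _ a] refl ballI)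
        (auto intro!: derivative_eq_intros)
  qed auto
  show "smooth_on UNIV (sin :: real \<Rightarrow> real)" by (rule *) (intro exI[of _ 1] exI[of _ 0], simp)
  show "smooth_on UNIV (cos :: real \<Rightarrow> real)" by (rule *) (intro exI[of _ 0] exI[of _ 1], simp)
qed

lemma smooth_germ_sin: "smooth_germ (sin :: real \<Rightarrow> real)"
  and smooth_germ_cos: "smooth_germ (cos :: real \<Rightarrow> real)"
  unfolding smooth_germ_def using smooth_on_sin smooth_on_cos by blast+

lemma smooth_germ_powr_compose:
  fixes v :: "'a::euclidean_space \<Rightarrow> real"
  assumes "smooth_germ v" "v 0 > 0"
  shows "smooth_germ (\<lambda>t. v t powr p)"
proof -
  have "smooth_germ (\<lambda>t. v 0 powr p * (1 + (v t / v 0 - 1)) powr p)"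
    using assms
    by (intro smooth_germ_cmult smooth_germ_compose[OF smooth_germ_powr] smooth_intros) auto
  moreover have "\<forall>\<^sub>F t in nhds 0. v t > 0"
    using smooth_germ_tendsto[OF assms(1)] assms(2) order_tendstoD(1) by blast
  then have "\<forall>\<^sub>F t in nhds 0. v 0 powr p * (1 + (v t / v 0 - 1)) powr p = v t powr p"
    by eventually_elim (use assms(2) in \<open>simp add: powr_mult [symmetric]\<close>)
  ultimately show ?thesis by (rule smooth_germ_cong)
qed

text \<open>The quotient is written as f v (v^2)^(-1), so that the base of the real power is
  positive whatever the sign of \<open>v\<close>.\<close>

lemma smooth_germ_divide:
  fixes f v :: "'a::euclidean_space \<Rightarrow> real"
  assumes "smooth_germ f" "smooth_germ v" "v 0 \<noteq> 0"
  shows "smooth_germ (\<lambda>t. f t / v t)"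
proof -
  have "smooth_germ (\<lambda>t. f t * v t * (v t * v t) powr (-1))"
    using assms by (intro smooth_germ_mult smooth_germ_powr_compose) (auto simp: zero_less_mult_iff)
  moreover have "f t * v t * (v t * v t) powr (-1) = f t / v t" for t
    by (cases "v t = 0") (auto simp: powr_minus_divide zero_less_mult_iff)
  ultimately show ?thesis by simp
qed

section \<open>Diffeomorphism germs and A-equivalence\<close>

lemma smooth_germ_frechet: "smooth_germ f \<Longrightarrow> smooth_germ (\<lambda>x. frechet_derivative f (at x) v)"
  unfolding smooth_germ_def using smooth_on_frechet by blast

lemma smooth_germ_has_derivative:
  "smooth_germ f \<Longrightarrow> \<forall>\<^sub>F x in nhds 0. (f has_derivative frechet_derivative f (at x)) (at x)"
  unfolding smooth_germ_def eventually_nhds by (metis smooth_on_has_derivative)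

lemma smooth_germ_deriv:
  fixes f :: "real \<Rightarrow> real"
  shows "smooth_germ f \<Longrightarrow> smooth_germ (deriv f)"
  unfolding smooth_germ_def using smooth_on_deriv by blast

lemma smooth_germ_DERIV:
  fixes f :: "real \<Rightarrow> real"
  shows "smooth_germ f \<Longrightarrow> \<forall>\<^sub>F x in nhds 0. (f has_real_derivative deriv f x) (at x)"
  unfolding smooth_germ_def eventually_nhds by (metis smooth_on_DERIV)

lemma diffeo_germ_ident: "diffeo_germ (\<lambda>x. x)"
  unfolding diffeo_germ_def smooth_on_def
  by (intro conjI exI[of _ UNIV] exI[of _ "\<lambda>x. x"])
    (auto intro: Ck_on_id simp: homeomorphism_def)

lemma diffeo_germ_smooth: "diffeo_germ h \<Longrightarrow> smooth_map_germ h"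
  unfolding diffeo_germ_def smooth_map_germ_def smooth_germ_def by blast

lemma diffeo_germ_inverse:
  assumes "diffeo_germ h"
  obtains k where "diffeo_germ k" "\<forall>\<^sub>F x in nhds 0. k (h x) = x" "\<forall>\<^sub>F x in nhds 0. h (k x) = x"
proof -
  obtain U V k where *: "h 0 = 0" "open U" "open V" "0 \<in> U" "homeomorphism U V h k" "smooth_on U h" "smooth_on V k"
    using assms by (auto simp: diffeo_germ_def)
  then have "0 \<in> V" "k 0 = 0" unfolding homeomorphism_def by (metis image_eqI)+
  moreover have "homeomorphism V U k h" using * homeomorphism_symD by blast
  ultimately have "diffeo_germ k" unfolding diffeo_germ_def using * by blast
  moreover have "\<forall>\<^sub>F x in nhds 0. k (h x) = x" "\<forall>\<^sub>F x in nhds 0. h (k x) = x"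
    using * \<open>0 \<in> V\<close> unfolding eventually_nhds homeomorphism_def by blast+
  ultimately show ?thesis using that by blast
qed

lemma diffeo_germ_compose:
  fixes h1 h2 :: "'a::euclidean_space \<Rightarrow> 'a"
  assumes "diffeo_germ h1" "diffeo_germ h2"
  shows "diffeo_germ (\<lambda>x. h2 (h1 x))"
proof -
  obtain U1 V1 k1 where 1: "h1 0 = 0" "open U1" "open V1" "0 \<in> U1" "homeomorphism U1 V1 h1 k1" "smooth_on U1 h1" "smooth_on V1 k1"
    using assms by (auto simp: diffeo_germ_def)
  obtain U2 V2 k2 where 2: "h2 0 = 0" "open U2" "open V2" "0 \<in> U2" "homeomorphism U2 V2 h2 k2" "smooth_on U2 h2" "smooth_on V2 k2"
    using assms by (auto simp: diffeo_germ_def)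
  let ?U = "U1 \<inter> h1 -` U2" and ?V = "V2 \<inter> k2 -` V1"
  have "open ?U" using smooth_on_continuous[OF 1(6)] 1(2) 2(2) by (rule continuous_open_preimage)
  have "open ?V" using smooth_on_continuous[OF 2(7)] 2(3) 1(3) by (rule continuous_open_preimage)
  have s: "smooth_on ?U (\<lambda>x. h2 (h1 x))"
    by (rule smooth_on_compose[OF \<open>open ?U\<close> 2(2)]) (use 1 2 in \<open>auto intro: smooth_on_subset\<close>)
  have s': "smooth_on ?V (\<lambda>x. k1 (k2 x))"
    by (rule smooth_on_compose[OF \<open>open ?V\<close> 1(3)]) (use 1 2 in \<open>auto intro: smooth_on_subset\<close>)
  have "h1 ` U1 = V1" "k1 ` V1 = U1" "h2 ` U2 = V2" "k2 ` V2 = U2"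
    and "\<And>x. x \<in> U1 \<Longrightarrow> k1 (h1 x) = x" "\<And>x. x \<in> V1 \<Longrightarrow> h1 (k1 x) = x"
    and "\<And>x. x \<in> U2 \<Longrightarrow> k2 (h2 x) = x" "\<And>x. x \<in> V2 \<Longrightarrow> h2 (k2 x) = x"
    using 1(5) 2(5) by (auto simp: homeomorphism_def)
  then have "homeomorphism ?U ?V (\<lambda>x. h2 (h1 x)) (\<lambda>x. k1 (k2 x))"
    by (intro homeomorphismI smooth_on_continuous[OF s] smooth_on_continuous[OF s']) (auto simp: image_iff)
  then show ?thesis unfolding diffeo_germ_def
    using 1 2 s s' \<open>open ?U\<close> \<open>open ?V\<close> by (intro conjI exI[of _ ?U] exI[of _ ?V] exI[of _ "\<lambda>x. k1 (k2 x)"]) auto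
qed

lemma diffeo_germ_derivative_inj:
  fixes h :: "'a::euclidean_space \<Rightarrow> 'a"
  assumes "diffeo_germ h" "(h has_derivative A) (at 0)" "A v = 0"
  shows "v = 0"
proof -
  obtain k where k: "diffeo_germ k" "\<forall>\<^sub>F x in nhds 0. k (h x) = x"
    using diffeo_germ_inverse[OF assms(1)] by blast
  have h0: "h 0 = 0" using assms(1) by (simp add: diffeo_germ_def)
  have "smooth_germ k" using diffeo_germ_smooth[OF k(1)] by (simp add: smooth_map_germ_def)
  then obtain B where B: "(k has_derivative B) (at 0)"
    using smooth_germ_has_derivative eventually_nhds_x_imp_x by blast
  have "(k \<circ> h has_derivative B \<circ> A) (at 0)"
    by (rule diff_chain_at[OF assms(2)]) (use B h0 in simp)
  moreover have "((\<lambda>x. x) has_derivative (\<lambda>x. x)) (at (0::'a))" by simp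
  then have "(k \<circ> h has_derivative (\<lambda>x. x)) (at 0)"
    by (rule has_derivative_transform_eventually)
      (use k(2) eventually_nhds_x_imp_x[OF k(2)] in \<open>auto simp: eventually_at_filter elim: eventually_mono\<close>)
  ultimately have "B (A v) = v" using has_derivative_unique by (metis comp_apply)
  moreover have "B 0 = 0" using B has_derivative_linear linear_0 by blast
  ultimately show ?thesis using assms(3) by simp
qed

text \<open>The inverse function theorem only yields a differentiable inverse \<open>g\<close>.
  Smoothness is bootstrapped from \<open>g' y v = K v (g y)\<close>: if \<open>g\<close> is C^k then
  so is the right-hand side, hence \<open>g\<close> is C^(k+1). The inverse of the derivative is
  supplied by its columns \<open>J b\<close>, so that its smoothness is a statement about
  vector-valued germs.\<close>

lemma diffeo_germI_right_inverse:
  fixes f :: "'a::euclidean_space \<Rightarrow> 'a"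
  assumes f: "smooth_germ f" "f 0 = 0"
    and J: "\<And>b. b \<in> Basis \<Longrightarrow> smooth_germ (J b)"
    and inv: "\<And>b. b \<in> Basis \<Longrightarrow> \<forall>\<^sub>F x in nhds 0. frechet_derivative f (at x) (J b x) = b"
  shows "diffeo_germ f"
proof -
  obtain U0 where U0: "open U0" "0 \<in> U0" "smooth_on U0 f" using f by (auto simp: smooth_germ_def)
  have "\<forall>b\<in>Basis. \<exists>W. open W \<and> 0 \<in> W \<and> smooth_on W (J b)" using J by (auto simp: smooth_germ_def)
  then obtain W where W: "\<And>b. b \<in> Basis \<Longrightarrow> open (W b) \<and> 0 \<in> W b \<and> smooth_on (W b) (J b)" by metis
  have "\<forall>\<^sub>F x in nhds 0. \<forall>b\<in>Basis. frechet_derivative f (at x) (J b x) = b"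
    using inv by (intro eventually_ball_finite) auto
  then obtain T where T: "open T" "0 \<in> T" "\<And>x b. x \<in> T \<Longrightarrow> b \<in> Basis \<Longrightarrow> frechet_derivative f (at x) (J b x) = b"
    unfolding eventually_nhds by blast
  define U where "U = U0 \<inter> T \<inter> (\<Inter>b\<in>Basis. W b)"
  have U: "open U" "0 \<in> U" unfolding U_def using U0 T W by (auto intro!: open_INT)
  have fU: "smooth_on U f" by (rule smooth_on_subset[OF U0(3)]) (auto simp: U_def)
  have JU: "smooth_on U (J b)" if "b \<in> Basis" for b
    by (rule smooth_on_subset[of "W b"]) (use W that in \<open>auto simp: U_def\<close>)
  let ?D = "\<lambda>x. frechet_derivative f (at x)"
  define K where "K = (\<lambda>v x. \<Sum>b\<in>Basis. (v \<bullet> b) *\<^sub>R J b x)"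
  have KU: "smooth_on U (K v)" for v
    unfolding K_def smooth_on_def
    using JU U(1) by (intro allI Ck_on_sum Ck_on_linear[OF bounded_linear_scaleR_right]) (auto simp: smooth_on_def)
  have D: "(f has_derivative ?D x) (at x)" if "x \<in> U" for x
    using smooth_on_has_derivative[OF fU that] .
  have DK: "?D x (K v x) = v" if "x \<in> U" for x v
  proof -
    interpret linear "?D x" using D[OF that] has_derivative_linear by blast
    have "?D x (K v x) = (\<Sum>b\<in>Basis. (v \<bullet> b) *\<^sub>R ?D x (J b x))" by (simp add: K_def sum scale)
    also have "\<dots> = (\<Sum>b\<in>Basis. (v \<bullet> b) *\<^sub>R b)"
      using that by (intro sum.cong refl) (simp add: T U_def)
    finally show ?thesis by (simp add: euclidean_representation)
  qed
  define f' where "f' = (\<lambda>x. Blinfun (?D x))"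
  have f'[simp]: "blinfun_apply (f' x) = ?D x" if "x \<in> U" for x
    unfolding f'_def using D[OF that] by (simp add: bounded_linear_Blinfun_apply has_derivative_bounded_linear)
  have cont: "continuous_on U f'"
  proof (rule continuous_on_blinfun_componentwise)
    fix i :: 'a
    have "continuous_on U (\<lambda>x. ?D x i)" by (rule smooth_on_continuous[OF smooth_on_frechet[OF fU]])
    then show "continuous_on U (\<lambda>x. blinfun_apply (f' x) i)"
      by (rule continuous_on_eq) simp
  qed
  have lin0: "linear (?D 0)" using D[OF U(2)] has_derivative_linear by blast
  have "surj (?D 0)" using DK[OF U(2)] by (intro surjI[where f="\<lambda>v. K v 0"])
  then obtain I where I: "linear I" "\<And>x. I (?D 0 x) = x"
    using linear_surjective_isomorphism[OF lin0] by blast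
  then have "Blinfun I o\<^sub>L f' 0 = id_blinfun"
    using U(2) by (intro blinfun_eqI) (simp add: bounded_linear_Blinfun_apply linear_conv_bounded_linear)
  then obtain U' V g g' where *: "open U'" "U' \<subseteq> U" "0 \<in> U'" "open V" "f 0 \<in> V" "homeomorphism U' V f g"
    "\<And>y. y \<in> V \<Longrightarrow> (g has_derivative (g' y)) (at y)"
    "\<And>y. y \<in> V \<Longrightarrow> g' y = inv (blinfun_apply (f'(g y)))"
    "\<And>y. y \<in> V \<Longrightarrow> bij (blinfun_apply (f'(g y)))"
    using inverse_function_theorem[of U f f' 0 "Blinfun I"] U D cont by (metis f')
  have gU: "g y \<in> U'" if "y \<in> V" for y using *(6) that by (auto simp: homeomorphism_def)
  have g'K: "g' y v = K v (g y)" if "y \<in> V" for y v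
  proof -
    have "g y \<in> U" using gU[OF that] *(2) by blast
    then show ?thesis
      using *(8)[OF that] *(9)[OF that] DK[of "g y" v] by (simp add: bij_is_inj inv_f_eq)
  qed
  have KU': "Ck_on k U' (K v)" for k v
    using smooth_on_subset[OF KU *(2)] unfolding smooth_on_def by blast
  have "Ck_on k V g" for k
  proof (induction k)
    case 0
    then show ?case using *(6) by (auto simp: homeomorphism_def)
  next
    case (Suc k)
    show ?case
    proof (rule Ck_on_SucI[OF *(4,7)])
      fix v
      have "Ck_on k V (\<lambda>y. K v (g y))"
        by (rule Ck_on_compose[OF *(4,1) gU Suc KU'])
      then show "Ck_on k V (\<lambda>y. g' y v)"
        by (rule Ck_on_cong[OF *(4), rotated]) (simp add: g'K)
    qed
  qed
  then have "smooth_on V g" by (simp add: smooth_on_def)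
  then show ?thesis unfolding diffeo_germ_def
    using f(2) * smooth_on_subset[OF fU *(2)] by blast
qed

lemma diffeo_germ_real:
  fixes h :: "real \<Rightarrow> real"
  assumes "smooth_germ h" "h 0 = 0" "deriv h 0 \<noteq> 0"
  shows "diffeo_germ h"
proof (rule diffeo_germI_right_inverse[OF assms(1,2), of "\<lambda>b x. b / deriv h x"])
  have sm: "smooth_germ (deriv h)" by (rule smooth_germ_deriv[OF assms(1)])
  show "smooth_germ (\<lambda>x. b / deriv h x)" for b
    by (rule smooth_germ_divide[OF smooth_germ_const sm assms(3)])
  have "\<forall>\<^sub>F x in nhds 0. deriv h x \<noteq> 0"
    using smooth_germ_tendsto[OF sm] assms(3) by (rule tendsto_imp_eventually_ne)
  moreover note smooth_germ_DERIV[OF assms(1)]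
  ultimately show "\<forall>\<^sub>F x in nhds 0. frechet_derivative h (at x) (b / deriv h x) = b" for b
  proof eventually_elim
    case (elim x)
    then have "(h has_derivative (*) (deriv h x)) (at x)" by (simp add: has_field_derivative_def)
    then have "frechet_derivative h (at x) = (*) (deriv h x)" using frechet_derivative_at by metis
    then show ?case using elim by simp
  qed
qed

text \<open>The adjugate over the determinant, applied to the columns of the matrix; these entries
  become the inverse columns of the Jacobian of a plane map.\<close>

lemma cramer_2:
  fixes a b c d :: real
  assumes "a * d - b * c \<noteq> 0"
  defines "e \<equiv> a * d - b * c"
  shows "d / e * a + - c / e * b = 1" "d / e * c + - c / e * d = 0"
    "- b / e * a + a / e * b = 0" "- b / e * c + a / e * d = 1"
proof -
  have "e \<noteq> 0" using assms by simp
  then show "d / e * a + - c / e * b = 1" "d / e * c + - c / e * d = 0"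
    "- b / e * a + a / e * b = 0" "- b / e * c + a / e * d = 1"
    by (simp_all add: divide_simps) (simp_all add: e_def algebra_simps)
qed

lemma diffeo_germ_plane:
  fixes \<psi> :: "real \<times> real \<Rightarrow> real \<times> real"
  assumes "smooth_germ \<psi>" "\<psi> 0 = 0"
    and "(\<psi> has_derivative (\<lambda>p. (a * fst p + b * snd p, c * fst p + d * snd p))) (at 0)"
    and "a * d - b * c \<noteq> 0"
  shows "diffeo_germ \<psi>"
proof -
  let ?D = "\<lambda>x. frechet_derivative \<psi> (at x)"
  let ?a = "\<lambda>x. fst (?D x (1,0))" and ?c = "\<lambda>x. snd (?D x (1,0))"
  let ?b = "\<lambda>x. fst (?D x (0,1))" and ?d = "\<lambda>x. snd (?D x (0,1))"
  let ?e = "\<lambda>x. ?a x * ?d x - ?b x * ?c x"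
  let ?J = "\<lambda>b' x. if b' = (1,0) then (?d x / ?e x, - ?c x / ?e x) else (- ?b x / ?e x, ?a x / ?e x)"
  have D0: "?D 0 = (\<lambda>p. (a * fst p + b * snd p, c * fst p + d * snd p))"
    using frechet_derivative_at[OF assms(3)] by simp
  have e0: "?e 0 \<noteq> 0" using assms(4) by (simp add: D0)
  have sm: "smooth_germ ?a" "smooth_germ ?b" "smooth_germ ?c" "smooth_germ ?d"
    using smooth_germ_frechet[OF assms(1)] by (intro smooth_germ_fst smooth_germ_snd; blast)+
  then have sme: "smooth_germ ?e" by (intro smooth_germ_diff smooth_germ_mult)
  show ?thesis
  proof (rule diffeo_germI_right_inverse[OF assms(1,2), of ?J])
    fix b' :: "real \<times> real" assume b': "b' \<in> Basis"
    have "smooth_germ (\<lambda>x. (?d x / ?e x, - ?c x / ?e x))" "smooth_germ (\<lambda>x. (- ?b x / ?e x, ?a x / ?e x))"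
      by (intro smooth_germ_Pair smooth_germ_divide[OF _ sme e0] smooth_germ_minus sm)+
    then show "smooth_germ (?J b')" by (cases "b' = (1,0)") simp_all
    have "\<forall>\<^sub>F x in nhds 0. ?e x \<noteq> 0"
      using smooth_germ_tendsto[OF sme] e0 by (rule tendsto_imp_eventually_ne)
    moreover note smooth_germ_has_derivative[OF assms(1)]
    ultimately show "\<forall>\<^sub>F x in nhds 0. ?D x (?J b' x) = b'"
    proof eventually_elim
      case (elim x)
      interpret linear "?D x" using elim(2) has_derivative_linear by blast
      have lin: "?D x (u, v) = (u * ?a x + v * ?b x, u * ?c x + v * ?d x)" for u v
      proof -
        have "?D x (u, v) = ?D x (u *\<^sub>R (1,0) + v *\<^sub>R (0,1))" by simp
        also have "\<dots> = u *\<^sub>R ?D x (1,0) + v *\<^sub>R ?D x (0,1)" by (simp only: add scale)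
        finally show ?thesis by (simp add: prod_eq_iff)
      qed
      have "b' = (1,0) \<or> b' = (0,1)" using b' by (auto simp: Basis_prod_def)
      then show ?case
      proof
        assume b: "b' = (1,0)"
        have j: "?J b' x = (?d x / ?e x, - ?c x / ?e x)" by (simp only: b refl if_True)
        have "?D x (?d x / ?e x, - ?c x / ?e x) = (1,0)"
          by (rule trans[OF lin]) (simp only: cramer_2[OF elim(1)])
        then show ?thesis by (rule trans[OF trans[OF arg_cong[OF j, of "?D x"]] b[symmetric]])
      next
        assume b: "b' = (0,1)"
        have j: "?J b' x = (- ?b x / ?e x, ?a x / ?e x)" by (simp only: b prod.inject zero_neq_one if_False simp_thms)
        have "?D x (- ?b x / ?e x, ?a x / ?e x) = (0,1)"
          by (rule trans[OF lin]) (simp only: cramer_2[OF elim(1)])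
        then show ?thesis by (rule trans[OF trans[OF arg_cong[OF j, of "?D x"]] b[symmetric]])
      qed
    qed
  qed
qed

section \<open>A-equivalence as an equivalence relation\<close>

lemma A_equivalent_sym:
  assumes "A_equivalent f g"
  shows "A_equivalent g f"
proof -
  obtain h \<psi> where *: "smooth_map_germ f" "smooth_map_germ g" "diffeo_germ h" "diffeo_germ \<psi>"
    "\<forall>\<^sub>F t in nhds 0. f (h t) = \<psi> (g t)" using assms by (auto simp: A_equivalent_def)
  obtain k where k: "diffeo_germ k" "\<forall>\<^sub>F x in nhds 0. h (k x) = x"
    using diffeo_germ_inverse[OF *(3)] by blast
  obtain \<xi> where c: "diffeo_germ \<xi>" "\<forall>\<^sub>F x in nhds 0. \<xi> (\<psi> x) = x"
    using diffeo_germ_inverse[OF *(4)] by blast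
  note sk = diffeo_germ_smooth[OF k(1), unfolded smooth_map_germ_def]
  have g: "smooth_germ g" "g 0 = 0" using *(2) by (auto simp: smooth_map_germ_def)
  have "smooth_germ (\<lambda>t. g (k t))" "g (k 0) = 0"
    using sk g by (auto intro: smooth_germ_compose)
  then have "\<forall>\<^sub>F t in nhds 0. \<xi> (\<psi> (g (k t))) = g (k t)"
    using c(2) by (rule smooth_germ_eventually)
  moreover have "\<forall>\<^sub>F t in nhds 0. f (h (k t)) = \<psi> (g (k t))"
    using sk *(5) by (intro smooth_germ_eventually[where g=k]) auto
  ultimately have "\<forall>\<^sub>F t in nhds 0. g (k t) = \<xi> (f t)"
    using k(2) by eventually_elim simp
  then show ?thesis unfolding A_equivalent_def using * k c by blast
qed

lemma A_equivalent_trans: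
  assumes "A_equivalent f g" "A_equivalent g l"
  shows "A_equivalent f l"
proof -
  obtain h \<psi> where *: "smooth_map_germ f" "diffeo_germ h" "diffeo_germ \<psi>"
    "\<forall>\<^sub>F t in nhds 0. f (h t) = \<psi> (g t)" using assms by (auto simp: A_equivalent_def)
  obtain k \<xi> where c: "smooth_map_germ l" "diffeo_germ k" "diffeo_germ \<xi>"
    "\<forall>\<^sub>F t in nhds 0. g (k t) = \<xi> (l t)" using assms by (auto simp: A_equivalent_def)
  note sk = diffeo_germ_smooth[OF c(2), unfolded smooth_map_germ_def]
  have "\<forall>\<^sub>F t in nhds 0. f (h (k t)) = \<psi> (g (k t))"
    using sk *(4) by (intro smooth_germ_eventually[where g=k]) auto
  with c(4) have "\<forall>\<^sub>F t in nhds 0. f (h (k t)) = \<psi> (\<xi> (l t))"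
    by eventually_elim simp
  then show ?thesis unfolding A_equivalent_def
    using *(1) c(1) diffeo_germ_compose[OF c(2) *(2)] diffeo_germ_compose[OF c(3) *(3)] by blast
qed

lemma A_equivalent_cong:
  assumes "A_equivalent f g" "\<forall>\<^sub>F t in nhds 0. g t = g' t"
  shows "A_equivalent f g'"
proof -
  obtain h \<psi> where *: "smooth_map_germ f" "smooth_map_germ g" "diffeo_germ h" "diffeo_germ \<psi>"
    "\<forall>\<^sub>F t in nhds 0. f (h t) = \<psi> (g t)" using assms by (auto simp: A_equivalent_def)
  have "smooth_map_germ g'"
    using *(2) assms(2) smooth_germ_cong eventually_nhds_x_imp_x[OF assms(2)]
    by (metis smooth_map_germ_def)
  moreover have "\<forall>\<^sub>F t in nhds 0. f (h t) = \<psi> (g' t)"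
    using *(5) assms(2) by eventually_elim simp
  ultimately show ?thesis unfolding A_equivalent_def using * by blast
qed

lemma A_equivalent_target:
  assumes "smooth_map_germ f" "diffeo_germ \<psi>"
  shows "A_equivalent f (\<lambda>t. \<psi> (f t))"
proof (rule A_equivalent_sym)
  have "smooth_map_germ (\<lambda>t. \<psi> (f t))"
    using assms diffeo_germ_smooth[OF assms(2)] by (auto simp: smooth_map_germ_def intro: smooth_germ_compose)
  then show "A_equivalent (\<lambda>t. \<psi> (f t)) f"
    unfolding A_equivalent_def using assms
    by (intro conjI exI[of _ "\<lambda>x. x"] exI[of _ \<psi>] diffeo_germ_ident) auto
qed

lemma A_equivalent_source:
  assumes "smooth_map_germ f" "diffeo_germ h"
  shows "A_equivalent f (\<lambda>t. f (h t))"
proof -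
  have "smooth_map_germ (\<lambda>t. f (h t))"
    using assms diffeo_germ_smooth[OF assms(2)] by (auto simp: smooth_map_germ_def intro: smooth_germ_compose)
  then show ?thesis
    unfolding A_equivalent_def using assms
    by (intro conjI exI[of _ "\<lambda>x. x"] exI[of _ h] diffeo_germ_ident) auto
qed

section \<open>Taylor coefficients and order of vanishing\<close>

definition tc :: "(real \<Rightarrow> real) \<Rightarrow> nat \<Rightarrow> real" where
  "tc f k = (deriv ^^ k) f 0 / fact k"

text \<open>A lower bound for the order at 0, not the order itself. It is encoded by divisibility so
  that the smooth quotient is at hand; \<open>vord_iff_tc\<close> and \<open>vord_of_bound\<close>
  translate it to vanishing Taylor coefficients and to size estimates.\<close>

definition vord :: "nat \<Rightarrow> (real \<Rightarrow> real) \<Rightarrow> bool" where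
  "vord k f \<longleftrightarrow> (\<exists>u. smooth_germ u \<and> (\<forall>\<^sub>F t in nhds 0. f t = t^k * u t))"

lemma iterated_deriv_eq:
  fixes D :: "nat \<Rightarrow> real \<Rightarrow> real"
  assumes "open S" "\<And>k x. x \<in> S \<Longrightarrow> (D k has_real_derivative D (Suc k) x) (at x)" "x \<in> S"
  shows "(deriv ^^ k) (D 0) x = D k x"
  using assms(3)
proof (induction k arbitrary: x)
  case (Suc k)
  have "((deriv ^^ k) (D 0) has_real_derivative D (Suc k) x) (at x)"
    by (rule has_field_derivative_transform_within_open[OF assms(2)[OF Suc.prems] assms(1) Suc.prems])
      (use Suc.IH in auto)
  then show ?case by (simp add: DERIV_imp_deriv)
qed simp

lemma smooth_on_iterated_deriv:
  fixes f :: "real \<Rightarrow> real"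
  assumes "open U" "smooth_on U f"
  shows "smooth_on U ((deriv ^^ k) f)"
  by (induction k) (use assms smooth_on_deriv in auto)

text \<open>The quotient is the integral of f'(s t) over s in [0, 1]. Differentiating k times under
  the integral brings out s^k, and since s^k integrates to 1/(k+1) the Taylor coefficients of the
  quotient are those of \<open>f\<close> shifted by one.\<close>

lemma hadamard_ball:
  fixes f :: "real \<Rightarrow> real"
  assumes "e > 0" "smooth_on (ball 0 e) f"
  obtains u where "smooth_on (ball 0 e) u" "\<And>t. t \<in> ball 0 e \<Longrightarrow> f t = f 0 + t * u t"
    "\<And>k. (deriv ^^ k) u 0 = (deriv ^^ Suc k) f 0 / real (Suc k)"
proof -
  define F where "F = (\<lambda>k. (deriv ^^ k) f)"
  have F: "(F k has_real_derivative F (Suc k) x) (at x)" if "x \<in> ball 0 e" for k x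
    using smooth_on_DERIV[OF smooth_on_iterated_deriv[OF open_ball assms(2), of k] that] by (simp add: F_def)
  have cF: "continuous_on (ball 0 e) (F k)" for k
    unfolding F_def by (intro smooth_on_continuous smooth_on_iterated_deriv assms(2)) auto
  have st: "s * t \<in> ball 0 e" if "t \<in> ball 0 e" "s \<in> {0..1}" for s t :: real
  proof -
    have "\<bar>s * t\<bar> \<le> 1 * \<bar>t\<bar>" unfolding abs_mult using that by (intro mult_right_mono) auto
    then show ?thesis using that by (simp add: dist_real_def)
  qed
  \<comment> \<open>\<open>I k\<close> is the k-th derivative of the quotient; the sequence is the
    class fed to \<open>smooth_on_coinduct\<close>.\<close>
  define I where "I = (\<lambda>k t. integral {0..1} (\<lambda>s. s^k * F (Suc k) (s * t)))"
  have I: "(I k has_real_derivative I (Suc k) t) (at t)" if t: "t \<in> ball 0 e" for k t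
  proof -
    have "((\<lambda>t. integral (cbox 0 1) (\<lambda>s. s^k * F (Suc k) (s * t))) has_field_derivative
        integral (cbox 0 1) (\<lambda>s. s^Suc k * F (Suc (Suc k)) (s * t))) (at t within ball 0 e)"
    proof (rule leibniz_rule_field_derivative[where fx="\<lambda>t s. s^Suc k * F (Suc (Suc k)) (s * t)"])
      fix x s :: real assume *: "x \<in> ball 0 e" "s \<in> cbox 0 1"
      have "((\<lambda>x. F (Suc k) (s * x)) has_real_derivative F (Suc (Suc k)) (s * x) * s) (at x)"
        by (rule DERIV_chain2[OF F]) (use st * in \<open>auto intro!: derivative_eq_intros\<close>)
      from DERIV_cmult[OF this, of "s^k"]
      show "((\<lambda>x. s^k * F (Suc k) (s * x)) has_real_derivative s^Suc k * F (Suc (Suc k)) (s * x)) (at x within ball 0 e)"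
        by (auto simp: mult_ac intro: has_field_derivative_at_within)
    next
      fix x :: real assume "x \<in> ball 0 e"
      then show "(\<lambda>s. s^k * F (Suc k) (s * x)) integrable_on cbox 0 1"
        using st by (intro integrable_continuous continuous_intros continuous_on_compose2[OF cF]) auto
    next
      show "continuous_on (ball 0 e \<times> cbox 0 1) (\<lambda>(t, s). s^Suc k * F (Suc (Suc k)) (s * t))"
        unfolding case_prod_unfold
        using st by (intro continuous_intros continuous_on_compose2[OF cF]) auto
    qed (use t in auto)
    then show ?thesis using t by (simp add: I_def at_within_open[OF t])
  qed
  define u where "u = I 0"
  have "smooth_on (ball 0 e) u"
  proof (rule smooth_on_coinduct[where P="\<lambda>g. \<exists>k. g = I k"])
    fix g assume "\<exists>k. g = I k"
    then obtain k where "g = I k" by blast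
    then show "\<exists>g'. (\<exists>k. g' = I k) \<and> (\<forall>x\<in>ball 0 e. (g has_real_derivative g' x) (at x))"
      using I by (intro exI[of _ "I (Suc k)"]) blast
  qed (auto simp: u_def)
  moreover have "f t = f 0 + t * u t" if t: "t \<in> ball 0 e" for t
  proof -
    have "((\<lambda>s. t * F 1 (s * t)) has_integral f (1 * t) - f (0 * t)) {0..1}"
    proof (rule fundamental_theorem_of_calculus)
      fix s :: real assume s: "s \<in> {0..1}"
      have "((\<lambda>s. F 0 (s * t)) has_real_derivative F (Suc 0) (s * t) * t) (at s)"
        by (rule DERIV_chain2[OF F]) (use st[OF t s] in \<open>auto intro!: derivative_eq_intros\<close>)
      then show "((\<lambda>s. f (s * t)) has_vector_derivative t * F 1 (s * t)) (at s within {0..1})"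
        by (auto simp: F_def has_real_derivative_iff_has_vector_derivative mult_ac intro: has_vector_derivative_at_within)
    qed simp
    then have "integral {0..1} (\<lambda>s. t * F 1 (s * t)) = f t - f 0"
      by (simp only: integral_unique mult_1 mult_zero_left)
    then show ?thesis by (simp add: u_def I_def)
  qed
  moreover have "(deriv ^^ k) u 0 = (deriv ^^ Suc k) f 0 / real (Suc k)" for k
  proof -
    have "(deriv ^^ k) u 0 = I k 0"
      unfolding u_def by (rule iterated_deriv_eq[of "ball 0 e"]) (use I assms(1) in auto)
    also have "\<dots> = integral {0..1} (\<lambda>s. s^k) * F (Suc k) 0" by (simp add: I_def)
    also have "integral {0..1} (\<lambda>s::real. s^k) = 1 / real (Suc k)"
    proof (rule integral_unique)
      have "((\<lambda>s::real. s^k) has_integral 1^Suc k / real (Suc k) - 0^Suc k / real (Suc k)) {0..1}"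
      proof (rule fundamental_theorem_of_calculus)
        fix s :: real
        have "((\<lambda>s. s ^ Suc k / real (Suc k)) has_real_derivative s ^ k) (at s within {0..1})"
          by (rule derivative_eq_intros refl | simp)+
        then show "((\<lambda>s. s ^ Suc k / real (Suc k)) has_vector_derivative s ^ k) (at s within {0..1})"
          by (simp add: has_real_derivative_iff_has_vector_derivative)
      qed simp
      then show "((\<lambda>s::real. s^k) has_integral 1 / real (Suc k)) {0..1}" by simp
    qed
    finally show ?thesis by (simp add: F_def)
  qed
  ultimately show ?thesis using that by blast
qed

lemma iterated_deriv_cong:
  fixes f g :: "real \<Rightarrow> real"
  assumes "\<forall>\<^sub>F x in nhds 0. f x = g x"
  shows "\<forall>\<^sub>F x in nhds 0. (deriv ^^ k) f x = (deriv ^^ k) g x"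
proof (induction k)
  case (Suc k)
  then have "\<forall>\<^sub>F y in nhds 0. \<forall>\<^sub>F x in nhds y. (deriv ^^ k) f x = (deriv ^^ k) g x"
    by (simp add: eventually_eventually)
  then show ?case by eventually_elim (auto intro: deriv_cong_ev)
qed (use assms in auto)

lemma tc_cong:
  "\<forall>\<^sub>F x in nhds 0. f x = g x \<Longrightarrow> tc f k = tc g k"
  unfolding tc_def using eventually_nhds_x_imp_x[OF iterated_deriv_cong] by metis

lemma tc_0 [simp]: "tc f 0 = f 0"
  by (simp add: tc_def)

lemma tc_Suc_deriv: "tc f (Suc k) = tc (deriv f) k / real (Suc k)"
  unfolding tc_def funpow_Suc_right o_def fact_Suc by simp

lemma smooth_germ_ball:
  assumes "smooth_germ (f :: real \<Rightarrow> real)"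
  obtains e where "e > 0" "smooth_on (ball 0 e) f"
  using assms unfolding smooth_germ_def by (meson open_contains_ball smooth_on_subset)

lemma hadamard:
  assumes "smooth_germ (f :: real \<Rightarrow> real)"
  obtains u where "smooth_germ u" "\<forall>\<^sub>F t in nhds 0. f t = f 0 + t * u t" "\<And>k. tc u k = tc f (Suc k)"
proof -
  obtain e where e: "e > 0" "smooth_on (ball 0 e) f" using smooth_germ_ball[OF assms] .
  obtain u where u: "smooth_on (ball 0 e) u" "\<And>t. t \<in> ball 0 e \<Longrightarrow> f t = f 0 + t * u t"
    "\<And>k. (deriv ^^ k) u 0 = (deriv ^^ Suc k) f 0 / real (Suc k)"
    using hadamard_ball[OF e] by metis
  show ?thesis
  proof (rule that)
    show "smooth_germ u" using u(1) e(1) unfolding smooth_germ_def by (intro exI[of _ "ball 0 e"]) auto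
    have "\<forall>\<^sub>F t in nhds 0. t \<in> ball 0 e" using e(1) by (intro eventually_nhds_in_open) auto
    then show "\<forall>\<^sub>F t in nhds 0. f t = f 0 + t * u t" by eventually_elim (rule u(2))
    show "tc u k = tc f (Suc k)" for k by (simp add: tc_def u(3) del: funpow.simps)
  qed
qed

lemma vord_smooth:
  assumes "vord k f"
  shows "smooth_germ f"
proof -
  obtain u where u: "smooth_germ u" "\<forall>\<^sub>F t in nhds 0. f t = t^k * u t" using assms by (auto simp: vord_def)
  have "smooth_germ (\<lambda>t. t^k * u t)" by (intro smooth_intros u(1))
  then show ?thesis by (rule smooth_germ_cong) (use u(2) in \<open>eventually_elim, simp\<close>)
qed

lemma vordI: "smooth_germ u \<Longrightarrow> \<forall>\<^sub>F t in nhds 0. f t = t^k * u t \<Longrightarrow> vord k f"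
  by (auto simp: vord_def)

lemma vordE:
  assumes "vord k f"
  obtains u where "smooth_germ u" "\<forall>\<^sub>F t in nhds 0. f t = t^k * u t"
  using assms by (auto simp: vord_def)

lemma vord_0 [simp]: "vord 0 f \<longleftrightarrow> smooth_germ f"
  using vord_smooth vordI[of f f 0] by auto

lemma vord_cong:
  assumes "vord k f" "\<forall>\<^sub>F t in nhds 0. f t = g t"
  shows "vord k g"
proof -
  obtain u where u: "smooth_germ u" "\<forall>\<^sub>F t in nhds 0. f t = t^k * u t" using assms(1) by (rule vordE)
  show ?thesis by (rule vordI[OF u(1)]) (use u(2) assms(2) in \<open>eventually_elim, simp\<close>)
qed

lemma vord_add:
  assumes "vord k f" "vord k g"
  shows "vord k (\<lambda>t. f t + g t)"
proof -
  obtain u where u: "smooth_germ u" "\<forall>\<^sub>F t in nhds 0. f t = t^k * u t" using assms(1) by (rule vordE)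
  obtain v where v: "smooth_germ v" "\<forall>\<^sub>F t in nhds 0. g t = t^k * v t" using assms(2) by (rule vordE)
  show ?thesis
    by (rule vordI[OF smooth_germ_add[OF u(1) v(1)]])
      (use u(2) v(2) in \<open>eventually_elim, simp add: algebra_simps\<close>)
qed

lemma vord_mult:
  assumes "vord j f" "vord k g"
  shows "vord (j + k) (\<lambda>t. f t * g t)"
proof -
  obtain u where u: "smooth_germ u" "\<forall>\<^sub>F t in nhds 0. f t = t^j * u t" using assms(1) by (rule vordE)
  obtain v where v: "smooth_germ v" "\<forall>\<^sub>F t in nhds 0. g t = t^k * v t" using assms(2) by (rule vordE)
  show ?thesis
    by (rule vordI[OF smooth_germ_mult[OF u(1) v(1)]])
      (use u(2) v(2) in \<open>eventually_elim, simp add: algebra_simps power_add\<close>)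
qed

lemma vord_mult_smooth: "vord k f \<Longrightarrow> smooth_germ g \<Longrightarrow> vord k (\<lambda>t. f t * g t)"
  using vord_mult[of k f 0 g] by simp

lemma vord_cmult: "vord k f \<Longrightarrow> vord k (\<lambda>t. c * f t)"
  using vord_mult_smooth[of k f "\<lambda>t. c"] smooth_germ_const[of c] by (simp add: mult.commute)

lemma vord_minus: "vord k f \<Longrightarrow> vord k (\<lambda>t. - f t)"
  using vord_cmult[of k f "-1"] by simp

lemma vord_diff: "vord k f \<Longrightarrow> vord k g \<Longrightarrow> vord k (\<lambda>t. f t - g t)"
  using vord_add[OF _ vord_minus] by fastforce

lemma vord_power_t: "vord k (\<lambda>t. t^k)"
  by (rule vordI[of "\<lambda>t. 1"]) (auto intro: smooth_intros)

lemma vord_mono: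
  assumes "vord k f" "j \<le> k"
  shows "vord j f"
proof -
  obtain u where u: "smooth_germ u" "\<forall>\<^sub>F t in nhds 0. f t = t^k * u t" using assms(1) by (rule vordE)
  have "smooth_germ (\<lambda>t. t^(k-j) * u t)" by (intro smooth_intros u(1))
  then show ?thesis
    by (rule vordI) (use u(2) in \<open>eventually_elim, simp add: mult.assoc [symmetric] power_add [symmetric] assms(2)\<close>)
qed

lemma vord_const_zero [simp]: "vord k (\<lambda>t. 0)"
  by (rule vordI[of "\<lambda>t. 0"]) (auto intro: smooth_intros)

lemma vord_sum: "(\<And>i. i \<in> I \<Longrightarrow> vord k (f i)) \<Longrightarrow> vord k (\<lambda>t. \<Sum>i\<in>I. f i t)"
  by (induction I rule: infinite_finite_induct) (auto intro: vord_add)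

lemma vord_power: "vord k f \<Longrightarrow> vord (n * k) (\<lambda>t. f t ^ n)"
  by (induction n) (auto intro: vord_mult smooth_intros)

lemma vord_Suc_0_iff: "vord (Suc 0) f \<longleftrightarrow> smooth_germ f \<and> f 0 = 0"
proof
  assume "vord (Suc 0) f"
  then show "smooth_germ f \<and> f 0 = 0"
    using vord_smooth by (auto elim!: vordE dest: eventually_nhds_x_imp_x)
next
  assume f: "smooth_germ f \<and> f 0 = 0"
  then obtain u where "smooth_germ u" "\<forall>\<^sub>F t in nhds 0. f t = f 0 + t * u t" using hadamard by metis
  then show "vord (Suc 0) f" using f by (intro vordI) auto
qed

lemma vord_zero: "vord k f \<Longrightarrow> k > 0 \<Longrightarrow> f 0 = 0"
  using vord_mono[of k f "Suc 0"] by (simp add: vord_Suc_0_iff)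

lemma vord_compose_vord:
  assumes "vord k f" "vord j h" "0 < j"
  shows "vord (k * j) (\<lambda>t. f (h t))"
proof -
  obtain u where u: "smooth_germ u" "\<forall>\<^sub>F t in nhds 0. f t = t^k * u t" using assms(1) by (rule vordE)
  have h: "smooth_germ h" "h 0 = 0" using vord_smooth vord_zero assms by auto
  have "vord (k * j) (\<lambda>t. h t ^ k * u (h t))"
    by (rule vord_mult_smooth[OF vord_power[OF assms(2)] smooth_germ_compose[OF u(1) h]])
  then show ?thesis
    by (rule vord_cong) (use smooth_germ_eventually[OF h u(2)] in \<open>eventually_elim, simp\<close>)
qed

lemma vord_compose: "vord k f \<Longrightarrow> smooth_germ h \<Longrightarrow> h 0 = 0 \<Longrightarrow> vord k (\<lambda>t. f (h t))"
  using vord_compose_vord[of k f 1 h] by (simp add: vord_Suc_0_iff)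

section \<open>Algebra of Taylor coefficients\<close>

lemma tc_add:
  assumes "smooth_germ f" "smooth_germ g"
  shows "tc (\<lambda>t. f t + g t) k = tc f k + tc g k"
  using assms
proof (induction k arbitrary: f g)
  case (Suc k)
  have "\<forall>\<^sub>F x in nhds 0. deriv (\<lambda>t. f t + g t) x = deriv f x + deriv g x"
    using smooth_germ_DERIV[OF Suc.prems(1)] smooth_germ_DERIV[OF Suc.prems(2)]
    by eventually_elim (auto intro!: DERIV_imp_deriv DERIV_add)
  then have "tc (deriv (\<lambda>t. f t + g t)) k = tc (\<lambda>x. deriv f x + deriv g x) k" by (rule tc_cong)
  then show ?case
    using Suc by (simp add: tc_Suc_deriv smooth_germ_deriv add_divide_distrib)
qed simp

lemma tc_cmult:
  assumes "smooth_germ f"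
  shows "tc (\<lambda>t. c * f t) k = c * tc f k"
  using assms
proof (induction k arbitrary: f)
  case (Suc k)
  have "\<forall>\<^sub>F x in nhds 0. deriv (\<lambda>t. c * f t) x = c * deriv f x"
    using smooth_germ_DERIV[OF Suc.prems(1)]
    by eventually_elim (auto intro!: DERIV_imp_deriv DERIV_cmult)
  then have "tc (deriv (\<lambda>t. c * f t)) k = tc (\<lambda>x. c * deriv f x) k" by (rule tc_cong)
  then show ?case
    using Suc by (simp add: tc_Suc_deriv smooth_germ_deriv)
qed simp

lemma tc_diff:
  assumes "smooth_germ f" "smooth_germ g"
  shows "tc (\<lambda>t. f t - g t) k = tc f k - tc g k"
  using tc_add[OF assms(1) smooth_germ_cmult[OF assms(2), of "-1"], of k] tc_cmult[OF assms(2), of "-1" k] by simp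

text \<open>The Leibniz rule is avoided: the Hadamard quotient \<open>v\<close> of t u(t) has the
  shifted coefficients, and it agrees with \<open>u\<close> away from 0 by cancellation and at 0 by
  continuity.\<close>

lemma tc_times_t:
  assumes "smooth_germ u"
  shows "tc (\<lambda>t. t * u t) (Suc k) = tc u k"
proof -
  have s: "smooth_germ (\<lambda>t. t * u t)" using assms by (intro smooth_intros)
  obtain v where v: "smooth_germ v" "\<forall>\<^sub>F t in nhds 0. t * u t = 0 * u 0 + t * v t"
    "\<And>k. tc v k = tc (\<lambda>t. t * u t) (Suc k)" using hadamard[OF s] by metis
  have ev: "\<forall>\<^sub>F t in at 0. v t = u t"
    using v(2) unfolding eventually_at_filter by eventually_elim (simp, metis)
  have "(v \<longlongrightarrow> v 0) (at 0)" "(u \<longlongrightarrow> u 0) (at 0)"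
    using smooth_germ_continuous v(1) assms by (auto simp: isCont_def)
  then have "(u \<longlongrightarrow> v 0) (at 0)" by (simp only: tendsto_cong[OF ev])
  then have "v 0 = u 0" using \<open>(u \<longlongrightarrow> u 0) (at 0)\<close> by (rule tendsto_unique[OF trivial_limit_at])
  have "\<forall>\<^sub>F x in nhds 0. x \<noteq> 0 \<longrightarrow> x \<in> UNIV \<longrightarrow> v x = u x"
    using ev by (simp only: eventually_at_filter)
  then have "\<forall>\<^sub>F t in nhds 0. v t = u t"
  proof eventually_elim
    case (elim t)
    then show ?case using \<open>v 0 = u 0\<close> by (cases "t = 0") auto
  qed
  from tc_cong[OF this, of k] show ?thesis by (simp only: v(3))
qed

lemma tc_power_times:
  assumes "smooth_germ u"
  shows "tc (\<lambda>t. t^k * u t) i = (if i < k then 0 else tc u (i - k))"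
proof (induction k arbitrary: i)
  case (Suc k)
  show ?case
  proof (cases i)
    case (Suc j)
    have s: "smooth_germ (\<lambda>t. t^k * u t)" using assms by (intro smooth_intros)
    have "tc (\<lambda>t. t * (t^k * u t)) (Suc j) = tc (\<lambda>t. t^k * u t) j" by (rule tc_times_t[OF s])
    then show ?thesis using Suc Suc.IH by (simp add: mult.assoc)
  qed simp
qed simp

lemma vord_iff_tc: "vord k f \<longleftrightarrow> smooth_germ f \<and> (\<forall>i<k. tc f i = 0)"
proof
  assume "vord k f"
  then obtain u where u: "smooth_germ u" "\<forall>\<^sub>F t in nhds 0. f t = t^k * u t" by (rule vordE)
  have "tc f i = (if i < k then 0 else tc u (i - k))" for i
    using tc_cong[OF u(2)] tc_power_times[OF u(1)] by simp
  then show "smooth_germ f \<and> (\<forall>i<k. tc f i = 0)"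
    using vord_smooth[OF \<open>vord k f\<close>] by simp
next
  assume "smooth_germ f \<and> (\<forall>i<k. tc f i = 0)"
  then show "vord k f"
  proof (induction k arbitrary: f)
    case (Suc k)
    obtain u where u: "smooth_germ u" "\<forall>\<^sub>F t in nhds 0. f t = f 0 + t * u t" "\<And>k. tc u k = tc f (Suc k)"
      using hadamard Suc.prems by metis
    have "f 0 = 0" using Suc.prems by (metis tc_0 zero_less_Suc)
    have "vord k u" using u Suc by simp
    from vord_mult[OF vord_power_t[of 1] this] have "vord (Suc k) (\<lambda>t. t * u t)" by simp
    then show ?case by (rule vord_cong) (use u(2) in \<open>eventually_elim, simp add: \<open>f 0 = 0\<close>\<close>)
  qed auto
qed

lemma vord_tc: "vord k f \<Longrightarrow> i < k \<Longrightarrow> tc f i = 0"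
  by (simp add: vord_iff_tc)

lemma tc_monomial: "tc (\<lambda>t. c * t^k) i = (if i = k then c else 0)"
proof -
  have "tc (\<lambda>t. t^k * c) i = (if i < k then 0 else tc (\<lambda>t. c) (i - k))" by (rule tc_power_times) (intro smooth_intros)
  moreover have "tc (\<lambda>t. c) j = (if j = 0 then c else 0)" for j
  proof (cases j)
    case (Suc l)
    have "(deriv ^^ l) (\<lambda>t::real. 0) = (\<lambda>t. 0 :: real)" for l by (induction l) auto
    then show ?thesis using Suc by (simp add: tc_Suc_deriv) (simp add: tc_def)
  qed simp
  ultimately show ?thesis by (auto simp: mult.commute)
qed

lemma tc_sum: "(\<And>i. i \<in> I \<Longrightarrow> smooth_germ (f i)) \<Longrightarrow> tc (\<lambda>t. \<Sum>i\<in>I. f i t) k = (\<Sum>i\<in>I. tc (f i) k)"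
  using tc_monomial[of 0 0] by (induction I rule: infinite_finite_induct) (auto simp: tc_add smooth_germ_sum)

lemma taylor_vord:
  assumes "smooth_germ f"
  shows "vord k (\<lambda>t. f t - (\<Sum>i<k. tc f i * t^i))"
proof -
  have s: "smooth_germ (\<lambda>t::real. \<Sum>i<k. tc f i * t^i)" by (intro smooth_intros)
  have "tc (\<lambda>t. \<Sum>i<k. tc f i * t^i) j = tc f j" if "j < k" for j
    using that by (subst tc_sum) (auto simp: tc_monomial intro!: smooth_intros)
  then show ?thesis using assms s by (auto simp: vord_iff_tc tc_diff smooth_germ_diff)
qed

lemma vord_step:
  assumes "vord k f"
  shows "vord (Suc k) (\<lambda>t. f t - tc f k * t^k)"
proof -
  have "smooth_germ (\<lambda>t::real. tc f k * t^k)" by (intro smooth_intros)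
  then show ?thesis using assms by (auto simp: vord_iff_tc tc_diff smooth_germ_diff tc_monomial less_Suc_eq)
qed

text \<open>While \<open>j < k\<close>, the bound forces the quotient by t^j to tend to 0, hence to
  vanish at 0, so that one more factor t splits off. Estimates from mean value theorems are turned
  back into divisibility here.\<close>

lemma vord_of_bound:
  assumes "smooth_germ f" "\<forall>\<^sub>F t in nhds 0. \<bar>f t\<bar> \<le> C * \<bar>t\<bar>^k"
  shows "vord k f"
proof -
  have "vord j f" if "j \<le> k" for j
    using that
  proof (induction j)
    case (Suc j)
    then have "vord j f" by simp
    then obtain u where u: "smooth_germ u" "\<forall>\<^sub>F t in nhds 0. f t = t^j * u t" by (rule vordE)
    have "\<forall>\<^sub>F t in at 0. norm (u t) \<le> C * \<bar>t\<bar>^(k - j)"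
      using u(2) assms(2) unfolding eventually_at_filter
    proof eventually_elim
      case (elim t)
      show ?case
      proof (intro impI)
        assume "t \<noteq> 0"
        have "\<bar>t\<bar>^j * \<bar>u t\<bar> \<le> \<bar>t\<bar>^j * (C * \<bar>t\<bar>^(k - j))"
          using elim Suc.prems by (simp add: abs_mult power_abs mult.left_commute power_add [symmetric])
        then show "norm (u t) \<le> C * \<bar>t\<bar>^(k - j)" using \<open>t \<noteq> 0\<close> by simp
      qed
    qed
    moreover have "((\<lambda>t. C * \<bar>t\<bar>^(k - j)) \<longlongrightarrow> C * \<bar>0\<bar>^(k - j)) (at 0)"
      by (intro tendsto_intros)
    then have "((\<lambda>t. C * \<bar>t\<bar>^(k - j)) \<longlongrightarrow> 0) (at 0)" using Suc.prems by (simp add: power_0_left)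
    ultimately have "(u \<longlongrightarrow> 0) (at 0)" by (rule Lim_null_comparison)
    moreover have "(u \<longlongrightarrow> u 0) (at 0)" using smooth_germ_continuous u(1) by (auto simp: isCont_def)
    ultimately have "u 0 = 0" using tendsto_unique trivial_limit_at by metis
    then have "vord (Suc 0) u" using u(1) by (simp add: vord_Suc_0_iff)
    from vord_mult[OF vord_power_t[of j] this] have "vord (Suc j) (\<lambda>t. t^j * u t)" by simp
    then show "vord (Suc j) f"
      by (rule vord_cong) (use u(2) in \<open>eventually_elim, simp\<close>)
  qed (use assms in simp)
  then show ?thesis by simp
qed

lemma vord_bound:
  assumes "vord k f"
  obtains C where "C > 0" "\<forall>\<^sub>F t in nhds 0. \<bar>f t\<bar> \<le> C * \<bar>t\<bar>^k"
proof -
  obtain u where u: "smooth_germ u" "\<forall>\<^sub>F t in nhds 0. f t = t^k * u t" using assms by (rule vordE)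
  have "((\<lambda>t. \<bar>u t\<bar>) \<longlongrightarrow> \<bar>u 0\<bar>) (nhds 0)" by (intro tendsto_rabs smooth_germ_tendsto u(1))
  then have "\<forall>\<^sub>F t in nhds 0. \<bar>u t\<bar> < \<bar>u 0\<bar> + 1" by (rule order_tendstoD) simp
  with u(2) have "\<forall>\<^sub>F t in nhds 0. \<bar>f t\<bar> \<le> (\<bar>u 0\<bar> + 1) * \<bar>t\<bar>^k"
  proof eventually_elim
    case (elim t)
    have "\<bar>f t\<bar> = \<bar>u t\<bar> * \<bar>t\<bar>^k" using elim by (simp add: abs_mult power_abs)
    also have "\<dots> \<le> (\<bar>u 0\<bar> + 1) * \<bar>t\<bar>^k" using elim by (intro mult_right_mono) auto
    finally show ?case .
  qed
  then show ?thesis by (intro that[of "\<bar>u 0\<bar> + 1"]) auto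
qed

section \<open>Borel's theorem and flat functions\<close>

lemma smooth_on_mult:
  fixes f g :: "'a::real_normed_vector \<Rightarrow> real"
  shows "open U \<Longrightarrow> smooth_on U f \<Longrightarrow> smooth_on U g \<Longrightarrow> smooth_on U (\<lambda>x. f x * g x)"
  unfolding smooth_on_def using Ck_on_bilinear[OF bounded_bilinear_mult] by blast

lemma smooth_on_power:
  fixes f :: "'a::real_normed_vector \<Rightarrow> real"
  assumes "open U" "smooth_on U f"
  shows "smooth_on U (\<lambda>x. f x ^ n)"
proof (induction n)
  case 0
  show ?case unfolding smooth_on_def power_0 using Ck_on_const[OF assms(1)] by blast
qed (use assms smooth_on_mult in auto)

lemma smooth_on_trig: "smooth_on UNIV (\<lambda>x::real. sin x ^ a * cos x ^ b)"
  by (intro smooth_on_mult smooth_on_power smooth_on_sin smooth_on_cos) auto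

lemma iterated_deriv_lincomb:
  fixes f g :: "real \<Rightarrow> real"
  assumes "smooth_on UNIV f" "smooth_on UNIV g"
  shows "(deriv ^^ k) (\<lambda>x. a * f x - b * g x) x = a * (deriv ^^ k) f x - b * (deriv ^^ k) g x"
proof -
  have "(deriv ^^ k) ((\<lambda>k x. a * (deriv ^^ k) f x - b * (deriv ^^ k) g x) 0) x
      = (\<lambda>k x. a * (deriv ^^ k) f x - b * (deriv ^^ k) g x) k x"
  proof (rule iterated_deriv_eq[of UNIV])
    fix k x
    have "((deriv ^^ k) f has_real_derivative (deriv ^^ Suc k) f x) (at x)"
      "((deriv ^^ k) g has_real_derivative (deriv ^^ Suc k) g x) (at x)"
      using smooth_on_DERIV[OF smooth_on_iterated_deriv[OF open_UNIV]] assms by auto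
    then show "((\<lambda>x. a * (deriv ^^ k) f x - b * (deriv ^^ k) g x) has_real_derivative
        a * (deriv ^^ Suc k) f x - b * (deriv ^^ Suc k) g x) (at x)"
      by (intro DERIV_diff DERIV_cmult)
  qed auto
  then show ?thesis by simp
qed

text \<open>Differentiation preserves the total degree: sin^a cos^b becomes a sin^(a-1) cos^(b+1) -
  b sin^(a+1) cos^(b-1), so every derivative costs at most a factor a + b. The cases a = 0 and b = 0
  are split off because the natural subtraction truncates there.\<close>

lemma trig_iterated_deriv_bound:
  "\<bar>(deriv ^^ k) (\<lambda>x::real. sin x ^ a * cos x ^ b) x\<bar> \<le> real (a + b) ^ k"
proof (induction k arbitrary: a b)
  case 0
  have "\<bar>sin x\<bar> ^ a * \<bar>cos x\<bar> ^ b \<le> 1 * 1"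
    by (intro mult_mono power_le_one) auto
  then show ?case by (simp add: abs_mult power_abs)
next
  case (Suc k)
  let ?p = "\<lambda>x::real. sin x ^ (a - 1) * cos x ^ (b + 1)" and ?q = "\<lambda>x::real. sin x ^ (a + 1) * cos x ^ (b - 1)"
  have "((\<lambda>x::real. sin x ^ a * cos x ^ b) has_real_derivative real a * ?p x - real b * ?q x) (at x)" for x
    by (auto intro!: derivative_eq_intros simp: algebra_simps)
  then have d: "deriv (\<lambda>x::real. sin x ^ a * cos x ^ b) = (\<lambda>x. real a * ?p x - real b * ?q x)"
    by (intro ext DERIV_imp_deriv)
  have "(deriv ^^ Suc k) (\<lambda>x::real. sin x ^ a * cos x ^ b) x = (deriv ^^ k) (\<lambda>x. real a * ?p x - real b * ?q x) x"
    unfolding funpow_Suc_right o_def d ..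
  also have "\<dots> = real a * (deriv ^^ k) ?p x - real b * (deriv ^^ k) ?q x"
    by (rule iterated_deriv_lincomb) (rule smooth_on_trig)+
  also have "\<bar>\<dots>\<bar> \<le> real a * real (a + b) ^ k + real b * real (a + b) ^ k"
  proof -
    have "\<bar>real a * (deriv ^^ k) ?p x\<bar> \<le> real a * real (a + b) ^ k"
    proof (cases "a = 0")
      case False
      then show ?thesis using Suc[of "a - 1" "b + 1"] by (auto simp: abs_mult intro!: mult_left_mono)
    qed simp
    moreover have "\<bar>real b * (deriv ^^ k) ?q x\<bar> \<le> real b * real (a + b) ^ k"
    proof (cases "b = 0")
      case False
      then show ?thesis using Suc[of "a + 1" "b - 1"] by (auto simp: abs_mult intro!: mult_left_mono)
    qed simp
    ultimately show ?thesis by linarith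
  qed
  also have "\<dots> = real (a + b) ^ Suc k" by (simp add: algebra_simps)
  finally show ?case .
qed

text \<open>In Borel's theorem powers of the sine take the place of the usual cut-off monomials: the \<open>k\<close>-th
  derivative of \<open>sin ^ n\<close> is bounded by \<open>n ^ k\<close>.  As \<open>sin x ^ n\<close> has Taylor coefficients beyond the
  \<open>n\<close>-th, the coefficients of the series are found from a triangular system.\<close>

definition borel_scale :: "real \<Rightarrow> nat \<Rightarrow> real" where
  "borel_scale a n = 2 + real n + \<bar>a\<bar>"

definition borel_term :: "real \<Rightarrow> nat \<Rightarrow> real \<Rightarrow> real" where
  "borel_term a n x = a / borel_scale a n ^ n * sin (borel_scale a n * x) ^ n"

function borel_coeff :: "(nat \<Rightarrow> real) \<Rightarrow> nat \<Rightarrow> real" where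
  "borel_coeff c n = c n - (\<Sum>m<n. tc (borel_term (borel_coeff c m) m) n)"
  by auto
termination by (relation "Wellfounded.measure snd") auto

declare borel_coeff.simps [simp del]

lemma tc_borel_term:
  assumes "k \<le> n"
  shows "tc (borel_term a n) k = (if k = n then a else 0)"
proof -
  let ?l = "borel_scale a n"
  have l: "?l > 0" by (auto simp: borel_scale_def add_pos_nonneg)
  have "deriv sin = (cos :: real \<Rightarrow> real)" by (intro ext DERIV_imp_deriv) (auto intro: derivative_eq_intros)
  then have t1: "tc sin (Suc 0) = 1" by (simp add: tc_Suc_deriv)
  obtain S where S: "smooth_germ S" "\<forall>\<^sub>F t in nhds 0. sin t = sin 0 + t * S t" "\<And>k. tc S k = tc sin (Suc k)"
    using hadamard[OF smooth_germ_sin] by metis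
  have S0: "S 0 = 1" using S(3)[of 0] t1 by simp
  have sl: "smooth_germ (\<lambda>x. ?l * x)" by (intro smooth_intros)
  have "\<forall>\<^sub>F x in nhds 0. sin (?l * x) = sin 0 + (?l * x) * S (?l * x)"
    by (rule smooth_germ_eventually[OF sl _ S(2)]) simp
  then have "\<forall>\<^sub>F x in nhds 0. borel_term a n x = x ^ n * (a * S (?l * x) ^ n)"
    by eventually_elim (use l in \<open>simp add: borel_term_def power_mult_distrib\<close>)
  then have "tc (borel_term a n) k = tc (\<lambda>x. x ^ n * (a * S (?l * x) ^ n)) k" by (rule tc_cong)
  also have "\<dots> = (if k < n then 0 else tc (\<lambda>x. a * S (?l * x) ^ n) (k - n))"
    by (rule tc_power_times) (intro smooth_intros smooth_germ_compose[OF S(1) sl], simp)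
  finally show ?thesis using assms S0 by simp
qed

theorem borel:
  fixes c :: "nat \<Rightarrow> real"
  obtains f where "smooth_germ f" "\<And>k. tc f k = c k"
proof -
  define a where "a = borel_coeff c"
  define l where "l = (\<lambda>n. borel_scale (a n) n)"
  \<comment> \<open>The three inequalities give, in turn, geometric decay of the terms, absorption
    of the factor n^k from the derivative bound, and absorption of the coefficient
    \<open>a n\<close>.\<close>
  have l2: "l n \<ge> 2" "real n \<le> l n" "\<bar>a n\<bar> \<le> l n" for n by (auto simp: l_def borel_scale_def)
  define D where "D = (\<lambda>n k x. a n / l n ^ n * l n ^ k * (deriv ^^ k) (\<lambda>x. sin x ^ n) (l n * x))"
  have D: "(D n k has_real_derivative D n (Suc k) x) (at x)" for n k x
  proof -
    have "((deriv ^^ k) (\<lambda>x. sin x ^ n) has_real_derivative (deriv ^^ Suc k) (\<lambda>x. sin x ^ n) y) (at y)" for y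
      using smooth_on_DERIV[OF smooth_on_iterated_deriv[OF open_UNIV], of "\<lambda>x. sin x ^ n"] smooth_on_trig[of n 0] by simp
    then have "((\<lambda>x. (deriv ^^ k) (\<lambda>x. sin x ^ n) (l n * x)) has_real_derivative
        (deriv ^^ Suc k) (\<lambda>x. sin x ^ n) (l n * x) * l n) (at x)"
      by (rule DERIV_chain2) (auto intro!: derivative_eq_intros)
    from DERIV_cmult[OF this, of "a n / l n ^ n * l n ^ k"] show ?thesis
      by (simp add: D_def mult_ac del: funpow.simps)
  qed
  \<comment> \<open>The exponent 2k + 1 counts k factors from the chain rule, k from the derivative
    bound and one for \<open>a n\<close>; it does not depend on n, so for n beyond it the quotient
    decays geometrically.\<close>
  have bnd: "norm (D n k x) \<le> l n ^ (2 * k + 1) / l n ^ n" for n k x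
  proof -
    have "\<bar>(deriv ^^ k) (\<lambda>x::real. sin x ^ n) (l n * x)\<bar> \<le> real n ^ k"
      using trig_iterated_deriv_bound[of k n 0] by simp
    also have "\<dots> \<le> l n ^ k" using l2 by (intro power_mono) auto
    finally have "\<bar>a n\<bar> * (l n ^ k * \<bar>(deriv ^^ k) (\<lambda>x::real. sin x ^ n) (l n * x)\<bar>) \<le> l n * (l n ^ k * l n ^ k)"
      using l2[of n] by (intro mult_mono) auto
    then have "\<bar>a n\<bar> * (l n ^ k * \<bar>(deriv ^^ k) (\<lambda>x::real. sin x ^ n) (l n * x)\<bar>) / l n ^ n \<le> l n ^ (2 * k + 1) / l n ^ n"
      using l2[of n] by (intro divide_right_mono) (auto simp: mult_2 power_add)
    then show ?thesis using l2[of n] by (simp add: D_def abs_mult power_abs)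
  qed
  have sM: "summable (\<lambda>n. l n ^ (2 * k + 1) / l n ^ n)" for k
  proof (rule summable_comparison_test)
    show "\<exists>N. \<forall>n\<ge>N. norm (l n ^ (2 * k + 1) / l n ^ n) \<le> 2 ^ (2 * k + 1) * (1/2) ^ n"
    proof (intro exI allI impI)
      fix n assume n: "n \<ge> 2 * k + 1"
      have e: "y ^ (2 * k + 1) / y ^ n = 1 / y ^ (n - (2 * k + 1))" if "y > 0" for y :: real
        using that n by (simp add: power_diff)
      have "l n ^ (2 * k + 1) / l n ^ n = 1 / l n ^ (n - (2 * k + 1))" using l2[of n] by (intro e) auto
      also have "\<dots> \<le> 1 / 2 ^ (n - (2 * k + 1))"
        using l2[of n] by (intro divide_left_mono power_mono) auto
      also have "\<dots> = 2 ^ (2 * k + 1) / 2 ^ n" using e[of 2] by simp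
      finally have "l n ^ (2 * k + 1) / l n ^ n \<le> 2 ^ (2 * k + 1) / 2 ^ n" .
      moreover have "l n ^ (2 * k + 1) / l n ^ n \<ge> 0"
        using l2[of n] by (intro divide_nonneg_nonneg zero_le_power) auto
      ultimately show "norm (l n ^ (2 * k + 1) / l n ^ n) \<le> 2 ^ (2 * k + 1) * (1/2) ^ n"
        by (simp only: real_norm_def abs_of_nonneg power_one_over times_divide_eq_right mult_1_right)
    qed
    show "summable (\<lambda>n. 2 ^ (2 * k + 1) * (1 / 2 :: real) ^ n)" by (intro summable_mult summable_geometric) simp
  qed
  define F where "F = (\<lambda>k x. \<Sum>n. D n k x)"
  have F: "(F k has_real_derivative F (Suc k) x) (at x)" for k x
  proof -
    have uc: "uniformly_convergent_on UNIV (\<lambda>N x. \<Sum>n<N. D n (Suc k) x)"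
      by (rule Weierstrass_m_test'[OF bnd sM])
    have su: "summable (\<lambda>n. D n k 0)"
      by (rule summable_comparison_test[OF _ sM[of k]]) (use bnd in blast)
    show ?thesis unfolding F_def
      by (rule has_field_derivative_series'(2)[where S=UNIV and ?x0.0=0])
        (use uc su in \<open>auto intro: D\<close>)
  qed
  have "smooth_on UNIV (F 0)"
  proof (rule smooth_on_coinduct[where P="\<lambda>g. \<exists>k. g = F k"])
    fix g assume "\<exists>k. g = F k"
    then obtain k where "g = F k" by blast
    then show "\<exists>g'. (\<exists>k. g' = F k) \<and> (\<forall>x\<in>UNIV. (g has_real_derivative g' x) (at x))"
      using F by (intro exI[of _ "F (Suc k)"]) blast
  qed auto
  then have "smooth_germ (F 0)" unfolding smooth_germ_def by blast
  moreover have "tc (F 0) k = c k" for k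
  proof -
    have Dt: "D n k 0 = fact k * tc (borel_term (a n) n) k" for n
    proof -
      have "(deriv ^^ k) (D n 0) 0 = D n k 0" by (rule iterated_deriv_eq[of UNIV]) (use D in auto)
      moreover have "D n 0 = borel_term (a n) n" by (simp add: D_def borel_term_def l_def fun_eq_iff)
      ultimately show ?thesis by (simp add: tc_def)
    qed
    have "(deriv ^^ k) (F 0) 0 = F k 0" by (rule iterated_deriv_eq[of UNIV]) (use F in auto)
    \<comment> \<open>Terms of index above k vanish to order greater than k at 0, so the series
      collapses there, and the recursion for \<open>borel_coeff\<close> closes the equation.\<close>
    also have "\<dots> = (\<Sum>n<Suc k. D n k 0)"
      unfolding F_def by (rule suminf_finite) (auto simp: Dt tc_borel_term)
    also have "\<dots> = fact k * ((\<Sum>n<k. tc (borel_term (a n) n) k) + a k)"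
      by (simp add: Dt tc_borel_term sum_distrib_left distrib_left)
    also have "(\<Sum>n<k. tc (borel_term (a n) n) k) + a k = c k"
      unfolding a_def by (subst (2) borel_coeff.simps) simp
    finally show ?thesis by (simp add: tc_def)
  qed
  ultimately show ?thesis using that by blast
qed

text \<open>The fourth root is singular at 0, but the derivative of c r(x^(1/4)) is (c/4) w(x^(1/4))
  with r'(t) = t^3 w(t), and the quotient \<open>w\<close> of a flat function is again flat. Hence
  the functions \<open>G c r\<close> with flat \<open>r\<close> form a class closed under
  differentiation.\<close>

lemma smooth_germ_flat_root4:
  fixes r :: "real \<Rightarrow> real"
  assumes "smooth_germ r" "\<And>k. tc r k = 0"
  shows "smooth_germ (\<lambda>x. if x > 0 then r (root 4 x) else 0)"
proof -
  obtain e where e: "e > 0" "smooth_on (ball 0 e) r" using smooth_germ_ball[OF assms(1)] .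
  define FL where "FL = (\<lambda>r::real \<Rightarrow> real. smooth_on (ball 0 e) r \<and> (\<forall>k. (deriv ^^ k) r 0 = 0))"
  have FLdiv: "\<exists>u. FL u \<and> (\<forall>t\<in>ball 0 e. r t = t^n * u t)" if "FL r" for r n
    using that
  proof (induction n arbitrary: r)
    case 0
    then show ?case by auto
  next
    case (Suc n)
    then have r: "smooth_on (ball 0 e) r" "\<And>k. (deriv ^^ k) r 0 = 0" by (auto simp: FL_def)
    obtain u where u: "smooth_on (ball 0 e) u" "\<And>t. t \<in> ball 0 e \<Longrightarrow> r t = r 0 + t * u t"
      "\<And>k. (deriv ^^ k) u 0 = (deriv ^^ Suc k) r 0 / real (Suc k)"
      using hadamard_ball[OF e(1) r(1)] by metis
    have "FL u" unfolding FL_def using u(1,3) r(2) by (simp del: funpow.simps)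
    then obtain v where "FL v" "\<forall>t\<in>ball 0 e. u t = t^n * v t" using Suc.IH by blast
    moreover have "r 0 = 0" using r(2)[of 0] by simp
    ultimately show ?case using u(2) by (intro exI[of _ v]) auto
  qed
  have FLd: "FL (deriv r)" if "FL r" for r
  proof -
    have "(deriv ^^ k) (deriv r) = (deriv ^^ Suc k) r" for k by (simp only: funpow_Suc_right o_def)
    then show ?thesis using that smooth_on_deriv[OF open_ball] by (simp add: FL_def del: funpow.simps)
  qed
  have "FL r" using e(2) assms(2) by (simp add: FL_def tc_def)
  define V where "V = {- (e^4) <..< e^4}"
  define G where "G = (\<lambda>c r x. if x > 0 then c * r (root 4 x) else (0::real))"
  have rt: "root 4 x \<in> ball 0 e" "root 4 x > 0" if "x \<in> V" "x > 0" for x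
  proof -
    show "root 4 x > 0" using that by simp
    have "root 4 x < root 4 (e^4)" using that by (subst real_root_less_iff) (auto simp: V_def)
    then show "root 4 x \<in> ball 0 e" using \<open>root 4 x > 0\<close> e(1) by (simp add: real_root_power_cancel)
  qed
  have step: "\<exists>c' r'. FL r' \<and> (\<forall>x\<in>V. (G c r has_real_derivative G c' r' x) (at x))" if r: "FL r" for c r
  proof -
    obtain w where w: "FL w" "\<And>t. t \<in> ball 0 e \<Longrightarrow> deriv r t = t^3 * w t" using FLdiv[OF FLd[OF r]] by blast
    obtain u where u: "FL u" "\<And>t. t \<in> ball 0 e \<Longrightarrow> r t = t^4 * u t" using FLdiv[OF r] by blast
    have "(G c r has_real_derivative G (c/4) w x) (at x)" if x: "x \<in> V" for x
    proof -
      consider "x > 0" | "x < 0" | "x = 0" by linarith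
      then show ?thesis
      proof cases
        case 1
        have "(root 4 has_real_derivative inverse (real 4 * root 4 x ^ (4 - Suc 0))) (at x)"
          using 1 by (intro DERIV_real_root) auto
        moreover have "(r has_real_derivative deriv r (root 4 x)) (at (root 4 x))"
          using smooth_on_DERIV[of "ball 0 e" r] r rt[OF x 1] by (auto simp: FL_def)
        ultimately have "((\<lambda>x. c * r (root 4 x)) has_real_derivative
            c * (deriv r (root 4 x) * inverse (real 4 * root 4 x ^ (4 - Suc 0)))) (at x)"
          by (intro DERIV_cmult DERIV_chain2)
        also have "c * (deriv r (root 4 x) * inverse (real 4 * root 4 x ^ (4 - Suc 0))) = G (c/4) w x"
          using 1 rt[OF x 1] w(2)[OF rt(1)[OF x 1]] by (simp add: G_def field_simps)
        finally show ?thesis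
          by (rule has_field_derivative_transform_within_open[of _ _ _ "{0<..}"]) (use 1 in \<open>auto simp: G_def\<close>)
      next
        case 2
        have "((\<lambda>x. 0) has_real_derivative G (c/4) w x) (at x)" using 2 by (simp add: G_def)
        then show ?thesis
          by (rule has_field_derivative_transform_within_open[of _ _ _ "{..<0}"]) (use 2 in \<open>auto simp: G_def\<close>)
      next
        \<comment> \<open>With r(t) = t^4 u(t) the difference quotient at 0 from the right is c
          u(h^(1/4)), which tends to u(0) = 0.\<close>
        case 3
        have u0: "u 0 = 0" using u(1) unfolding FL_def by (metis funpow_0)
        have "isCont u 0" using u(1) smooth_on_continuous[of "ball 0 e" u] e(1)
          by (auto simp: FL_def continuous_on_eq_continuous_at)
        moreover have "((\<lambda>h::real. root 4 \<bar>h\<bar>) \<longlongrightarrow> root 4 \<bar>0\<bar>) (at 0)" by (intro tendsto_intros)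
        ultimately have "((\<lambda>h. u (root 4 \<bar>h\<bar>)) \<longlongrightarrow> u 0) (at 0)"
          by (intro isCont_tendsto_compose[of 0 u]) simp_all
        then have lim: "((\<lambda>h. c * u (root 4 \<bar>h\<bar>)) \<longlongrightarrow> 0) (at 0)"
          using tendsto_mult_left[of _ "u 0" "at 0" c] u0 by simp
        have "\<forall>\<^sub>F h in nhds 0. h \<in> V" using e(1) by (intro eventually_nhds_in_open) (auto simp: V_def)
        then have "\<forall>\<^sub>F h in at 0. norm ((G c r (0 + h) - G c r 0) / h) \<le> \<bar>c * u (root 4 \<bar>h\<bar>)\<bar>"
          unfolding eventually_at_filter
        proof eventually_elim
          case (elim h)
          show ?case
          proof (intro impI)
            assume "h \<noteq> 0"
            show "norm ((G c r (0 + h) - G c r 0) / h) \<le> \<bar>c * u (root 4 \<bar>h\<bar>)\<bar>"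
            proof (cases "h > 0")
              case True
              then have "r (root 4 h) = h * u (root 4 h)" using u(2)[OF rt(1)[OF elim True]] by simp
              then show ?thesis using True by (simp add: G_def abs_mult)
            qed (simp add: G_def)
          qed
        qed
        then have "((\<lambda>h. (G c r (0 + h) - G c r 0) / h) \<longlongrightarrow> 0) (at 0)"
          by (rule Lim_null_comparison) (use tendsto_rabs_zero[OF lim] in simp)
        then have "(G c r has_real_derivative 0) (at 0)" unfolding DERIV_def .
        then show ?thesis using 3 by (simp add: G_def)
      qed
    qed
    then show ?thesis using w(1) by blast
  qed
  have "smooth_on V (G 1 r)"
  proof (rule smooth_on_coinduct[where P="\<lambda>g. \<exists>c r. FL r \<and> g = G c r"])
    show "open V" by (simp add: V_def)
    show "\<exists>c r'. FL r' \<and> G 1 r = G c r'" using \<open>FL r\<close> by blast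
    fix g assume "\<exists>c r. FL r \<and> g = G c r"
    then show "\<exists>g'. (\<exists>c r. FL r \<and> g' = G c r) \<and> (\<forall>x\<in>V. (g has_real_derivative g' x) (at x))"
      using step by metis
  qed
  moreover have "open V" "0 \<in> V" using e(1) by (auto simp: V_def)
  moreover have "G 1 r = (\<lambda>x. if x > 0 then r (root 4 x) else 0)" by (auto simp: G_def)
  ultimately show ?thesis unfolding smooth_germ_def by auto
qed

section \<open>Functions on the curve and finite determinacy\<close>

text \<open>A triangular system: t^j w_j(t) has order exactly j, so each coefficient of
  \<open>u\<close> in turn determines one constant \<open>c j\<close>.\<close>

lemma preparation_step:
  fixes w :: "nat \<Rightarrow> real \<Rightarrow> real"
  assumes w: "\<And>j. j < k \<Longrightarrow> smooth_germ (w j)" "\<And>j. j < k \<Longrightarrow> w j 0 \<noteq> 0"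
    and u: "smooth_germ u"
  shows "\<exists>c. vord k (\<lambda>t. u t - (\<Sum>j<k. c j * (t^j * w j t)))"
proof -
  have "n \<le> k \<Longrightarrow> \<exists>c. vord n (\<lambda>t. u t - (\<Sum>j<n. c j * (t^j * w j t)))" for n
  proof (induction n)
    case (Suc n)
    then obtain c where c: "vord n (\<lambda>t. u t - (\<Sum>j<n. c j * (t^j * w j t)))" by auto
    let ?f = "\<lambda>t. u t - (\<Sum>j<n. c j * (t^j * w j t))"
    define a where "a = tc ?f n / w n 0"
    have wn: "smooth_germ (w n)" "w n 0 \<noteq> 0" using w Suc.prems by auto
    have "vord (Suc 0) (\<lambda>t. tc ?f n - a * w n t)"
      unfolding vord_Suc_0_iff by (intro conjI smooth_intros wn(1)) (use wn(2) in \<open>simp add: a_def\<close>)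
    from vord_mult[OF vord_power_t[of n] this]
    have "vord (Suc n) (\<lambda>t. t^n * (tc ?f n - a * w n t))" by simp
    from vord_add[OF vord_step[OF c] this]
    have "vord (Suc n) (\<lambda>t. u t - (\<Sum>j<Suc n. (c(n := a)) j * (t^j * w j t)))"
      by (simp add: algebra_simps)
    then show ?case by blast
  qed (use u in simp)
  then show ?thesis by simp
qed

text \<open>The Malgrange preparation theorem for the fourth power map.  The Taylor coefficients
  are matched by Borel's theorem; the flat remainder only needs \<open>w 0\<close> and \<open>w 1\<close>, by solving the
  linear system for the values at \<open>t\<close> and \<open>- t\<close>.\<close>

theorem preparation:
  fixes w :: "nat \<Rightarrow> real \<Rightarrow> real"
  assumes w: "\<And>j. j < 4 \<Longrightarrow> smooth_germ (w j)" "\<And>j. j < 4 \<Longrightarrow> w j 0 \<noteq> 0"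
    and u: "smooth_germ u"
  shows "\<exists>B. (\<forall>j. smooth_germ (B j)) \<and>
    (\<forall>\<^sub>F t in nhds 0. u t = (\<Sum>j<4. B j (t^4) * (t^j * w j t)))"
proof -
  let ?W = "\<lambda>c t. \<Sum>j<4. c j * (t^j * w j t)"
  define P where "P = (\<lambda>u c v. smooth_germ v \<and> (\<forall>\<^sub>F t in nhds 0. u t = ?W c t + t^4 * v t))"
  have "\<exists>c v. smooth_germ u \<longrightarrow> P u c v" for u :: "real \<Rightarrow> real"
  proof (cases "smooth_germ u")
    case True
    obtain c where "vord 4 (\<lambda>t. u t - ?W c t)" using preparation_step[of 4 w u] w True by auto
    then obtain v where v: "smooth_germ v" "\<forall>\<^sub>F t in nhds 0. u t - ?W c t = t^4 * v t" by (rule vordE)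
    from v(2) have "\<forall>\<^sub>F t in nhds 0. u t = ?W c t + t^4 * v t" by eventually_elim linarith
    then show ?thesis using v(1) unfolding P_def by blast
  qed auto
  \<comment> \<open>\<open>C\<close> and \<open>N\<close> choose the coefficients and the quotient
    of one division modulo t^4. Iterating \<open>N\<close> produces the formal coefficients that
    Borel's theorem then realizes by germs in t^4.\<close>
  then obtain C N where "\<And>u. smooth_germ u \<Longrightarrow> P u (C u) (N u)" by metis
  then have CN: "smooth_germ (N u)" "\<forall>\<^sub>F t in nhds 0. u t = ?W (C u) t + t^4 * N u t"
    if "smooth_germ u" for u using that unfolding P_def by blast+
  define U where "U = (\<lambda>i. (N ^^ i) u)"
  have U: "smooth_germ (U i)" for i by (induction i) (use u CN in \<open>auto simp: U_def\<close>)
  have ser: "\<forall>\<^sub>F t in nhds 0. u t = (\<Sum>i<L. t^(4*i) * ?W (C (U i)) t) + t^(4*L) * U L t" for L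
  proof (induction L)
    case (Suc L)
    have "\<forall>\<^sub>F t in nhds 0. U L t = ?W (C (U L)) t + t^4 * U (Suc L) t"
      using CN(2)[OF U[of L]] by (simp add: U_def)
    with Suc show ?case
    proof eventually_elim
      case (elim t)
      have "t^(4*L) * U L t = t^(4*L) * ?W (C (U L)) t + t^(4*L) * t^4 * U (Suc L) t"
        by (subst elim(2)) (simp only: distrib_left mult.assoc)
      also have "t^(4*L) * t^4 = t^(4 * Suc L)" by (simp add: power_add [symmetric] add.commute)
      finally show ?case by (subst elim(1)) simp
    qed
  qed (simp add: U_def)
  have "\<exists>B. smooth_germ B \<and> (\<forall>i. tc B i = C (U i) j)" for j
    using borel[of "\<lambda>i. C (U i) j"] by metis
  then obtain B0 where B0: "\<And>j. smooth_germ (B0 j)" "\<And>j i. tc (B0 j) i = C (U i) j" by metis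
  have s4: "smooth_germ (\<lambda>t::real. t^4)" by (intro smooth_intros)
  have sB4: "smooth_germ (\<lambda>t. B0 j (t^4))" for j by (rule smooth_germ_compose[OF B0(1) s4]) simp
  define \<rho> where "\<rho> = (\<lambda>t. u t - (\<Sum>j<4. B0 j (t^4) * (t^j * w j t)))"
  have s\<rho>: "smooth_germ \<rho>"
    unfolding \<rho>_def by (intro smooth_intros u sB4 w) auto
  have "vord (4 * L) \<rho>" for L
  proof -
    have T: "vord (4 * L) (\<lambda>t. B0 j (t^4) - (\<Sum>i<L. C (U i) j * (t^4)^i))" for j
      using vord_compose_vord[OF taylor_vord[OF B0(1)[of j], of L] vord_power_t[of 4]]
      by (simp add: B0(2) mult.commute)
    have "vord (4 * L) (\<lambda>t. t^(4*L) * U L t - (\<Sum>j<4. (B0 j (t^4) - (\<Sum>i<L. C (U i) j * (t^4)^i)) * (t^j * w j t)))"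
      by (intro vord_diff vord_mult_smooth[OF vord_power_t U] vord_sum vord_mult_smooth[OF T] smooth_intros w) auto
    then show ?thesis
    proof (rule vord_cong)
      show "\<forall>\<^sub>F t in nhds 0. t^(4*L) * U L t - (\<Sum>j<4. (B0 j (t^4) - (\<Sum>i<L. C (U i) j * (t^4)^i)) * (t^j * w j t)) = \<rho> t"
        using ser[of L]
      proof eventually_elim
        case (elim t)
        have "(\<Sum>i<L. t^(4*i) * ?W (C (U i)) t) = (\<Sum>i<L. \<Sum>j<4. (C (U i) j * (t^4)^i) * (t^j * w j t))"
          unfolding sum_distrib_left power_mult by (intro sum.cong refl) (simp only: mult_ac)
        also have "\<dots> = (\<Sum>j<4. (\<Sum>i<L. C (U i) j * (t^4)^i) * (t^j * w j t))"
          unfolding sum_distrib_right by (rule sum.swap)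
        finally show ?case
          unfolding \<rho>_def left_diff_distrib sum_subtractf using elim by linarith
      qed
    qed
  qed
  then have flat: "vord k \<rho>" for k by (rule vord_mono[of "4 * k"]) simp
  have m: "smooth_germ (\<lambda>t::real. - t)" by (intro smooth_intros)
  have w01: "smooth_germ (w 0)" "smooth_germ (w 1)" "w 0 0 \<noteq> 0" "w 1 0 \<noteq> 0" using w by auto
  have wm: "smooth_germ (\<lambda>t. w 0 (- t))" "smooth_germ (\<lambda>t. w 1 (- t))"
    by (rule smooth_germ_compose[OF w01(1) m], simp, rule smooth_germ_compose[OF w01(2) m], simp)
  have \<rho>m: "vord k (\<lambda>t. \<rho> (- t))" for k by (rule vord_compose[OF flat m]) simp
  \<comment> \<open>With a even and b0 odd, the equation \<rho>(t) = a(t) w_0(t) + b0(t) w_1(t) at t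
    and at -t is a linear system for a(t), b0(t). Up to sign, \<open>\<delta>\<close> is its
    determinant; it equals 2 w_0(0) w_1(0) at 0.\<close>
  define \<delta> where "\<delta> = (\<lambda>t. w 0 t * w 1 (- t) + w 0 (- t) * w 1 t)"
  have \<delta>: "smooth_germ \<delta>" "\<delta> 0 \<noteq> 0"
    unfolding \<delta>_def by (intro smooth_intros wm w01) (use w01 in simp)
  have sd: "smooth_germ (\<lambda>t. 1 / \<delta> t)" by (rule smooth_germ_divide[OF smooth_germ_const \<delta>])
  define a where "a = (\<lambda>t. (\<rho> t * w 1 (- t) + \<rho> (- t) * w 1 t) * (1 / \<delta> t))"
  define b0 where "b0 = (\<lambda>t. (\<rho> t * w 0 (- t) - \<rho> (- t) * w 0 t) * (1 / \<delta> t))"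
  have a: "vord k a" for k unfolding a_def
    by (intro vord_mult_smooth[OF _ sd] vord_add vord_mult_smooth[OF flat] vord_mult_smooth[OF \<rho>m] wm w01)
  have b0: "vord k b0" for k unfolding b0_def
    by (intro vord_mult_smooth[OF _ sd] vord_diff vord_mult_smooth[OF flat] vord_mult_smooth[OF \<rho>m] wm w01)
  obtain b where b: "smooth_germ b" "\<forall>\<^sub>F t in nhds 0. b0 t = b0 0 + t * b t" "\<And>k. tc b k = tc b0 (Suc k)"
    using hadamard[OF vord_smooth[OF b0[of 0]]] by metis
  have zero: "a 0 = 0" "b0 0 = 0" using vord_zero[OF a[of 1]] vord_zero[OF b0[of 1]] by auto
  have even: "a (- t) = a t" "b0 (- t) = - b0 t" for t
    by (simp_all add: a_def b0_def \<delta>_def divide_simps) (simp_all add: algebra_simps)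
  let ?r = "\<lambda>f x. if x > 0 then f (root 4 x) else (0::real)"
  have sA: "smooth_germ (?r a)"
    by (rule smooth_germ_flat_root4) (use vord_smooth[OF a] vord_tc[OF a] in blast)+
  have sB: "smooth_germ (?r b)"
    by (rule smooth_germ_flat_root4[OF b(1)]) (use b(3) vord_tc[OF b0] in \<open>metis lessI\<close>)
  have r4: "root 4 (t^4) = \<bar>t\<bar>" for t :: real
    using real_root_power_cancel[of 4 "\<bar>t\<bar>"] by simp
  \<comment> \<open>The even functions a and b = b0/t depend on the absolute value of t, the fourth
    root of t^4, and being flat they stay smooth as functions of t^4. The factor t split off from b0
    is the t^1 that accompanies w_1.\<close>
  define B where "B = (\<lambda>j. if j = 0 then (\<lambda>x. B0 j x + ?r a x) else if j = 1 then (\<lambda>x. B0 j x + ?r b x) else B0 j)"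
  have "smooth_germ (B j)" for j
    unfolding B_def using B0(1) sA sB by (auto intro: smooth_germ_add)
  moreover have "\<forall>\<^sub>F t in nhds 0. u t = (\<Sum>j<4. B j (t^4) * (t^j * w j t))"
  proof -
    have "\<forall>\<^sub>F t in nhds 0. b0 (- t) = b0 0 + (- t) * b (- t)"
      by (rule smooth_germ_eventually[OF m _ b(2)]) simp
    moreover have "\<forall>\<^sub>F t in nhds 0. \<delta> t \<noteq> 0"
      using smooth_germ_tendsto[OF \<delta>(1)] \<delta>(2) by (rule tendsto_imp_eventually_ne)
    ultimately show ?thesis using b(2)
    proof eventually_elim
      case (elim t)
      have A: "?r a (t^4) = a t"
        using even(1)[of t] zero by (cases "t \<ge> 0") (auto simp: r4 abs_if zero_less_power_eq)
      have Bt: "?r b (t^4) * t = b0 t"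
        using even(2)[of t] zero elim by (cases "t \<ge> 0") (auto simp: r4 abs_if mult.commute)
      have \<rho>t: "\<rho> t = a t * w 0 t + b0 t * w 1 t"
      proof -
        define d where "d = 1 / \<delta> t"
        have "a t * w 0 t + b0 t * w 1 t = \<rho> t * (w 0 t * w 1 (- t) + w 0 (- t) * w 1 t) * d"
          unfolding a_def b0_def d_def [symmetric] by (simp add: algebra_simps)
        also have "w 0 t * w 1 (- t) + w 0 (- t) * w 1 t = \<delta> t" by (simp add: \<delta>_def)
        also have "\<rho> t * \<delta> t * d = \<rho> t" using elim(2) by (simp add: d_def)
        finally show ?thesis ..
      qed
      have "(\<Sum>j<4. B j (t^4) * (t^j * w j t)) = (\<Sum>j<4. B0 j (t^4) * (t^j * w j t)) + ?r a (t^4) * w 0 t + ?r b (t^4) * t * w 1 t"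
        by (simp add: B_def eval_nat_numeral algebra_simps)
      also have "\<dots> = (\<Sum>j<4. B0 j (t^4) * (t^j * w j t)) + \<rho> t" by (simp only: A Bt \<rho>t add.assoc)
      finally show ?case by (simp add: \<rho>_def)
    qed
  qed
  ultimately show ?thesis by blast
qed

text \<open>The first coordinate of the curve is t^4, so four plane functions whose restrictions
  have the consecutive orders N, ..., N + 3 generate, over the germs in that coordinate, everything
  divisible by t^N.\<close>

lemma curve_function:
  fixes E :: "nat \<Rightarrow> real \<times> real \<Rightarrow> real" and q r :: "real \<Rightarrow> real"
  assumes E: "\<And>j. j < 4 \<Longrightarrow> smooth_germ (E j)"
    and w: "\<And>j. j < 4 \<Longrightarrow> smooth_germ (w j)" "\<And>j. j < 4 \<Longrightarrow> w j 0 \<noteq> 0"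
    and Ew: "\<And>j. j < 4 \<Longrightarrow> \<forall>\<^sub>F t in nhds 0. E j (t^4, q t) = t^(N + j) * w j t"
    and r: "vord N r"
  obtains R where "smooth_germ R" "\<forall>\<^sub>F t in nhds 0. R (t^4, q t) = r t"
proof -
  obtain u where u: "smooth_germ u" "\<forall>\<^sub>F t in nhds 0. r t = t^N * u t" using r by (rule vordE)
  obtain B where B: "\<And>j. smooth_germ (B j)"
    "\<forall>\<^sub>F t in nhds 0. u t = (\<Sum>j<4. B j (t^4) * (t^j * w j t))"
    using preparation[of w u, OF w u(1)] by blast
  define R where "R = (\<lambda>p. \<Sum>j<4. B j (fst p) * E j p)"
  have f: "smooth_germ (\<lambda>p::real\<times>real. fst p)" by (intro smooth_intros)
  have "smooth_germ (\<lambda>p::real\<times>real. B j (fst p))" for j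
    by (rule smooth_germ_compose[OF B(1) f]) simp
  then have "smooth_germ R" unfolding R_def by (intro smooth_germ_sum smooth_germ_mult E) auto
  moreover have "\<forall>\<^sub>F t in nhds 0. \<forall>j\<in>{..<4}. E j (t^4, q t) = t^(N + j) * w j t"
    using Ew by (intro eventually_ball_finite) auto
  with u(2) B(2) have "\<forall>\<^sub>F t in nhds 0. R (t^4, q t) = r t"
  proof eventually_elim
    case (elim t)
    have "R (t^4, q t) = (\<Sum>j<4. t^N * (B j (t^4) * (t^j * w j t)))"
      unfolding R_def using elim(3) by (intro sum.cong refl) (simp add: power_add)
    then show ?case using elim by (simp only: sum_distrib_left)
  qed
  ultimately show ?thesis using that by blast
qed

section \<open>First-order estimates for plane functions along a curve\<close>

lemma smooth_germ_lipschitz_at_0: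
  fixes f :: "'a::real_normed_vector \<Rightarrow> real"
  assumes "smooth_germ f"
  obtains K e where "e > 0" "K > 0" "\<And>x. norm x < e \<Longrightarrow> \<bar>f x - f 0\<bar> \<le> K * norm x"
proof -
  let ?D = "frechet_derivative f (at 0)"
  have D: "(f has_derivative ?D) (at 0)"
    using smooth_germ_has_derivative[OF assms] eventually_nhds_x_imp_x by blast
  obtain K where K: "K > 0" "\<And>v. norm (?D v) \<le> norm v * K"
    using bounded_linear.pos_bounded[OF has_derivative_bounded_linear[OF D]] by blast
  obtain d where d: "d > 0" "\<And>y. norm y < d \<Longrightarrow> norm (f y - f 0 - ?D y) \<le> norm y"
    using D[unfolded has_derivative_at_alt, THEN conjunct2, rule_format, of 1] by auto
  show ?thesis
  proof (rule that[of d "K + 1"])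
    fix x :: 'a assume "norm x < d"
    then have "\<bar>f x - f 0 - ?D x\<bar> \<le> norm x" "\<bar>?D x\<bar> \<le> norm x * K" using d(2) K(2)[of x] by auto
    then show "\<bar>f x - f 0\<bar> \<le> (K + 1) * norm x" by (simp add: algebra_simps)
  qed (use d K in auto)
qed

text \<open>On the ball of radius d the derivative of \<open>R\<close> minus its linear part at 0 is
  O(d), and the mean value inequality applies. The estimate compares two arbitrary points near 0, as
  required for the points of a curve at t and -t.\<close>

lemma strict_derivative_plane:
  fixes R :: "real \<times> real \<Rightarrow> real"
  assumes "smooth_germ R" "(R has_derivative (\<lambda>p. a * fst p + b * snd p)) (at 0)"
  obtains C e where "e > 0" "C > 0"
    "\<And>p p' d. norm p \<le> d \<Longrightarrow> norm p' \<le> d \<Longrightarrow> d < e \<Longrightarrow>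
      \<bar>R p - R p' - (a * fst (p - p') + b * snd (p - p'))\<bar> \<le> C * d * norm (p - p')"
proof -
  let ?D = "\<lambda>x. frechet_derivative R (at x)"
  have D0: "?D 0 = (\<lambda>p. a * fst p + b * snd p)" using frechet_derivative_at[OF assms(2)] by simp
  obtain K1 e1 where 1: "e1 > 0" "K1 > 0" "\<And>x. norm x < e1 \<Longrightarrow> \<bar>?D x (1,0) - ?D 0 (1,0)\<bar> \<le> K1 * norm x"
    using smooth_germ_lipschitz_at_0[OF smooth_germ_frechet[OF assms(1), of "(1,0)"]] by metis
  obtain K2 e2 where 2: "e2 > 0" "K2 > 0" "\<And>x. norm x < e2 \<Longrightarrow> \<bar>?D x (0,1) - ?D 0 (0,1)\<bar> \<le> K2 * norm x"
    using smooth_germ_lipschitz_at_0[OF smooth_germ_frechet[OF assms(1), of "(0,1)"]] by metis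
  obtain e3 where 3: "e3 > 0" "\<And>x. norm x < e3 \<Longrightarrow> (R has_derivative ?D x) (at x)"
    using smooth_germ_has_derivative[OF assms(1)] unfolding eventually_nhds_metric by auto
  show ?thesis
  proof (rule that[of "min e1 (min e2 e3)" "K1 + K2"])
    fix p p' :: "real \<times> real" and d :: real
    assume p: "norm p \<le> d" "norm p' \<le> d" "d < min e1 (min e2 e3)"
    let ?L = "\<lambda>p. a * fst p + b * snd p"
    let ?g = "\<lambda>x. R x - ?L x"
    have "norm (?g p - ?g p') \<le> (K1 + K2) * d * norm (p - p')"
    proof (rule differentiable_bound[where S="cball 0 d" and f'="\<lambda>x v. ?D x v - ?L v"])
      fix x :: "real \<times> real" assume "x \<in> cball 0 d"
      then have x: "norm x \<le> d" "norm x < e1" "norm x < e2" "norm x < e3" using p by auto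
      have "(?g has_derivative (\<lambda>v. ?D x v - ?L v)) (at x)"
        by (intro has_derivative_diff 3(2) x(4)) (auto intro!: derivative_eq_intros)
      then show "(?g has_derivative (\<lambda>v. ?D x v - ?L v)) (at x within cball 0 d)"
        by (rule has_derivative_at_withinI)
      interpret linear "?D x" using 3(2)[OF x(4)] has_derivative_linear by blast
      show "onorm (\<lambda>v. ?D x v - ?L v) \<le> (K1 + K2) * d"
      proof (rule onorm_le)
        fix v :: "real \<times> real"
        have "v = fst v *\<^sub>R (1,0) + snd v *\<^sub>R (0,1)" by (simp add: prod_eq_iff)
        then have "?D x v = ?D x (fst v *\<^sub>R (1,0) + snd v *\<^sub>R (0,1))" by simp
        also have "\<dots> = fst v * ?D x (1,0) + snd v * ?D x (0,1)" by (simp only: add scale real_scaleR_def)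
        finally have "?D x v - ?L v = fst v * (?D x (1,0) - a) + snd v * (?D x (0,1) - b)"
          by (simp add: algebra_simps)
        then have "\<bar>?D x v - ?L v\<bar> \<le> \<bar>fst v\<bar> * \<bar>?D x (1,0) - a\<bar> + \<bar>snd v\<bar> * \<bar>?D x (0,1) - b\<bar>"
          by (simp add: abs_mult [symmetric])
        also have "\<dots> \<le> norm v * (K1 * d) + norm v * (K2 * d)"
        proof (intro add_mono mult_mono)
          show "\<bar>fst v\<bar> \<le> norm v" "\<bar>snd v\<bar> \<le> norm v"
            using norm_fst_le[of "fst v" "snd v"] norm_snd_le[of "snd v" "fst v"] by simp_all
          have "\<bar>?D x (1,0) - a\<bar> \<le> K1 * norm x" "\<bar>?D x (0,1) - b\<bar> \<le> K2 * norm x"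
            using 1(3)[OF x(2)] 2(3)[OF x(3)] by (simp_all add: D0)
          then show "\<bar>?D x (1,0) - a\<bar> \<le> K1 * d" "\<bar>?D x (0,1) - b\<bar> \<le> K2 * d"
            using x(1) 1(2) 2(2) by (meson dual_order.trans mult_left_mono less_imp_le)+
        qed auto
        finally show "norm (?D x v - ?L v) \<le> (K1 + K2) * d * norm v" by (simp add: algebra_simps)
      qed
    qed (use p in auto)
    then show "\<bar>R p - R p' - (a * fst (p - p') + b * snd (p - p'))\<bar> \<le> (K1 + K2) * d * norm (p - p')"
      by (simp add: algebra_simps)
  qed (use 1 2 3 in auto)
qed

text \<open>The remainder after the linear part is quadratic, and both components have order at
  least 4. Since 8 exceeds the orders 4, 5, 6, 7, the linear part of \<open>R\<close> can be read
  off from Taylor coefficients along the curve.\<close>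

lemma curve_linear_part:
  fixes R :: "real \<times> real \<Rightarrow> real"
  assumes R: "smooth_germ R" "R 0 = 0" "(R has_derivative (\<lambda>p. a * fst p + b * snd p)) (at 0)"
    and f: "vord 4 f" "vord 4 g"
  shows "vord 8 (\<lambda>t. R (f t, g t) - (a * f t + b * g t))"
proof -
  have s: "smooth_germ f" "smooth_germ g" "f 0 = 0" "g 0 = 0" using f vord_smooth vord_zero by auto
  obtain C e where e: "e > 0" "C > 0"
    "\<And>p p' d. norm p \<le> d \<Longrightarrow> norm p' \<le> d \<Longrightarrow> d < e \<Longrightarrow>
      \<bar>R p - R p' - (a * fst (p - p') + b * snd (p - p'))\<bar> \<le> C * d * norm (p - p')"
    using strict_derivative_plane[OF R(1,3)] by metis
  obtain C1 where C1: "C1 > 0" "\<forall>\<^sub>F t in nhds 0. \<bar>f t\<bar> \<le> C1 * \<bar>t\<bar>^4" using vord_bound[OF f(1)] .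
  obtain C2 where C2: "C2 > 0" "\<forall>\<^sub>F t in nhds 0. \<bar>g t\<bar> \<le> C2 * \<bar>t\<bar>^4" using vord_bound[OF f(2)] .
  have sp: "smooth_germ (\<lambda>t. (f t, g t))" using s by (intro smooth_intros)
  have "((\<lambda>t. norm (f t, g t)) \<longlongrightarrow> norm (f 0, g 0)) (nhds 0)" by (intro tendsto_norm smooth_germ_tendsto[OF sp])
  then have "\<forall>\<^sub>F t in nhds 0. norm (f t, g t) < e" using e(1) s by (intro order_tendstoD) auto
  with C1(2) C2(2) have "\<forall>\<^sub>F t in nhds 0. \<bar>R (f t, g t) - (a * f t + b * g t)\<bar> \<le> C * (C1 + C2)^2 * \<bar>t\<bar>^8"
  proof eventually_elim
    case (elim t)
    have n: "norm (f t, g t) \<le> (C1 + C2) * \<bar>t\<bar>^4"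
      using norm_Pair_le[of "f t" "g t"] elim by (simp add: algebra_simps)
    have "\<bar>R (f t, g t) - (a * f t + b * g t)\<bar> \<le> C * (norm (f t, g t) * norm (f t, g t))"
      using e(3)[of "(f t, g t)" "norm (f t, g t)" 0] elim R(2) by (simp add: zero_prod_def)
    also have "\<dots> \<le> C * (((C1 + C2) * \<bar>t\<bar>^4) * ((C1 + C2) * \<bar>t\<bar>^4))"
      using n e(2) C1(1) C2(1) by (intro mult_left_mono mult_mono) auto
    also have "\<dots> = C * (C1 + C2)^2 * (\<bar>t\<bar>^4 * \<bar>t\<bar>^4)" by (simp add: power2_eq_square mult_ac)
    finally show ?case by (simp add: power_add [symmetric])
  qed
  moreover have "smooth_germ (\<lambda>t. R (f t, g t) - (a * f t + b * g t))"
    by (intro smooth_intros s smooth_germ_compose[OF R(1) sp]) (use s in \<open>auto simp: zero_prod_def\<close>)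
  ultimately show ?thesis by (intro vord_of_bound)
qed

lemma smooth_germ_plane_derivative:
  fixes R :: "real \<times> real \<Rightarrow> real"
  assumes "smooth_germ R"
  obtains a b where "(R has_derivative (\<lambda>p. a * fst p + b * snd p)) (at 0)"
proof -
  let ?D = "frechet_derivative R (at 0)"
  have D: "(R has_derivative ?D) (at 0)"
    using smooth_germ_has_derivative[OF assms] eventually_nhds_x_imp_x by blast
  interpret linear ?D using D has_derivative_linear by blast
  have "?D = (\<lambda>p. ?D (1,0) * fst p + ?D (0,1) * snd p)"
  proof
    fix p :: "real \<times> real"
    have "?D p = ?D (fst p *\<^sub>R (1,0) + snd p *\<^sub>R (0,1))" by simp
    also have "\<dots> = fst p * ?D (1,0) + snd p * ?D (0,1)" by (simp only: add scale real_scaleR_def)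
    finally show "?D p = ?D (1,0) * fst p + ?D (0,1) * snd p" by (simp add: mult.commute)
  qed
  then show ?thesis using D that by metis
qed

text \<open>The difference y - q is a plane function \<open>R\<close> along the curve (t^4, q), and
  (x, y) \<mapsto> (x, y + R(x, y)) carries this curve to (t^4, y). For this to be a diffeomorphism
  the linear part of \<open>R\<close> is shown to vanish: its terms would appear at the orders 4 and
  \<open>n\<close>, both below 8 \<le> N.\<close>

lemma determinacy:
  fixes E :: "nat \<Rightarrow> real \<times> real \<Rightarrow> real" and q y :: "real \<Rightarrow> real"
  assumes q: "vord n q" "tc q n \<noteq> 0" and n: "4 < n" "n < 8" "8 \<le> N"
    and E: "\<And>j. j < 4 \<Longrightarrow> smooth_germ (E j)"
    and w: "\<And>j. j < 4 \<Longrightarrow> smooth_germ (w j)" "\<And>j. j < 4 \<Longrightarrow> w j 0 \<noteq> 0"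
    and Ew: "\<And>j. j < 4 \<Longrightarrow> \<forall>\<^sub>F t in nhds 0. E j (t^4, q t) = t^(N + j) * w j t"
    and y: "vord N (\<lambda>t. y t - q t)"
  shows "A_equivalent (\<lambda>t. (t^4, y t)) (\<lambda>t. (t^4, q t))"
proof -
  obtain R where R: "smooth_germ R" "\<forall>\<^sub>F t in nhds 0. R (t^4, q t) = y t - q t"
    by (rule curve_function[OF E w Ew y]) blast
  obtain a b where D: "(R has_derivative (\<lambda>p. a * fst p + b * snd p)) (at 0)"
    using smooth_germ_plane_derivative[OF R(1)] .
  have q4: "vord 4 q" "q 0 = 0" using vord_mono[OF q(1)] vord_zero[OF q(1)] n by auto
  have sq: "smooth_germ q" using q(1) by (rule vord_smooth)
  have "y 0 - q 0 = 0" using vord_zero[OF y] n by simp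
  then have R0: "R 0 = 0" using eventually_nhds_x_imp_x[OF R(2)] q4 by (simp add: zero_prod_def)
  have "vord 8 (\<lambda>t. R (t^4, q t) - (a * t^4 + b * q t))"
    by (rule curve_linear_part[OF R(1) R0 D vord_power_t q4(1)])
  then have "vord 8 (\<lambda>t. (y t - q t) - (a * t^4 + b * q t))"
    by (rule vord_cong) (use R(2) in \<open>eventually_elim, simp\<close>)
  from vord_diff[OF vord_mono[OF y n(3)] this]
  have v: "vord 8 (\<lambda>t. a * t^4 + b * q t)" by simp
  have s4: "smooth_germ (\<lambda>t::real. a * t^4)" by (intro smooth_intros)
  have t: "tc (\<lambda>t. a * t^4 + b * q t) k = (if k = 4 then a else 0) + b * tc q k" for k
    using tc_add[OF s4 smooth_germ_cmult[OF sq, of b]] tc_cmult[OF sq] by (simp add: tc_monomial)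
  have "a = 0" using vord_tc[OF v, of 4] t[of 4] vord_tc[OF q(1), of 4] n by simp
  moreover have "b = 0" using vord_tc[OF v, of n] t[of n] q(2) n by simp
  ultimately have D0: "(R has_derivative (\<lambda>p. 0)) (at 0)" using D by simp
  have s1: "smooth_germ (\<lambda>p::real\<times>real. fst p)" and s2: "smooth_germ (\<lambda>p::real\<times>real. snd p)"
    by (intro smooth_intros)+
  have "diffeo_germ (\<lambda>p. (fst p, snd p + R p))"
  proof (rule diffeo_germ_plane[where a=1 and b=0 and c=0 and d=1])
    show "smooth_germ (\<lambda>p. (fst p, snd p + R p))" by (intro smooth_germ_Pair smooth_germ_add s1 s2 R(1))
    show "((\<lambda>p. (fst p, snd p + R p)) has_derivative (\<lambda>p. (1 * fst p + 0 * snd p, 0 * fst p + 1 * snd p))) (at 0)"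
      by (auto intro!: derivative_eq_intros D0)
  qed (use R0 in \<open>auto simp: zero_prod_def\<close>)
  moreover have "smooth_map_germ (\<lambda>t. (t^4, q t))"
    unfolding smooth_map_germ_def using sq q4 by (auto intro!: smooth_intros simp: zero_prod_def)
  ultimately have "A_equivalent (\<lambda>t. (t^4, q t)) (\<lambda>t. (\<lambda>p. (fst p, snd p + R p)) (t^4, q t))"
    by (intro A_equivalent_target)
  then have "A_equivalent (\<lambda>t. (t^4, q t)) (\<lambda>t. (t^4, y t))"
    by (rule A_equivalent_cong) (use R(2) in \<open>eventually_elim, simp\<close>)
  then show ?thesis by (rule A_equivalent_sym)
qed

section \<open>Reduction steps\<close>

text \<open>The coefficient \<open>a\<close> may be 0, in which case the order is higher. Cancelling
  a leading term is then an addition of two \<open>lead\<close> facts whose coefficients sum to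
  0.\<close>

definition lead :: "nat \<Rightarrow> real \<Rightarrow> (real \<Rightarrow> real) \<Rightarrow> bool" where
  "lead k a f \<longleftrightarrow> vord (Suc k) (\<lambda>t. f t - a * t^k)"

lemma leadE:
  assumes "lead k a f"
  obtains u where "smooth_germ u" "u 0 = a" "\<forall>\<^sub>F t in nhds 0. f t = t^k * u t"
proof -
  obtain v where v: "smooth_germ v" "\<forall>\<^sub>F t in nhds 0. f t - a * t^k = t^Suc k * v t"
    using assms unfolding lead_def by (rule vordE)
  show ?thesis
  proof (rule that[of "\<lambda>t. a + t * v t"])
    show "smooth_germ (\<lambda>t. a + t * v t)" by (intro smooth_intros v(1))
    show "\<forall>\<^sub>F t in nhds 0. f t = t^k * (a + t * v t)"
      using v(2) by eventually_elim (simp add: algebra_simps)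
  qed simp
qed

lemma leadI:
  assumes "smooth_germ u" "u 0 = a" "\<forall>\<^sub>F t in nhds 0. f t = t^k * u t"
  shows "lead k a f"
proof -
  have "vord (Suc 0) (\<lambda>t. u t - a)"
    unfolding vord_Suc_0_iff by (intro conjI smooth_intros assms(1)) (simp add: assms(2))
  from vord_mult[OF vord_power_t[of k] this] have "vord (Suc k) (\<lambda>t. t^k * (u t - a))" by simp
  then show ?thesis unfolding lead_def
    by (rule vord_cong) (use assms(3) in \<open>eventually_elim, simp add: algebra_simps\<close>)
qed

lemma lead_vord: "lead k a f \<Longrightarrow> vord k f"
  by (meson leadE vordI)

lemma lead_smooth: "lead k a f \<Longrightarrow> smooth_germ f"
  using lead_vord vord_smooth by blast

lemma lead_tc:
  assumes "lead k a f"
  shows "tc f k = a"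
proof -
  obtain u where u: "smooth_germ u" "u 0 = a" "\<forall>\<^sub>F t in nhds 0. f t = t^k * u t" using assms by (rule leadE)
  then show ?thesis using tc_cong[OF u(3), of k] tc_power_times[OF u(1), of k k] by simp
qed

lemma lead_iff: "lead k a f \<longleftrightarrow> vord k f \<and> tc f k = a"
proof
  assume "vord k f \<and> tc f k = a"
  then show "lead k a f" unfolding lead_def using vord_step[of k f] by simp
qed (rule conjI[OF lead_vord lead_tc])

lemma lead_cong:
  assumes "lead k a f" "\<forall>\<^sub>F t in nhds 0. f t = g t"
  shows "lead k a g"
  unfolding lead_iff
  using vord_cong[OF lead_vord[OF assms(1)] assms(2)] lead_tc[OF assms(1)] tc_cong[OF assms(2), of k] by simp

lemma lead_mult:
  assumes "lead j a f" "lead k b g"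
  shows "lead (j + k) (a * b) (\<lambda>t. f t * g t)"
proof -
  obtain u where u: "smooth_germ u" "u 0 = a" "\<forall>\<^sub>F t in nhds 0. f t = t^j * u t" using assms(1) by (rule leadE)
  obtain v where v: "smooth_germ v" "v 0 = b" "\<forall>\<^sub>F t in nhds 0. g t = t^k * v t" using assms(2) by (rule leadE)
  show ?thesis
    by (rule leadI[OF smooth_germ_mult[OF u(1) v(1)]])
      (use u(2) v(2) in simp, use u(3) v(3) in \<open>eventually_elim, simp add: power_add mult_ac\<close>)
qed

lemma lead_monomial: "lead k a (\<lambda>t. a * t^k)"
  by (simp add: lead_def)

lemma lead_power_t: "lead k 1 (\<lambda>t. t^k)"
  by (simp add: lead_def)

lemma lead_power: "lead k a f \<Longrightarrow> lead (n * k) (a^n) (\<lambda>t. f t^n)"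
proof (induction n)
  case (Suc n)
  from lead_mult[OF Suc.prems Suc.IH[OF Suc.prems]] show ?case by simp
qed (simp add: lead_def)

lemma lead_add_higher: "lead k a f \<Longrightarrow> vord (Suc k) g \<Longrightarrow> lead k a (\<lambda>t. f t + g t)"
  unfolding lead_def by (drule (1) vord_add) (simp add: algebra_simps)

lemma lead_add: "lead k a f \<Longrightarrow> lead k b g \<Longrightarrow> lead k (a + b) (\<lambda>t. f t + g t)"
  unfolding lead_def by (drule (1) vord_add) (simp add: algebra_simps)

lemma lead_cmult: "lead k a f \<Longrightarrow> lead k (c * a) (\<lambda>t. c * f t)"
  unfolding lead_def by (drule vord_cmult[of _ _ c]) (simp add: algebra_simps)

lemma lead_zero: "lead k 0 f \<longleftrightarrow> vord (Suc k) f"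
  by (simp add: lead_def)

lemma lead_of_vord: "vord k f \<Longrightarrow> lead k (tc f k) f"
  by (simp add: lead_iff)

section \<open>Reparametrization by a fourth root\<close>

lemma tc_powr:
  "tc (\<lambda>z. (1 + z) powr p) (Suc 0) = p" "tc (\<lambda>z. (1 + z) powr p) (Suc (Suc 0)) = p * (p - 1) / 2"
proof -
  have d: "\<forall>\<^sub>F z in nhds 0. deriv (\<lambda>z::real. (1 + z) powr p) z = p * (1 + z) powr (p - 1)" for p :: real
  proof -
    have "\<forall>\<^sub>F z in nhds 0. z \<in> {-1<..<1::real}" by (intro eventually_nhds_in_open) auto
    then show ?thesis
    proof eventually_elim
      case (elim z)
      then show ?case by (auto intro!: DERIV_imp_deriv derivative_eq_intros)
    qed
  qed
  have 1: "tc (\<lambda>z. (1 + z) powr p) (Suc k) = p * tc (\<lambda>z. (1 + z) powr (p - 1)) k / real (Suc k)" for k p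
    unfolding tc_Suc_deriv tc_cong[OF d] tc_cmult[OF smooth_germ_powr] ..
  show "tc (\<lambda>z. (1 + z) powr p) (Suc 0) = p" by (simp add: 1)
  show "tc (\<lambda>z. (1 + z) powr p) (Suc (Suc 0)) = p * (p - 1) / 2" by (simp add: 1)
qed

lemma powr_expand_1:
  assumes "vord w W" "0 < w"
  shows "vord (2 * w) (\<lambda>t. (1 + W t) powr p - (1 + p * W t))"
  using vord_compose_vord[OF taylor_vord[OF smooth_germ_powr[of p], of 2] assms]
  by (simp add: numeral_2_eq_2 tc_powr)

lemma powr_expand_2:
  assumes "vord w W" "0 < w"
  shows "vord (3 * w) (\<lambda>t. (1 + W t) powr p - (1 + p * W t + p * (p - 1) / 2 * W t ^ 2))"
  using vord_compose_vord[OF taylor_vord[OF smooth_germ_powr[of p], of 3] assms]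
  by (simp add: numeral_3_eq_3 numeral_2_eq_2 tc_powr add.assoc)

lemma power_root_reparam:
  fixes v :: real
  assumes "v > 0"
  shows "(t * v powr (1/4)) ^ j = t^j * v powr (real j / 4)"
  using assms by (simp add: power_mult_distrib powr_powr powr_realpow [symmetric])

lemma diffeo_root_reparam:
  fixes v :: "real \<Rightarrow> real"
  assumes "smooth_germ v" "v 0 = 1"
  shows "diffeo_germ (\<lambda>t. t * v t powr (1/4))"
proof -
  have sv: "smooth_germ (\<lambda>t. v t powr (1/4))" by (rule smooth_germ_powr_compose) (use assms in auto)
  have s: "smooth_germ (\<lambda>t. t * v t powr (1/4))" by (intro smooth_intros sv)
  have "tc (\<lambda>t. t * v t powr (1/4)) (Suc 0) = 1" using tc_times_t[OF sv, of 0] assms(2) by simp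
  then show ?thesis by (intro diffeo_germ_real s) (auto simp: tc_Suc_deriv)
qed

text \<open>The parameter \<tau> = t v(t)^(1/4) satisfies \<tau>^4 = t^4 v(t), and z = y o s with s
  the inverse of \<tau>. The last clause compares z with q by comparing y(t) with q(\<tau>(t)), so
  that s itself never has to be expanded.\<close>

lemma curve_normalize:
  assumes v: "smooth_germ v" "v 0 = 1" and y: "smooth_germ y" "y 0 = 0"
  shows "\<exists>z. smooth_germ z \<and> A_equivalent (\<lambda>t. (t^4 * v t, y t)) (\<lambda>t. (t^4, z t)) \<and>
    (\<forall>k q. smooth_germ q \<longrightarrow> vord k (\<lambda>t. y t - q (t * v t powr (1/4))) \<longrightarrow> vord k (\<lambda>t. z t - q t))"
proof -
  let ?\<tau> = "\<lambda>t. t * v t powr (1/4)"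
  have d: "diffeo_germ ?\<tau>" by (rule diffeo_root_reparam[OF v])
  obtain s where s: "diffeo_germ s" "\<forall>\<^sub>F t in nhds 0. ?\<tau> (s t) = t"
    using diffeo_germ_inverse[OF d] by metis
  have ss: "smooth_germ s" "s 0 = 0" using diffeo_germ_smooth[OF s(1)] by (auto simp: smooth_map_germ_def)
  let ?F = "\<lambda>t. (t^4 * v t, y t)" and ?z = "\<lambda>t. y (s t)"
  have sz: "smooth_germ ?z" by (rule smooth_germ_compose[OF y(1) ss])
  have "smooth_map_germ ?F"
    unfolding smooth_map_germ_def using y by (auto intro!: smooth_intros v simp: zero_prod_def)
  then have "A_equivalent ?F (\<lambda>t. ?F (s t))" using s(1) by (rule A_equivalent_source)
  moreover have "\<forall>\<^sub>F t in nhds 0. ?F (s t) = (t^4, ?z t)"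
  proof -
    have "\<forall>\<^sub>F t in nhds 0. v t > 0"
      using smooth_germ_tendsto[OF v(1)] v(2) by (intro order_tendstoD) auto
    then have "\<forall>\<^sub>F t in nhds 0. v (s t) > 0" by (rule smooth_germ_eventually[OF ss])
    with s(2) show ?thesis
    proof eventually_elim
      case (elim t)
      have "?\<tau> (s t) ^ 4 = s t ^ 4 * v (s t)" using power_root_reparam[OF elim(2), of "s t" 4] elim(2) by simp
      then show ?case by (simp only: elim(1))
    qed
  qed
  ultimately have "A_equivalent ?F (\<lambda>t. (t^4, ?z t))" by (rule A_equivalent_cong)
  moreover have "vord k (\<lambda>t. ?z t - q t)" if "vord k (\<lambda>t. y t - q (?\<tau> t))" for k q
    using vord_compose[OF that ss]
    by (rule vord_cong) (use s(2) in \<open>eventually_elim, simp\<close>)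
  ultimately show ?thesis using sz by blast
qed

lemma curve_coordinate_change:
  assumes X: "smooth_germ X" "X 0 = 0" "(X has_derivative (\<lambda>p. fst p + b * snd p)) (at 0)"
    and Y: "smooth_germ Y" "Y 0 = 0" "(Y has_derivative (\<lambda>p. c * fst p + d * snd p)) (at 0)"
    and det: "d - b * c \<noteq> 0"
    and y: "smooth_germ y" "y 0 = 0"
    and v: "smooth_germ v" "v 0 = 1" "\<forall>\<^sub>F t in nhds 0. X (t^4, y t) = t^4 * v t"
    and q: "smooth_germ q" "vord k (\<lambda>t. Y (t^4, y t) - q (t * v t powr (1/4)))"
  shows "\<exists>z. smooth_germ z \<and> A_equivalent (\<lambda>t. (t^4, y t)) (\<lambda>t. (t^4, z t)) \<and> vord k (\<lambda>t. z t - q t)"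
proof -
  let ?g = "\<lambda>t. (t^4, y t)" and ?\<psi> = "\<lambda>p. (X p, Y p)"
  have g: "smooth_germ ?g" by (intro smooth_intros y(1))
  have g0: "?g 0 = 0" by (simp add: y(2) zero_prod_def)
  have "diffeo_germ ?\<psi>"
  proof (rule diffeo_germ_plane[where a=1 and b=b and c=c and d=d])
    show "smooth_germ ?\<psi>" by (intro smooth_intros X(1) Y(1))
    show "(?\<psi> has_derivative (\<lambda>p. (1 * fst p + b * snd p, c * fst p + d * snd p))) (at 0)"
      using X(3) Y(3) by (auto intro: has_derivative_Pair)
  qed (use det X(2) Y(2) in \<open>auto simp: zero_prod_def\<close>)
  moreover have "smooth_map_germ ?g" using g g0 by (simp add: smooth_map_germ_def)
  ultimately have "A_equivalent ?g (\<lambda>t. ?\<psi> (?g t))" by (intro A_equivalent_target)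
  then have 1: "A_equivalent ?g (\<lambda>t. (t^4 * v t, Y (t^4, y t)))"
    by (rule A_equivalent_cong) (use v(3) in \<open>eventually_elim, simp\<close>)
  have "smooth_germ (\<lambda>t. Y (t^4, y t))" using smooth_germ_compose[OF Y(1) g g0] .
  moreover have "Y (0^4, y 0) = 0" using Y(2) g0 by simp
  ultimately obtain z where z: "smooth_germ z" "A_equivalent (\<lambda>t. (t^4 * v t, Y (t^4, y t))) (\<lambda>t. (t^4, z t))"
    "\<forall>k q. smooth_germ q \<longrightarrow> vord k (\<lambda>t. Y (t^4, y t) - q (t * v t powr (1/4))) \<longrightarrow> vord k (\<lambda>t. z t - q t)"
    using curve_normalize[OF v(1,2), of "\<lambda>t. Y (t^4, y t)"] by blast
  show ?thesis
    using z(1,3) q A_equivalent_trans[OF 1 z(2)] by blast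
qed

text \<open>A state of the elimination: below order \<open>k\<close> only the two terms of the
  intended normal form are left. The steps that start from such a state raise \<open>k\<close> by
  one and keep \<open>n\<close>, \<open>c\<close> and \<open>m\<close>.\<close>

definition reduces :: "(real \<Rightarrow> real \<times> real) \<Rightarrow> nat \<Rightarrow> real \<Rightarrow> nat \<Rightarrow> nat \<Rightarrow> bool" where
  "reduces f n c m k \<longleftrightarrow> (\<exists>y. smooth_germ y \<and> A_equivalent f (\<lambda>t. (t^4, y t)) \<and>
     vord k (\<lambda>t. y t - (t^n + c * t^m)))"

lemma reduces_coordinate_change:
  assumes f: "A_equivalent f (\<lambda>t. (t^4, y t))"
    and X: "smooth_germ X" "X 0 = 0" "(X has_derivative (\<lambda>p. fst p + b * snd p)) (at 0)"
    and Y: "smooth_germ Y" "Y 0 = 0" "(Y has_derivative (\<lambda>p. d * snd p)) (at 0)" "d \<noteq> 0"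
    and y: "smooth_germ y" "y 0 = 0"
    and v: "smooth_germ v" "v 0 = 1" "\<forall>\<^sub>F t in nhds 0. X (t^4, y t) = t^4 * v t"
    and q: "vord k (\<lambda>t. Y (t^4, y t) - (t^n * v t powr (real n / 4) + c * (t^m * v t powr (real m / 4))))"
  shows "reduces f n c m k"
proof -
  let ?q = "\<lambda>t. t^n + c * t^m"
  have "\<forall>\<^sub>F t in nhds 0. v t > 0"
    using smooth_germ_tendsto[OF v(1)] v(2) by (intro order_tendstoD) auto
  then have "\<forall>\<^sub>F t in nhds 0. Y (t^4, y t) - (t^n * v t powr (real n / 4) + c * (t^m * v t powr (real m / 4)))
      = Y (t^4, y t) - ?q (t * v t powr (1/4))"
    by eventually_elim (simp only: power_root_reparam)
  with q have "vord k (\<lambda>t. Y (t^4, y t) - ?q (t * v t powr (1/4)))" by (rule vord_cong)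
  moreover have "smooth_germ ?q" by (intro smooth_intros)
  ultimately have "\<exists>z. smooth_germ z \<and> A_equivalent (\<lambda>t. (t^4, y t)) (\<lambda>t. (t^4, z t)) \<and> vord k (\<lambda>t. z t - ?q t)"
    by (intro curve_coordinate_change[where c=0 and d=d, OF X Y(1,2) _ _ y v]) (use Y(3,4) in auto)
  then show ?thesis unfolding reduces_def using A_equivalent_trans[OF f] by blast
qed

lemma vord_normal_form_lead:
  assumes "vord k (\<lambda>t. y t - (t^n + c * t^m))" "n < k" "n < m"
  shows "lead n 1 y"
proof -
  have "vord (Suc n) (\<lambda>t. (y t - (t^n + c * t^m)) + c * t^m)"
    by (intro vord_add vord_mono[OF assms(1)] vord_cmult vord_mono[OF vord_power_t]) (use assms in auto)
  then show ?thesis by (simp add: lead_def algebra_simps)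
qed

lemma has_derivative_fst_plane: "(fst has_derivative (\<lambda>p. fst p + 0 * snd p)) (at (0 :: real \<times> real))"
proof -
  have "(\<lambda>p::real\<times>real. fst p + 0 * snd p) = fst" by auto
  then show ?thesis using bounded_linear_imp_has_derivative[OF bounded_linear_fst] by metis
qed

lemma has_derivative_snd_plane: "(snd has_derivative (\<lambda>p. 1 * snd p)) (at (0 :: real \<times> real))"
proof -
  have "(\<lambda>p::real\<times>real. 1 * snd p) = snd" by auto
  then show ?thesis using bounded_linear_imp_has_derivative[OF bounded_linear_snd] by metis
qed

text \<open>If a plane function has order exactly \<open>k\<close> along the curve, a multiple of it
  subtracted from the second coordinate removes the coefficient of t^k. Vanishing derivative at 0
  keeps the change tangent to the identity.\<close>

lemma reduces_target_step:
  assumes red: "reduces f n c m k" and k: "0 < k" "0 < n" "0 < m"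
    and \<mu>: "smooth_germ \<mu>" "\<mu> 0 = 0" "(\<mu> has_derivative (\<lambda>p. 0)) (at 0)"
    and lead: "\<And>y. vord k (\<lambda>t. y t - (t^n + c * t^m)) \<Longrightarrow> lead k a (\<lambda>t. \<mu> (t^4, y t))" "a \<noteq> 0"
  shows "reduces f n c m (Suc k)"
proof -
  obtain y where y: "smooth_germ y" "A_equivalent f (\<lambda>t. (t^4, y t))" "vord k (\<lambda>t. y t - (t^n + c * t^m))"
    using red unfolding reduces_def by blast
  define \<gamma> where "\<gamma> = tc (\<lambda>t. y t - (t^n + c * t^m)) k"
  have "lead k \<gamma> (\<lambda>t. y t - (t^n + c * t^m))" unfolding \<gamma>_def by (rule lead_of_vord[OF y(3)])
  from lead_add[OF this lead_cmult[OF lead(1)[OF y(3)], of "- (\<gamma> / a)"]]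
  have *: "vord (Suc k) (\<lambda>t. y t - \<gamma> / a * \<mu> (t^4, y t) - (t^n + c * t^m))"
    using lead(2) by (simp add: lead_zero algebra_simps)
  show ?thesis
  proof (rule reduces_coordinate_change[where X=fst and Y="\<lambda>p. snd p - \<gamma> / a * \<mu> p" and v="\<lambda>t. 1" and b=0 and d=1, OF y(2)])
    show "smooth_germ (\<lambda>p. snd p - \<gamma> / a * \<mu> p)" "smooth_germ (fst :: real \<times> real \<Rightarrow> real)" "smooth_germ (\<lambda>t. 1)"
      by (intro smooth_intros \<mu>(1))+
    show "((\<lambda>p. snd p - \<gamma> / a * \<mu> p) has_derivative (\<lambda>p. 1 * snd p)) (at 0)"
      using lead(2) by (auto intro!: derivative_eq_intros \<mu>(3))
    show "(fst has_derivative (\<lambda>p. fst p + 0 * snd p)) (at (0 :: real \<times> real))"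
      by (rule has_derivative_fst_plane)
    show "y 0 = 0" using vord_zero[OF y(3)] k by (simp add: zero_power)
  qed (use \<mu>(2) y(1) lead(2) * in auto)
qed

text \<open>The substitution t \<mapsto> t (1 + W)^(1/4) changes t^n by (n/4) t^n W to first order.
  The quadratic terms in W have order n + 2w and the effect on t^m has order m + w, both beyond n +
  w.\<close>

lemma normal_form_expand:
  assumes "vord w W" "0 < w" "n < m"
  shows "vord (Suc (n + w)) (\<lambda>t. (t^n * (1 + W t) powr (real n / 4) + c * (t^m * (1 + W t) powr (real m / 4)))
    - (t^n + c * t^m + real n / 4 * (t^n * W t)))"
proof -
  have W: "smooth_germ W" "W 0 = 0" using vord_smooth vord_zero assms by auto
  have "vord (n + 2 * w) (\<lambda>t. t^n * ((1 + W t) powr (real n / 4) - (1 + real n / 4 * W t)))"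
    by (intro vord_mult vord_power_t powr_expand_1 assms)
  then have 1: "vord (Suc (n + w)) (\<lambda>t. t^n * ((1 + W t) powr (real n / 4) - (1 + real n / 4 * W t)))"
    by (rule vord_mono) (use assms in simp)
  have "vord w (\<lambda>t. (1 + W t) powr (real m / 4) - 1)"
  proof -
    have "vord w (\<lambda>t. ((1 + W t) powr (real m / 4) - (1 + real m / 4 * W t)) + real m / 4 * W t)"
      by (intro vord_add vord_mono[OF powr_expand_1[OF assms(1,2)]] vord_cmult assms) simp
    then show ?thesis by simp
  qed
  then have "vord (m + w) (\<lambda>t. t^m * ((1 + W t) powr (real m / 4) - 1))"
    by (intro vord_mult vord_power_t)
  then have 2: "vord (Suc (n + w)) (\<lambda>t. c * (t^m * ((1 + W t) powr (real m / 4) - 1)))"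
    by (intro vord_cmult) (erule vord_mono, use assms in linarith)
  from vord_add[OF 1 2] show ?thesis
    by (simp add: algebra_simps)
qed

text \<open>For the gaps of the semigroup: a multiple of \<open>\<mu>\<close>, of order 4 + w along
  the curve, is added to the first coordinate, which becomes t^4 (1 + W) with W of order w.
  Restoring t^4 by a new parameter then moves the coefficient of t^(n+w).\<close>

lemma reduces_source_step:
  assumes red: "reduces f n c m k" and k: "k = n + w" "0 < w" "0 < n" "n < m"
    and \<mu>: "smooth_germ \<mu>" "\<mu> 0 = 0" "(\<mu> has_derivative (\<lambda>p. b * snd p)) (at 0)"
    and lead: "\<And>y. vord k (\<lambda>t. y t - (t^n + c * t^m)) \<Longrightarrow> lead (4 + w) a (\<lambda>t. \<mu> (t^4, y t))" "a \<noteq> 0"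
  shows "reduces f n c m (Suc k)"
proof -
  obtain y where y: "smooth_germ y" "A_equivalent f (\<lambda>t. (t^4, y t))" "vord k (\<lambda>t. y t - (t^n + c * t^m))"
    using red unfolding reduces_def by blast
  define \<gamma> where "\<gamma> = tc (\<lambda>t. y t - (t^n + c * t^m)) k"
  have l\<gamma>: "lead k \<gamma> (\<lambda>t. y t - (t^n + c * t^m))" unfolding \<gamma>_def by (rule lead_of_vord[OF y(3)])
  \<comment> \<open>Since W has leading term \<delta> a t^w, the induced change (n/4) t^n W has
    leading coefficient (n/4) \<delta> a, which is to equal \<open>\<gamma>\<close>.\<close>
  define \<delta> where "\<delta> = 4 * \<gamma> / (real n * a)"
  obtain M where M: "smooth_germ M" "M 0 = a" "\<forall>\<^sub>F t in nhds 0. \<mu> (t^4, y t) = t^(4 + w) * M t"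
    using lead(1)[OF y(3)] by (rule leadE)
  define W where "W = (\<lambda>t. \<delta> * (t^w * M t))"
  have sW: "smooth_germ W" unfolding W_def by (intro smooth_intros M(1))
  have lW: "lead w (\<delta> * a) W" unfolding W_def
    by (intro lead_cmult leadI[OF M(1,2)]) simp
  then have vW: "vord w W" by (rule lead_vord)
  have "lead (n + w) (real n / 4 * (1 * (\<delta> * a))) (\<lambda>t. real n / 4 * (t^n * W t))"
    by (intro lead_cmult lead_mult lead_power_t lW)
  then have 1: "lead k \<gamma> (\<lambda>t. real n / 4 * (t^n * W t))"
    using lead(2) k by (simp add: \<delta>_def)
  have y0: "y 0 = 0" using vord_zero[OF y(3)] k by (simp add: zero_power)
  show ?thesis
  proof (rule reduces_coordinate_change[where X="\<lambda>p. fst p + \<delta> * \<mu> p" and Y=snd and v="\<lambda>t. 1 + W t" and b="\<delta> * b" and d=1, OF y(2)])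
    show "smooth_germ (\<lambda>p. fst p + \<delta> * \<mu> p)" "smooth_germ (snd :: real \<times> real \<Rightarrow> real)" "smooth_germ (\<lambda>t. 1 + W t)"
      by (intro smooth_intros \<mu>(1) sW)+
    show "((\<lambda>p. fst p + \<delta> * \<mu> p) has_derivative (\<lambda>p. fst p + \<delta> * b * snd p)) (at 0)"
      by (auto intro!: derivative_eq_intros \<mu>(3))
    show "(snd has_derivative (\<lambda>p. 1 * snd p)) (at (0 :: real \<times> real))"
      by (rule has_derivative_snd_plane)
    show "\<forall>\<^sub>F t in nhds 0. fst (t^4, y t) + \<delta> * \<mu> (t^4, y t) = t^4 * (1 + W t)"
      using M(3) by eventually_elim (simp add: W_def power_add algebra_simps)
    have "\<gamma> + - 1 * \<gamma> = 0" by simp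
    with lead_add[OF l\<gamma> lead_cmult[OF 1, of "-1"]]
    have "vord (Suc k) (\<lambda>t. (y t - (t^n + c * t^m)) + (- 1) * (real n / 4 * (t^n * W t)))"
      by (simp only: lead_zero)
    from vord_diff[OF this normal_form_expand[OF vW k(2,4), of c, folded k(1)]]
    show "vord (Suc k) (\<lambda>t. snd (t^4, y t) - (t^n * (1 + W t) powr (real n / 4) + c * (t^m * (1 + W t) powr (real m / 4))))"
      by (simp add: algebra_simps)
    show "1 + W 0 = 1" using vord_zero[OF vW] k by simp
  qed (use \<mu>(2) y(1) y0 in auto)
qed

text \<open>The change \<open>(x, y) \<mapsto> (x v, y v^(n/4))\<close> with \<open>v = 1 + 4 \<delta> x\<close> preserves \<open>(t^4, t^n)\<close> and multiplies
  \<open>t^m\<close> by \<open>v^((n - m)/4)\<close>.\<close>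

lemma reduces_scale_step:
  assumes red: "reduces f n c m k" and k: "k = m + 4" "0 < n" "n < m" "c \<noteq> 0"
  shows "reduces f n c m (Suc k)"
proof -
  obtain y where y: "smooth_germ y" "A_equivalent f (\<lambda>t. (t^4, y t))" "vord k (\<lambda>t. y t - (t^n + c * t^m))"
    using red unfolding reduces_def by blast
  define \<gamma> where "\<gamma> = tc (\<lambda>t. y t - (t^n + c * t^m)) k"
  have l\<gamma>: "lead k \<gamma> (\<lambda>t. y t - (t^n + c * t^m))" unfolding \<gamma>_def by (rule lead_of_vord[OF y(3)])
  \<comment> \<open>To first order v^((n - m)/4) is 1 + (n - m) \<delta> t^4, so the term c t^m
    contributes c (n - m) \<delta> at order m + 4; this choice cancels
    \<open>\<gamma>\<close>.\<close>
  define \<delta> where "\<delta> = \<gamma> / (c * (real m - real n))"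
  have y0: "y 0 = 0" using vord_zero[OF y(3)] k by (simp add: zero_power)
  define W where "W = (\<lambda>t::real. 4 * \<delta> * t^4)"
  have W: "vord 4 W" unfolding W_def by (intro vord_cmult vord_power_t)
  have e: "lead 4 (p * (4 * \<delta>)) (\<lambda>t. (1 + W t) powr p - 1)" for p
  proof -
    have "lead 4 (p * (4 * \<delta>)) (\<lambda>t. p * W t + ((1 + W t) powr p - (1 + p * W t)))"
      unfolding W_def by (intro lead_add_higher lead_cmult lead_monomial vord_mono[OF powr_expand_1[OF W[unfolded W_def]]]) auto
    then show ?thesis by simp
  qed
  have sp: "lead 0 1 (\<lambda>t. (1 + W t) powr (real n / 4))"
  proof -
    have "smooth_germ (\<lambda>t. (1 + W t) powr (real n / 4))"
      by (rule smooth_germ_compose[OF smooth_germ_powr vord_smooth[OF W]]) (simp add: W_def)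
    then show ?thesis by (simp add: lead_iff W_def)
  qed
  have A: "lead k (c * (1 * (real n / 4 * (4 * \<delta>) + (-1) * (real m / 4 * (4 * \<delta>)))))
      (\<lambda>t. c * (t^m * (((1 + W t) powr (real n / 4) - 1) + (-1) * ((1 + W t) powr (real m / 4) - 1))))"
    unfolding k(1) by (intro lead_cmult lead_mult lead_power_t lead_add e)
  have B: "lead k (\<gamma> * 1) (\<lambda>t. (y t - (t^n + c * t^m)) * (1 + W t) powr (real n / 4))"
    using lead_mult[OF l\<gamma> sp] by simp
  have "c * (1 * (real n / 4 * (4 * \<delta>) + (-1) * (real m / 4 * (4 * \<delta>)))) + \<gamma> * 1 = 0"
  proof -
    have "\<delta> * (c * (real m - real n)) = \<gamma>" using k by (simp add: \<delta>_def)
    then show ?thesis by (simp add: algebra_simps)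
  qed
  with lead_add[OF A B] have AB: "vord (Suc k) (\<lambda>t. c * (t^m * (((1 + W t) powr (real n / 4) - 1) + (-1) * ((1 + W t) powr (real m / 4) - 1)))
      + (y t - (t^n + c * t^m)) * (1 + W t) powr (real n / 4))"
    by (simp only: lead_zero)
  have s4: "smooth_germ (\<lambda>p::real\<times>real. 4 * \<delta> * fst p)" by (intro smooth_intros)
  have sY: "smooth_germ (\<lambda>p::real\<times>real. (1 + 4 * \<delta> * fst p) powr (real n / 4))"
    by (rule smooth_germ_compose[OF smooth_germ_powr s4]) simp
  show ?thesis
  proof (rule reduces_coordinate_change[where X="\<lambda>p. fst p * (1 + 4 * \<delta> * fst p)" and
        Y="\<lambda>p. snd p * (1 + 4 * \<delta> * fst p) powr (real n / 4)" and v="\<lambda>t. 1 + W t" and b=0 and d=1, OF y(2)])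
    show "smooth_germ (\<lambda>p::real\<times>real. fst p * (1 + 4 * \<delta> * fst p))"
      "smooth_germ (\<lambda>p::real\<times>real. snd p * (1 + 4 * \<delta> * fst p) powr (real n / 4))" "smooth_germ (\<lambda>t. 1 + W t)"
      by (intro smooth_intros sY vord_smooth[OF W])+
    show "((\<lambda>p::real\<times>real. fst p * (1 + 4 * \<delta> * fst p)) has_derivative (\<lambda>p. fst p + 0 * snd p)) (at 0)"
      by (auto intro!: derivative_eq_intros)
    show "((\<lambda>p::real\<times>real. snd p * (1 + 4 * \<delta> * fst p) powr (real n / 4)) has_derivative (\<lambda>p. 1 * snd p)) (at 0)"
      by (auto intro!: derivative_eq_intros)
    show "vord (Suc k) (\<lambda>t. snd (t^4, y t) * (1 + 4 * \<delta> * fst (t^4, y t)) powr (real n / 4)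
        - (t^n * (1 + W t) powr (real n / 4) + c * (t^m * (1 + W t) powr (real m / 4))))"
      using AB by (simp add: W_def algebra_simps)
  qed (use y(1) y0 in \<open>auto simp: W_def\<close>)
qed

section \<open>Monomials and the cusp as coordinate changes\<close>

lemma has_derivative_product_zero:
  fixes f g :: "'a::real_normed_vector \<Rightarrow> real"
  assumes "smooth_germ f" "smooth_germ g" "f 0 = 0" "g 0 = 0"
  shows "((\<lambda>p. f p * g p) has_derivative (\<lambda>p. 0)) (at 0)"
proof -
  have "(f has_derivative frechet_derivative f (at 0)) (at 0)" "(g has_derivative frechet_derivative g (at 0)) (at 0)"
    using smooth_germ_has_derivative assms(1,2) eventually_nhds_x_imp_x by blast+
  from has_derivative_mult[OF this] show ?thesis by (simp add: assms)
qed

lemma monomial_smooth: "smooth_germ (\<lambda>p::real\<times>real. fst p ^ i * snd p ^ j)"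
  by (intro smooth_intros)

lemma monomial_has_derivative:
  assumes "2 \<le> i + j"
  shows "((\<lambda>p::real\<times>real. fst p ^ i * snd p ^ j) has_derivative (\<lambda>p. 0)) (at 0)"
proof (cases i)
  case 0
  then obtain j' where j: "j = Suc (Suc j')" using assms by (metis add_0 add_2_eq_Suc le_Suc_ex)
  have "((\<lambda>p::real\<times>real. snd p * snd p ^ Suc j') has_derivative (\<lambda>p. 0)) (at 0)"
    by (rule has_derivative_product_zero) (intro smooth_intros, intro smooth_intros, auto)
  then show ?thesis using 0 j by simp
next
  case (Suc i')
  have *: "0 < i' \<or> 0 < j" using Suc assms by arith
  have "((\<lambda>p::real\<times>real. fst p * (fst p ^ i' * snd p ^ j)) has_derivative (\<lambda>p. 0)) (at 0)"
    by (rule has_derivative_product_zero) (intro smooth_intros, intro smooth_intros, use * in auto)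
  then show ?thesis using Suc by (simp add: mult.assoc)
qed

lemma monomial_lead:
  assumes "lead n 1 y"
  shows "lead (4 * i + n * j) 1 (\<lambda>t. fst (t^4, y t) ^ i * snd (t^4, y t) ^ j)"
proof -
  have "lead (i * 4 + j * n) (1 ^ i * 1 ^ j) (\<lambda>t. (t^4) ^ i * y t ^ j)"
    by (intro lead_mult lead_power lead_power_t assms)
  then show ?thesis by (simp add: mult.commute)
qed

lemma reduces_monomial:
  assumes "reduces f n c m k" "k = 4 * i + n * j" "2 \<le> i + j" "0 < n" "n < m" "n < k"
  shows "reduces f n c m (Suc k)"
proof (rule reduces_target_step[where \<mu>="\<lambda>p. fst p ^ i * snd p ^ j" and a=1, OF assms(1)])
  show "lead k 1 (\<lambda>t. fst (t^4, y t) ^ i * snd (t^4, y t) ^ j)" if "vord k (\<lambda>t. y t - (t^n + c * t^m))" for y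
    unfolding assms(2) by (rule monomial_lead[OF vord_normal_form_lead[OF that assms(6,5)]])
qed (use assms in \<open>auto intro: monomial_smooth monomial_has_derivative\<close>)

text \<open>The function y^j has order n j = 4 + w along the curve, so adding it to the first
  coordinate acts at order n + w = n j + n - 4. For j = 1 the change has a linear term in y, which
  leaves the Jacobian triangular.\<close>

lemma reduces_source_power:
  assumes "reduces f n c m k" "k + 4 = n * j + n" "0 < j" "4 < n" "n < m"
  shows "reduces f n c m (Suc k)"
proof (rule reduces_source_step[where \<mu>="\<lambda>p. fst p ^ 0 * snd p ^ j" and a=1 and w="n * j - 4" and b="if j = 1 then 1 else 0", OF assms(1)])
  have nj: "4 < n * j" using assms(3,4) by (cases j) auto
  then show k: "k = n + (n * j - 4)" "0 < n * j - 4" using assms(2) by auto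
  show "lead (4 + (n * j - 4)) 1 (\<lambda>t. fst (t^4, y t) ^ 0 * snd (t^4, y t) ^ j)" if "vord k (\<lambda>t. y t - (t^n + c * t^m))" for y
    using monomial_lead[OF vord_normal_form_lead[OF that], of 0 j] k nj assms(5) by simp
  show "((\<lambda>p::real\<times>real. fst p ^ 0 * snd p ^ j) has_derivative (\<lambda>p. (if j = 1 then 1 else 0) * snd p)) (at 0)"
  proof (cases "j = 1")
    case True
    then show ?thesis by (auto intro!: derivative_eq_intros)
  next
    case False
    then show ?thesis using monomial_has_derivative[of 0 j] assms(3) by simp
  qed
  show "smooth_germ (\<lambda>p::real\<times>real. fst p ^ 0 * snd p ^ j)" by (rule monomial_smooth)
qed (use assms in auto)

text \<open>The equation of the curve that (t^4, t^6) covers twice. On (t^4, t^6 + c t^m) the two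
  leading terms cancel and the order is m + 6; for odd m this supplies odd orders, which monomials
  in t^4 and t^6 cannot.\<close>

definition cusp :: "real \<times> real \<Rightarrow> real" where
  "cusp p = snd p ^ 2 - fst p ^ 3"

lemma cusp_smooth: "smooth_germ cusp"
  unfolding cusp_def[abs_def] by (intro smooth_intros)

lemma cusp_has_derivative: "(cusp has_derivative (\<lambda>p. 0)) (at 0)"
  using has_derivative_diff[OF monomial_has_derivative[of 0 2] monomial_has_derivative[of 3 0]]
  by (simp add: cusp_def[abs_def])

lemma cusp_lead:
  assumes "vord k (\<lambda>t. y t - (t^6 + c * t^m))" "m < k" "6 < m"
  shows "lead (m + 6) (2 * c) (\<lambda>t. cusp (t^4, y t))"
proof -
  have 1: "lead m c (\<lambda>t. y t - t^6)"
    using vord_mono[OF assms(1), of "Suc m"] assms(2) by (simp add: lead_def algebra_simps)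
  have "lead 6 (1 + 1) (\<lambda>t. y t + t^6)"
    using vord_normal_form_lead[OF assms(1)] assms by (intro lead_add lead_power_t) auto
  from lead_mult[OF 1 this] have "lead (m + 6) (2 * c) (\<lambda>t. (y t - t^6) * (y t + t^6))" by (simp add: mult.commute)
  moreover have "(y t - t^6) * (y t + t^6) = cusp (t^4, y t)" for t
    by (simp add: cusp_def algebra_simps power2_eq_square power_mult [symmetric] power_add [symmetric])
  ultimately show ?thesis by simp
qed

lemma reduces_cusp_target:
  assumes "reduces f 6 c m k" "k = m + 6" "6 < m" "c \<noteq> 0"
  shows "reduces f 6 c m (Suc k)"
proof (rule reduces_target_step[where \<mu>=cusp and a="2 * c", OF assms(1)])
  show "lead k (2 * c) (\<lambda>t. cusp (t^4, y t))" if "vord k (\<lambda>t. y t - (t^6 + c * t^m))" for y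
    using cusp_lead[OF that] assms by simp
qed (use assms in \<open>auto intro: cusp_smooth cusp_has_derivative simp: cusp_def\<close>)

text \<open>The order m + 6 of the cusp equation is 4 + (m + 2), so added to the first coordinate it
  acts at order 6 + (m + 2).\<close>

lemma reduces_cusp_source:
  assumes "reduces f 6 c m k" "k = m + 8" "6 < m" "c \<noteq> 0"
  shows "reduces f 6 c m (Suc k)"
proof (rule reduces_source_step[where \<mu>=cusp and a="2 * c" and w="m + 2" and b=0, OF assms(1)])
  show "lead (4 + (m + 2)) (2 * c) (\<lambda>t. cusp (t^4, y t))" if "vord k (\<lambda>t. y t - (t^6 + c * t^m))" for y
    using cusp_lead[OF that] assms by (simp add: add.commute)
qed (use assms in \<open>auto intro: cusp_smooth cusp_has_derivative simp: cusp_def\<close>)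

text \<open>The change X = x + 4 \<delta> y with \<delta> = b/n removes the term of order n + w, and
  its second-order effect at order n + 2w must be tracked. A part b^2 arises because W contains y
  with its own term b t^(n+w); a part b^2 w/(2n) is the quadratic term of (1 + W)^(n/4). For (n, w)
  = (5, 1) and (7, 3) the factor is 11/10 and 17/14.\<close>

lemma reduces_double_source_step:
  assumes f: "A_equivalent f (\<lambda>t. (t^4, y t))" and y: "smooth_germ y"
    and n: "n = 4 + w" "0 < w"
    and exp: "vord (Suc (n + 2 * w)) (\<lambda>t. y t - (t^n + b * t^(n + w) + c * t^(n + 2 * w)))"
  shows "reduces f n (c - b^2 * (1 + real w / (2 * real n))) (n + 2 * w) (Suc (n + 2 * w))"
proof -
  define \<delta> where "\<delta> = b / real n"
  define a where "a = c - b^2 * (1 + real w / (2 * real n))"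
  have y0: "y 0 = 0" using vord_zero[OF exp] n by (simp add: zero_power)
  obtain r where r: "smooth_germ r" "\<forall>\<^sub>F t in nhds 0. y t - (t^n + b * t^(n + w) + c * t^(n + 2 * w)) = t^Suc (n + 2 * w) * r t"
    using exp by (rule vordE)
  \<comment> \<open>y is factored exactly as t^n Z, so that W = 4 \<delta> t^w Z and the comparison
    becomes a polynomial identity in t^w, Z and the remainder.\<close>
  define Z where "Z = (\<lambda>t. 1 + b * t^w + t^(2*w) * (c + t * r t))"
  have sZ: "smooth_germ Z" unfolding Z_def by (intro smooth_intros r)
  have yZ: "\<forall>\<^sub>F t in nhds 0. y t = t^n * Z t"
    using r(2) by eventually_elim (simp add: Z_def algebra_simps power_add)
  define W where "W = (\<lambda>t. 4 * \<delta> * (t^w * Z t))"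
  have sW: "smooth_germ W" unfolding W_def by (intro smooth_intros sZ)
  have vW: "vord w W" unfolding W_def by (intro vord_cmult vord_mult_smooth vord_power_t sZ)
  have W0: "W 0 = 0" using vord_zero[OF vW] n by simp
  let ?p = "real n / 4"
  have e2: "vord (n + 3 * w) (\<lambda>t. t^n * ((1 + W t) powr ?p - (1 + ?p * W t + ?p * (?p - 1) / 2 * W t ^ 2)))"
    by (intro vord_mult vord_power_t powr_expand_2 vW n)
  have e2': "vord (Suc (n + 2 * w)) (\<lambda>t. t^n * ((1 + W t) powr ?p - (1 + ?p * W t + ?p * (?p - 1) / 2 * W t ^ 2)))"
    by (rule vord_mono[OF e2]) (use n in simp)
  have em: "vord w (\<lambda>t. (1 + W t) powr (real (n + 2 * w) / 4) - 1)"
  proof -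
    have "vord w (\<lambda>t. ((1 + W t) powr (real (n + 2 * w) / 4) - (1 + real (n + 2 * w) / 4 * W t)) + real (n + 2 * w) / 4 * W t)"
      by (intro vord_add vord_mono[OF powr_expand_1[OF vW n(2)]] vord_cmult vW) simp
    then show ?thesis by simp
  qed
  have "vord ((n + 2 * w) + w) (\<lambda>t. t^(n + 2 * w) * ((1 + W t) powr (real (n + 2 * w) / 4) - 1))"
    by (intro vord_mult vord_power_t em)
  then have em': "vord (Suc (n + 2 * w)) (\<lambda>t. a * (t^(n + 2 * w) * ((1 + W t) powr (real (n + 2 * w) / 4) - 1)))"
    by (intro vord_cmult) (erule vord_mono, use n in linarith)
  have nz: "real n \<noteq> 0" using n by simp
  have d1: "?p * (4 * \<delta>) = b" using nz by (simp add: \<delta>_def)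
  have wn: "real w = real n - 4" using n by simp
  have d2: "?p * (?p - 1) / 2 * (4 * \<delta>)^2 = b^2 * (real w / (2 * real n))"
    unfolding wn using nz by (simp add: \<delta>_def power2_eq_square field_simps)
  have Z2: "vord 1 (\<lambda>t. Z t ^ 2 - 1)"
    unfolding One_nat_def vord_Suc_0_iff by (intro conjI smooth_intros sZ) (use n in \<open>simp add: Z_def zero_power\<close>)
  have poly: "vord (Suc (n + 2 * w)) (\<lambda>t. t^n * Z t - (t^n * (1 + ?p * W t + ?p * (?p - 1) / 2 * W t ^ 2) + a * t^(n + 2 * w)))"
  proof -
    have "vord ((n + 2 * w) + 1) (\<lambda>t. t^(n + 2 * w) * ((t * r t) + (- b) * (t^w * (c + t * r t)) + (- (b^2 * (real w / (2 * real n)))) * (Z t ^ 2 - 1)))"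
    proof (intro vord_mult vord_power_t vord_add vord_cmult Z2)
      have "vord (1 + 0) (\<lambda>t. t * r t)" using vord_mult[OF vord_power_t[of 1], of 0 r] r(1) by simp
      then show "vord 1 (\<lambda>t. t * r t)" by simp
      have "vord w (\<lambda>t. t^w * (c + t * r t))" by (intro vord_mult_smooth vord_power_t smooth_intros r)
      then show "vord 1 (\<lambda>t. t^w * (c + t * r t))" by (rule vord_mono) (use n in simp)
    qed
    moreover have "t^(n + 2 * w) * ((t * r t) + (- b) * (t^w * (c + t * r t)) + (- (b^2 * (real w / (2 * real n)))) * (Z t ^ 2 - 1))
       = t^n * Z t - (t^n * (1 + ?p * W t + ?p * (?p - 1) / 2 * W t ^ 2) + a * t^(n + 2 * w))" for t
    proof -
      define g where "g = b^2 * (real w / (2 * real n))"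
      have pw: "?p * W t = b * (t^w * Z t)" unfolding W_def using d1 by (metis mult.assoc)
      have "?p * (?p - 1) / 2 * W t ^ 2 = (?p * (?p - 1) / 2 * (4 * \<delta>)^2) * (t^w * Z t)^2"
        unfolding W_def power_mult_distrib[of "4 * \<delta>"] by (simp only: mult.assoc)
      then have pw2: "?p * (?p - 1) / 2 * W t ^ 2 = g * (t^w * Z t)^2" unfolding d2 g_def .
      have a: "a = c - b^2 - g" by (simp add: a_def g_def algebra_simps)
      have "Z t = 1 + b * t^w + t^w * t^w * (c + t * r t)" by (simp add: Z_def mult_2 power_add)
      then show ?thesis unfolding g_def [symmetric] unfolding pw pw2 a unfolding power_add mult_2
        by (simp add: algebra_simps power2_eq_square)
    qed
    ultimately show ?thesis by simp
  qed
  show ?thesis unfolding a_def [symmetric]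
  proof (rule reduces_coordinate_change[where X="\<lambda>p. fst p + 4 * \<delta> * snd p" and Y=snd and v="\<lambda>t. 1 + W t" and b="4 * \<delta>" and d=1, OF f])
    show "smooth_germ (\<lambda>p::real\<times>real. fst p + 4 * \<delta> * snd p)" "smooth_germ (snd :: real \<times> real \<Rightarrow> real)" "smooth_germ (\<lambda>t. 1 + W t)"
      by (intro smooth_intros sW)+
    show "((\<lambda>p::real\<times>real. fst p + 4 * \<delta> * snd p) has_derivative (\<lambda>p. fst p + 4 * \<delta> * snd p)) (at 0)"
      by (auto intro!: derivative_eq_intros)
    show "(snd has_derivative (\<lambda>p. 1 * snd p)) (at (0 :: real \<times> real))" by (rule has_derivative_snd_plane)
    show "\<forall>\<^sub>F t in nhds 0. fst (t^4, y t) + 4 * \<delta> * snd (t^4, y t) = t^4 * (1 + W t)"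
      using yZ by eventually_elim (simp add: W_def n power_add algebra_simps)
    show "vord (Suc (n + 2 * w)) (\<lambda>t. snd (t^4, y t) - (t^n * (1 + W t) powr (real n / 4) + a * (t^(n + 2 * w) * (1 + W t) powr (real (n + 2 * w) / 4))))"
      by (rule vord_cong[OF vord_diff[OF vord_diff[OF poly e2'] em']])
        (use yZ in \<open>eventually_elim, simp add: algebra_simps\<close>)
  qed (use y y0 W0 in auto)
qed

text \<open>With \<open>z = t^2\<close>, the curve \<open>(t^4, t^6)\<close> is the cusp \<open>(z^2, z^3)\<close>; the change used here extends the
  reparametrization \<open>z \<mapsto> z + 2 \<delta> z^2\<close> of the cusp.\<close>

lemma reduces_cusp_step:
  assumes red: "reduces f 6 c m k" and k: "k = m + 2" "6 < m" "c \<noteq> 0"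
  shows "reduces f 6 c m (Suc k)"
proof -
  obtain y where y: "smooth_germ y" "A_equivalent f (\<lambda>t. (t^4, y t))" "vord k (\<lambda>t. y t - (t^6 + c * t^m))"
    using red unfolding reduces_def by blast
  define \<gamma> where "\<gamma> = tc (\<lambda>t. y t - (t^6 + c * t^m)) k"
  have l\<gamma>: "lead k \<gamma> (\<lambda>t. y t - (t^6 + c * t^m))" unfolding \<gamma>_def by (rule lead_of_vord[OF y(3)])
  \<comment> \<open>Two contributions at order m + 2 add up: 6 \<delta> c, because X contains y
    where the exact cusp has t^6, and m \<delta> c, from reparametrizing c t^m.\<close>
  define \<delta> where "\<delta> = \<gamma> / (c * (real m + 6))"
  have y0: "y 0 = 0" using vord_zero[OF y(3)] k by (simp add: zero_power)
  have ls: "lead m c (\<lambda>t. y t - t^6)"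
    using vord_mono[OF y(3), of "Suc m"] k by (simp add: lead_def algebra_simps)
  then obtain S where S: "smooth_germ S" "S 0 = c" "\<forall>\<^sub>F t in nhds 0. y t - t^6 = t^m * S t"
    by (rule leadE)
  define V where "V = (\<lambda>t::real. 1 + 2 * \<delta> * t^2)"
  have sV: "smooth_germ V" unfolding V_def by (intro smooth_intros)
  define m4 where "m4 = m - 4"
  have m4: "m = 4 + m4" "3 \<le> m4" using k by (auto simp: m4_def)
  define W where "W = (\<lambda>t. 4 * \<delta> * t^2 + 4 * \<delta>^2 * t^4 + 4 * \<delta> * (t^m4 * S t))"
  have V2: "1 + W t = V t ^ 2 + 4 * \<delta> * (t^m4 * S t)" for t
    by (simp add: W_def V_def algebra_simps power2_eq_square power_add [symmetric] eval_nat_numeral)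
  define W2 where "W2 = (\<lambda>t. t^m4 * (4 * \<delta> * S t / V t ^ 2))"
  have sdiv: "smooth_germ (\<lambda>t. 4 * \<delta> * S t / V t ^ 2)"
    by (rule smooth_germ_divide) (intro smooth_intros S(1), intro smooth_intros sV, simp add: V_def)
  have W2: "vord m4 W2" unfolding W2_def by (intro vord_mult_smooth vord_power_t sdiv)
  have sW: "smooth_germ W" unfolding W_def by (intro smooth_intros S(1))
  have W: "vord 2 W"
  proof -
    have "vord 2 (\<lambda>t. 4 * \<delta> * t^2 + 4 * \<delta>^2 * t^4 + 4 * \<delta> * (t^m4 * S t))"
      by (intro vord_add vord_cmult vord_mult_smooth S(1) vord_mono[OF vord_power_t]) (use m4 in auto)
    then show ?thesis by (simp add: W_def)
  qed
  have "vord (2 * m4) (\<lambda>t. (1 + W2 t) powr (3/2) - (1 + 3/2 * W2 t))" by (rule powr_expand_1[OF W2]) (use m4 in simp)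
  then have "vord (6 + 2 * m4) (\<lambda>t. t^6 * (((1 + W2 t) powr (3/2) - (1 + 3/2 * W2 t)) * V t ^ 3))"
    by (intro vord_mult vord_power_t vord_mult_smooth smooth_intros sV)
  then have P1: "vord (Suc k) (\<lambda>t. t^6 * (((1 + W2 t) powr (3/2) - (1 + 3/2 * W2 t)) * V t ^ 3))"
    by (rule vord_mono) (use m4 k in simp)
  have P2: "lead k (6 * \<delta> * (1 * c)) (\<lambda>t. 6 * \<delta> * (t^k * (S t * V t)))"
  proof -
    have "lead k (1 * c) (\<lambda>t. t^k * (S t * V t))"
      by (rule leadI[of "\<lambda>t. S t * V t"]) (intro smooth_intros S(1) sV, simp add: S(2) V_def, simp)
    then show ?thesis by (rule lead_cmult)
  qed
  have P3: "lead k (c * (1 * (real m / 4 * (4 * \<delta>)))) (\<lambda>t. c * (t^m * ((1 + W t) powr (real m / 4) - 1)))"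
  proof -
    have A: "vord (2 * 2) (\<lambda>t. (1 + W t) powr (real m / 4) - (1 + real m / 4 * W t))"
      by (rule powr_expand_1[OF W]) simp
    have "lead 2 (4 * \<delta>) (\<lambda>t. 4 * \<delta> * t^2 + (4 * \<delta>^2 * t^4 + 4 * \<delta> * (t^m4 * S t)))"
      by (intro lead_add_higher lead_monomial vord_add vord_cmult vord_mult_smooth S(1) vord_mono[OF vord_power_t])
        (use m4 in auto)
    then have "lead 2 (4 * \<delta>) W" by (simp add: W_def add.assoc)
    then have "lead 2 (real m / 4 * (4 * \<delta>)) (\<lambda>t. real m / 4 * W t + ((1 + W t) powr (real m / 4) - (1 + real m / 4 * W t)))"
      by (intro lead_add_higher lead_cmult vord_mono[OF A]) auto
    then have "lead 2 (real m / 4 * (4 * \<delta>)) (\<lambda>t. (1 + W t) powr (real m / 4) - 1)" by simp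
    then show ?thesis unfolding k(1) by (intro lead_cmult lead_mult lead_power_t)
  qed
  have P4: "vord (Suc k) (\<lambda>t. 12 * \<delta>^2 * (t^4 * (y t - t^6)))"
  proof -
    have "vord (4 + m) (\<lambda>t. t^4 * (y t - t^6))" by (intro vord_mult vord_power_t lead_vord[OF ls])
    then show ?thesis by (intro vord_cmult) (erule vord_mono, use k in simp)
  qed
  have "\<gamma> + ((-1) * (6 * \<delta> * (1 * c)) + (-1) * (c * (1 * (real m / 4 * (4 * \<delta>))))) = 0"
  proof -
    have "\<delta> * (c * (real m + 6)) = \<gamma>" using k by (simp add: \<delta>_def)
    then show ?thesis by (simp add: algebra_simps)
  qed
  with lead_add[OF l\<gamma> lead_add[OF lead_cmult[OF P2, of "-1"] lead_cmult[OF P3, of "-1"]]]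
  have P: "vord (Suc k) (\<lambda>t. (y t - (t^6 + c * t^m)) + ((-1) * (6 * \<delta> * (t^k * (S t * V t))) + (-1) * (c * (t^m * ((1 + W t) powr (real m / 4) - 1)))))"
    by (simp only: lead_zero)
  \<comment> \<open>This is z^3 (1 + 2 \<delta> z)^3 expanded and rewritten with x = z^2, y = z^3;
    likewise the first coordinate is z^2 (1 + 2 \<delta> z)^2. On the curve, y differs from t^6 by
    t^m S, which is what \<open>P2\<close> and \<open>P4\<close> account for.\<close>
  let ?Y = "\<lambda>p::real\<times>real. snd p + 6 * \<delta> * fst p ^ 2 + 12 * \<delta>^2 * (fst p * snd p) + 8 * \<delta>^3 * fst p ^ 3"
  have Vpos: "\<forall>\<^sub>F t in nhds 0. V t > 0"
    using smooth_germ_tendsto[OF sV] by (rule order_tendstoD) (simp add: V_def)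
  have sW2: "smooth_germ W2" "W2 0 = 0" using W2 vord_smooth vord_zero m4 by auto
  have W2pos: "\<forall>\<^sub>F t in nhds 0. W2 t > -1"
    using smooth_germ_tendsto[OF sW2(1)] by (rule order_tendstoD) (simp add: sW2(2))
  show ?thesis
  proof (rule reduces_coordinate_change[where X="\<lambda>p. fst p + 4 * \<delta> * snd p + 4 * \<delta>^2 * fst p ^ 2" and
        Y="?Y" and v="\<lambda>t. 1 + W t" and b="4 * \<delta>" and d=1, OF y(2)])
    show "smooth_germ (\<lambda>p::real\<times>real. fst p + 4 * \<delta> * snd p + 4 * \<delta>^2 * fst p ^ 2)" "smooth_germ ?Y" "smooth_germ (\<lambda>t. 1 + W t)"
      by (intro smooth_intros sW)+
    show "((\<lambda>p::real\<times>real. fst p + 4 * \<delta> * snd p + 4 * \<delta>^2 * fst p ^ 2) has_derivative (\<lambda>p. fst p + 4 * \<delta> * snd p)) (at 0)"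
      by (auto intro!: derivative_eq_intros)
    show "(?Y has_derivative (\<lambda>p. 1 * snd p)) (at 0)"
      by (auto intro!: derivative_eq_intros)
    show "\<forall>\<^sub>F t in nhds 0. fst (t^4, y t) + 4 * \<delta> * snd (t^4, y t) + 4 * \<delta>^2 * fst (t^4, y t) ^ 2 = t^4 * (1 + W t)"
      using S(3)
    proof eventually_elim
      case (elim t)
      then have "y t = t^6 + t^4 * (t^m4 * S t)" by (simp add: m4 power_add)
      then show ?case by (simp add: W_def algebra_simps power_add [symmetric] power_mult [symmetric])
    qed
    show "vord (Suc k) (\<lambda>t. ?Y (t^4, y t) - (t^6 * (1 + W t) powr (real 6 / 4) + c * (t^m * (1 + W t) powr (real m / 4))))"
    proof (rule vord_cong[OF vord_diff[OF vord_add[OF P P4] P1]])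
      show "\<forall>\<^sub>F t in nhds 0. ((y t - (t^6 + c * t^m)) + ((-1) * (6 * \<delta> * (t^k * (S t * V t))) + (-1) * (c * (t^m * ((1 + W t) powr (real m / 4) - 1)))))
          + 12 * \<delta>^2 * (t^4 * (y t - t^6)) - t^6 * (((1 + W2 t) powr (3/2) - (1 + 3/2 * W2 t)) * V t ^ 3)
        = ?Y (t^4, y t) - (t^6 * (1 + W t) powr (real 6 / 4) + c * (t^m * (1 + W t) powr (real m / 4)))"
        using Vpos W2pos
      proof eventually_elim
        case (elim t)
        have "1 + W t = V t ^ 2 * (1 + W2 t)"
          unfolding V2 W2_def using elim(1) by (simp add: distrib_left)
        then have "(1 + W t) powr (real 6 / 4) = (V t ^ 2) powr (3/2) * (1 + W2 t) powr (3/2)"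
          using elim by (simp add: powr_mult)
        also have "(V t ^ 2) powr (3/2) = V t ^ 3"
        proof -
          have "(V t ^ 2) powr (3/2) = (V t powr 2) powr (3/2)" using elim(1) by simp
          also have "\<dots> = V t powr 3" by (simp only: powr_powr) simp
          also have "\<dots> = V t ^ 3" using elim(1) by simp
          finally show ?thesis .
        qed
        finally have e: "(1 + W t) powr (real 6 / 4) = V t ^ 3 * (1 + W2 t) powr (3/2)" .
        have "W2 t * V t ^ 3 = 4 * \<delta> * (t^m4 * (S t * V t))"
          using elim(1) by (simp add: W2_def power2_eq_square power3_eq_cube)
        then have "t^6 * (3/2 * W2 t * V t ^ 3) = 6 * \<delta> * (t^6 * t^m4 * (S t * V t))" by simp
        also have "t^6 * t^m4 = t^k" unfolding k m4(1) by (simp add: power_add [symmetric] add.commute)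
        finally have e2: "t^6 * (3/2 * W2 t * V t ^ 3) = 6 * \<delta> * (t^k * (S t * V t))" .
        have e3: "t^6 * V t ^ 3 = t^6 + 6 * \<delta> * (t^4)^2 + 12 * \<delta>^2 * (t^4 * t^6) + 8 * \<delta>^3 * (t^4)^3"
          by (simp add: V_def eval_nat_numeral algebra_simps)
        define A where "A = (1 + W2 t) powr (3/2)"
        define B where "B = (1 + W t) powr (real m / 4)"
        have "t^6 * ((A - (1 + 3/2 * W2 t)) * V t ^ 3) = t^6 * (V t ^ 3 * A) - t^6 * V t ^ 3 - t^6 * (3/2 * W2 t * V t ^ 3)"
          by (simp add: algebra_simps)
        then show ?case unfolding e A_def [symmetric] B_def [symmetric] e2 e3
          by (simp add: algebra_simps)
      qed
    qed
  qed (use y(1) y0 vord_zero[OF W] in auto)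
qed

section \<open>Normal forms\<close>

lemma normal_form_lead: "n < m \<Longrightarrow> lead n 1 (\<lambda>t. t^n + c * t^m)"
  by (intro lead_add_higher lead_power_t vord_cmult vord_mono[OF vord_power_t]) auto

lemma normal_form_factor: "n < m \<Longrightarrow> t^n + c * t^m = t^n * (1 + c * t^(m - n))" for t :: real
  by (simp add: distrib_left power_add [symmetric] mult.left_commute)

lemma reduces_imp_equivalent_monomials:
  assumes red: "reduces f n c m N" and n: "4 < n" "n < 8" "n < m" "8 \<le> N"
    and ab: "\<And>j. j < 4 \<Longrightarrow> 4 * a j + n * b j = N + j"
  shows "A_equivalent f (\<lambda>t. (t^4, t^n + c * t^m))"
proof -
  obtain y where y: "A_equivalent f (\<lambda>t. (t^4, y t))" "vord N (\<lambda>t. y t - (t^n + c * t^m))"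
    using red unfolding reduces_def by blast
  let ?q = "\<lambda>t. t^n + c * t^m"
  let ?u = "\<lambda>t. 1 + c * t^(m - n)"
  have "A_equivalent (\<lambda>t. (t^4, y t)) (\<lambda>t. (t^4, ?q t))"
  proof (rule determinacy[where E="\<lambda>j p. fst p ^ a j * snd p ^ b j" and w="\<lambda>j t. ?u t ^ b j" and n=n and N=N])
    show "vord n ?q" "tc ?q n \<noteq> 0"
      using lead_vord[OF normal_form_lead[OF n(3)]] lead_tc[OF normal_form_lead[OF n(3), of c]] by auto
    show "smooth_germ (\<lambda>t. ?u t ^ b j)" for j by (intro smooth_intros)
    show "\<forall>\<^sub>F t in nhds 0. fst (t^4, ?q t) ^ a j * snd (t^4, ?q t) ^ b j = t^(N + j) * ?u t ^ b j" if "j < 4" for j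
    proof (intro always_eventually allI)
      fix t :: real
      have "fst (t^4, ?q t) ^ a j * snd (t^4, ?q t) ^ b j = (t^4) ^ a j * (t^n * ?u t) ^ b j"
        by (simp only: fst_conv snd_conv normal_form_factor[OF n(3)])
      also have "\<dots> = t^(4 * a j + n * b j) * ?u t ^ b j"
        by (simp only: power_mult_distrib power_mult power_add mult.assoc)
      finally show "fst (t^4, ?q t) ^ a j * snd (t^4, ?q t) ^ b j = t^(N + j) * ?u t ^ b j"
        by (simp only: ab[OF that])
    qed
    show "?u 0 ^ b j \<noteq> 0" for j using n by (simp add: zero_power)
  qed (use n y(2) in \<open>auto intro: monomial_smooth\<close>)
  then show ?thesis by (rule A_equivalent_trans[OF y(1)])
qed

lemma even_monomial:
  assumes "even (e::nat)" "8 \<le> e"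
  obtains i j where "e = 4 * i + 6 * j" "2 \<le> i + j"
proof (cases "4 dvd e")
  case True
  then obtain i where "e = 4 * i" by auto
  then show ?thesis using assms that[of i 0] by auto
next
  case False
  obtain k where "e = 2 * k" using assms by auto
  moreover have "odd k" using False calculation by auto
  then obtain l where "k = 2 * l + 1" by (rule oddE)
  ultimately have "e = 4 * (l - 1) + 6 * 1" "2 \<le> (l - 1) + 1" using assms by auto
  then show ?thesis by (rule that)
qed

text \<open>From m + 9 on four consecutive orders are available: the even orders m + 9 and m + 11
  from monomials, m + 10 = 4 + (m + 6) and m + 12 = 6 + (m + 6) from the cusp equation times a
  coordinate.\<close>

lemma reduces_imp_equivalent_cusp:
  assumes red: "reduces f 6 c m (m + 9)" and m: "6 < m" "odd m" "c \<noteq> 0"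
  shows "A_equivalent f (\<lambda>t. (t^4, t^6 + c * t^m))"
proof -
  obtain y where y: "A_equivalent f (\<lambda>t. (t^4, y t))" "vord (m + 9) (\<lambda>t. y t - (t^6 + c * t^m))"
    using red unfolding reduces_def by blast
  obtain i0 j0 where 0: "m + 9 = 4 * i0 + 6 * j0" by (rule even_monomial[of "m + 9"]) (use m in auto)
  obtain i2 j2 where 2: "m + 11 = 4 * i2 + 6 * j2" by (rule even_monomial[of "m + 11"]) (use m in auto)
  let ?q = "\<lambda>t. t^6 + c * t^m"
  let ?u = "\<lambda>t. 1 + c * t^(m - 6)"
  let ?k = "\<lambda>t. c * (2 + c * t^(m - 6))"
  let ?E = "\<lambda>(j::nat) p. if j = 0 then fst p ^ i0 * snd p ^ j0 else if j = 1 then fst p * cusp p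
      else if j = 2 then fst p ^ i2 * snd p ^ j2 else snd p * cusp p"
  let ?w = "\<lambda>(j::nat) t. if j = 0 then ?u t ^ j0 else if j = 1 then ?k t else if j = 2 then ?u t ^ j2 else ?u t * ?k t"
  have cusp: "cusp (t^4, ?q t) = t^(m + 6) * ?k t" for t
  proof -
    have tm: "t^m = t^6 * t^(m - 6)" using m by (simp add: power_add [symmetric])
    have "cusp (t^4, ?q t) = (c * t^m) * (2 * t^6 + c * t^m)"
      by (simp add: cusp_def power2_eq_square algebra_simps power_mult [symmetric] power_add [symmetric])
    also have "\<dots> = (t^m * t^6) * (c * (2 + c * t^(m - 6)))"
      by (subst (2) tm) (simp add: algebra_simps)
    finally show ?thesis by (simp only: power_add)
  qed
  have mono: "(t^4) ^ i * ?q t ^ j = t^(4 * i + 6 * j) * ?u t ^ j" for i j and t :: real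
  proof -
    have "(t^4) ^ i * ?q t ^ j = (t^4) ^ i * (t^6 * ?u t) ^ j"
      using normal_form_factor[OF m(1), of t c] by simp
    then show ?thesis by (simp only: power_mult_distrib power_mult power_add mult.assoc)
  qed
  have "A_equivalent (\<lambda>t. (t^4, y t)) (\<lambda>t. (t^4, ?q t))"
  proof (rule determinacy[where E="?E" and w="?w" and n=6 and N="m + 9"])
    show "vord 6 ?q" "tc ?q 6 \<noteq> 0"
      using lead_vord[OF normal_form_lead[OF m(1)]] lead_tc[OF normal_form_lead[OF m(1), of c]] by auto
    show "smooth_germ (?w j)" if "j < 4" for j
    proof -
      have "smooth_germ (\<lambda>t. ?u t ^ j0)" "smooth_germ ?k" "smooth_germ (\<lambda>t. ?u t ^ j2)" "smooth_germ (\<lambda>t. ?u t * ?k t)"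
        by (intro smooth_intros)+
      then show ?thesis by (cases "j = 0"; cases "j = 1"; cases "j = 2") simp_all
    qed
    show "smooth_germ (?E j)" if "j < 4" for j
    proof -
      have "smooth_germ (\<lambda>p::real\<times>real. fst p ^ i0 * snd p ^ j0)" "smooth_germ (\<lambda>p. fst p * cusp p)"
        "smooth_germ (\<lambda>p::real\<times>real. fst p ^ i2 * snd p ^ j2)" "smooth_germ (\<lambda>p. snd p * cusp p)"
        by (intro smooth_intros cusp_smooth)+
      then show ?thesis by (cases "j = 0"; cases "j = 1"; cases "j = 2") simp_all
    qed
    show "?w j 0 \<noteq> 0" if "j < 4" for j using m by (auto simp: zero_power)
    show "\<forall>\<^sub>F t in nhds 0. ?E j (t^4, ?q t) = t^(m + 9 + j) * ?w j t" if "j < 4" for j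
    proof (intro always_eventually allI)
      fix t :: real
      have A: "fst (t^4, ?q t) ^ i0 * snd (t^4, ?q t) ^ j0 = t^(m + 9 + 0) * ?u t ^ j0"
        using mono[where i=i0 and j=j0 and t=t] by (simp add: 0)
      have B: "fst (t^4, ?q t) * cusp (t^4, ?q t) = t^(m + 9 + 1) * ?k t"
        unfolding cusp by (simp add: power_add eval_nat_numeral)
      have C: "fst (t^4, ?q t) ^ i2 * snd (t^4, ?q t) ^ j2 = t^(m + 9 + 2) * ?u t ^ j2"
        using mono[where i=i2 and j=j2 and t=t] by (simp add: 2 [symmetric] add.commute)
      have "snd (t^4, ?q t) * cusp (t^4, ?q t) = (t^6 * ?u t) * (t^(m + 6) * ?k t)"
        unfolding cusp using normal_form_factor[OF m(1), of t c] by simp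
      also have "\<dots> = t^(m + 9 + 3) * (?u t * ?k t)" by (simp add: power_add eval_nat_numeral)
      finally have D: "snd (t^4, ?q t) * cusp (t^4, ?q t) = t^(m + 9 + 3) * (?u t * ?k t)" .
      have "j = 0 \<or> j = 1 \<or> j = 2 \<or> j = 3" using that by linarith
      then show "?E j (t^4, ?q t) = t^(m + 9 + j) * ?w j t"
        by (elim disjE) (simp_all only: A B C D refl if_True if_False one_neq_zero zero_neq_one zero_neq_numeral numeral_neq_zero
            numeral_eq_iff num.distinct numeral_eq_one_iff one_eq_numeral_iff simp_thms)
    qed
  qed (use y(2) in auto)
  then show ?thesis by (rule A_equivalent_trans[OF y(1)])
qed

lemma normal_form_scale:
  assumes "l \<noteq> 0" "n < m" "0 < n"
  shows "A_equivalent (\<lambda>t. (t^4, t^n + c * t^m)) (\<lambda>t. (t^4, t^n + c * l^(m - n) * t^m))"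
proof -
  let ?f = "\<lambda>t. (t^4, t^n + c * t^m)" and ?g = "\<lambda>t. (t^4, t^n + c * l^(m - n) * t^m)"
  have s: "smooth_map_germ (\<lambda>t::real. (t^4, t^n + a * t^m))" for a
    unfolding smooth_map_germ_def
    by (intro conjI smooth_intros) (use assms in \<open>simp add: zero_prod_def zero_power\<close>)
  have "diffeo_germ (\<lambda>t::real. l * t)"
  proof (rule diffeo_germ_real)
    have "deriv (\<lambda>t. l * t) 0 = l" by (intro DERIV_imp_deriv) (auto intro!: derivative_eq_intros)
    then show "deriv (\<lambda>t. l * t) 0 \<noteq> 0" using assms by simp
  qed (intro smooth_intros, simp)
  moreover have "diffeo_germ (\<lambda>p::real\<times>real. (l^4 * fst p, l^n * snd p))"
  proof (rule diffeo_germ_plane[where a="l^4" and b=0 and c=0 and d="l^n"])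
    show "smooth_germ (\<lambda>p::real\<times>real. (l^4 * fst p, l^n * snd p))" by (intro smooth_intros)
    show "((\<lambda>p::real\<times>real. (l^4 * fst p, l^n * snd p)) has_derivative (\<lambda>p. (l^4 * fst p + 0 * snd p, 0 * fst p + l^n * snd p))) (at 0)"
      by (auto intro!: derivative_eq_intros)
  qed (use assms in \<open>auto simp: zero_prod_def\<close>)
  moreover have "?f (l * t) = (\<lambda>p. (l^4 * fst p, l^n * snd p)) (?g t)" for t
  proof -
    have "l^m = l^n * l^(m - n)" using assms by (simp add: power_add [symmetric])
    then show ?thesis by (simp add: power_mult_distrib algebra_simps)
  qed
  ultimately show ?thesis unfolding A_equivalent_def using s[of c] s[of "c * l^(m - n)"]
    by (intro conjI exI[of _ "\<lambda>t. l * t"] exI[of _ "\<lambda>p. (l^4 * fst p, l^n * snd p)"]) auto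
qed

text \<open>The rescaling t \<mapsto> l t multiplies \<open>c\<close> by l^(m - n). For m - n even
  the sign of \<open>c\<close> is kept, as for t^5 and t^7, t^7 and t^9, t^7 and t^13; for m - n odd
  a negative l reverses it, as in the family W^#.\<close>

lemma normal_form_sign:
  assumes f: "A_equivalent f (\<lambda>t. (t^4, t^n + c * t^m))" and n: "0 < n" "n < m"
  shows "c > 0 \<Longrightarrow> A_equivalent f (\<lambda>t. (t^4, t^n + t^m))"
    and "c < 0 \<Longrightarrow> A_equivalent f (\<lambda>t. (t^4, t^n - t^m))"
    and "c = 0 \<Longrightarrow> A_equivalent f (\<lambda>t. (t^4, t^n))"
    and "c \<noteq> 0 \<Longrightarrow> odd (m - n) \<Longrightarrow> A_equivalent f (\<lambda>t. (t^4, t^n + t^m))"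
proof -
  have *: "A_equivalent f (\<lambda>t. (t^4, t^n + a * t^m))" if "c * l^(m - n) = a" "l \<noteq> 0" for a l
    using A_equivalent_trans[OF f normal_form_scale[of l n m c]] that n by simp
  show "A_equivalent f (\<lambda>t. (t^4, t^n + t^m))" if "c > 0"
    using *[of "root (m - n) (1 / c)" 1] that n by (simp add: real_root_pow_pos2)
  show "A_equivalent f (\<lambda>t. (t^4, t^n - t^m))" if "c < 0"
    using *[of "root (m - n) (1 / (- c))" "-1"] that n by (simp add: real_root_pow_pos2 del: minus_divide_right)
  show "A_equivalent f (\<lambda>t. (t^4, t^n))" if "c = 0"
    using f that by simp
  show "A_equivalent f (\<lambda>t. (t^4, t^n + t^m))" if "c \<noteq> 0" "odd (m - n)"
    using *[of "root (m - n) (1 / c)" 1] that n by (simp add: odd_real_root_pow)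
qed

section \<open>Elimination sequences for the three types\<close>

lemma less_4_cases: "(j::nat) < 4 \<Longrightarrow> j = 0 \<or> j = 1 \<or> j = 2 \<or> j = 3"
  by linarith

text \<open>In the semigroup of 4 and 5 the numbers 8, 9, 10 are values of monomials and 12 is the
  conductor. The remaining gap 11 = 5 + (10 - 4) is reached by y^2 in the first coordinate; the gap
  6 is removed by y itself at the cost 11/10 b^2 at order 7.\<close>

lemma W12_normal_form:
  assumes f: "A_equivalent f (\<lambda>t. (t^4, y t))" and y: "smooth_germ y"
    and exp: "vord 8 (\<lambda>t. y t - (t^5 + b * t^6 + c * t^7))"
  shows "A_equivalent f (\<lambda>t. (t^4, t^5 + (c - 11/10 * b^2) * t^7))"
proof -
  define a where "a = c - 11/10 * b^2"
  have "reduces f 5 (c - b^2 * (1 + real 1 / (2 * real 5))) (5 + 2 * 1) (Suc (5 + 2 * 1))"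
    by (rule reduces_double_source_step[OF f y]) (use exp in auto)
  moreover have "c - b^2 * (1 + real 1 / (2 * real 5)) = a" by (simp add: a_def)
  ultimately have "reduces f 5 a 7 8" by simp
  then have "reduces f 5 a 7 (Suc 8)" by (rule reduces_monomial[where i=2 and j=0]) auto
  then have "reduces f 5 a 7 (Suc (Suc 8))" by (rule reduces_monomial[where i=1 and j=1]) auto
  then have "reduces f 5 a 7 (Suc (Suc (Suc 8)))" by (rule reduces_monomial[where i=0 and j=2]) auto
  then have "reduces f 5 a 7 (Suc (Suc (Suc (Suc 8))))" by (rule reduces_source_power[where j=2]) auto
  then have "reduces f 5 a 7 12" by simp
  then have "A_equivalent f (\<lambda>t. (t^4, t^5 + a * t^7))"
    by (rule reduces_imp_equivalent_monomials[where a="\<lambda>j. 3 - j" and b="\<lambda>j. j"]) auto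
  then show ?thesis by (simp add: a_def)
qed

text \<open>In the semigroup of 4 and 7 only the gap 17 lies above 13; it equals 7 + (14 - 4) and is
  reached by y^2 in the first coordinate. From 18 on, xy^2, x^3 y, x^5 and y^3 have the four
  consecutive orders needed.\<close>

lemma W18_tail:
  assumes "reduces f 7 c m 14" "7 < m"
  shows "A_equivalent f (\<lambda>t. (t^4, t^7 + c * t^m))"
proof -
  have "reduces f 7 c m (Suc 14)" by (rule reduces_monomial[OF assms(1), where i=0 and j=2]) (use assms(2) in auto)
  then have "reduces f 7 c m (Suc (Suc 14))" by (rule reduces_monomial[where i=2 and j=1]) (use assms(2) in auto)
  then have "reduces f 7 c m (Suc (Suc (Suc 14)))" by (rule reduces_monomial[where i=4 and j=0]) (use assms(2) in auto)
  then have "reduces f 7 c m (Suc (Suc (Suc (Suc 14))))" by (rule reduces_source_power[where j=2]) (use assms(2) in auto)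
  then have "reduces f 7 c m 18" by simp
  then show ?thesis
    by (rule reduces_imp_equivalent_monomials[where a="\<lambda>j. if j = 0 then 1 else if j = 1 then 3 else if j = 2 then 5 else 0"
          and b="\<lambda>j. if j = 0 then 2 else if j = 1 then 1 else if j = 2 then 0 else 3"])
      (use assms(2) in \<open>auto dest: less_4_cases\<close>)
qed

lemma W18_normal_form_9:
  assumes "reduces f 7 c 9 10" "c \<noteq> 0"
  shows "A_equivalent f (\<lambda>t. (t^4, t^7 + c * t^9))"
proof (rule W18_tail)
  have "reduces f 7 c 9 (Suc 10)" by (rule reduces_source_power[OF assms(1), where j=1]) auto
  then have "reduces f 7 c 9 (Suc (Suc 10))" by (rule reduces_monomial[where i=1 and j=1]) auto
  then have "reduces f 7 c 9 (Suc (Suc (Suc 10)))" by (rule reduces_monomial[where i=3 and j=0]) auto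
  then have "reduces f 7 c 9 (Suc (Suc (Suc (Suc 10))))" by (rule reduces_scale_step) (use assms(2) in auto)
  then show "reduces f 7 c 9 14" by simp
qed simp

lemma W18_normal_form_13:
  assumes f: "A_equivalent f (\<lambda>t. (t^4, y t))" and y: "smooth_germ y"
    and exp: "vord 14 (\<lambda>t. y t - (t^7 + b * t^10 + c * t^13))"
  shows "A_equivalent f (\<lambda>t. (t^4, t^7 + (c - 17/14 * b^2) * t^13))"
proof (rule W18_tail)
  have "reduces f 7 (c - b^2 * (1 + real 3 / (2 * real 7))) (7 + 2 * 3) (Suc (7 + 2 * 3))"
    by (rule reduces_double_source_step[OF f y]) (use exp in auto)
  moreover have "c - b^2 * (1 + real 3 / (2 * real 7)) = c - 17/14 * b^2" by simp
  ultimately show "reduces f 7 (c - 17/14 * b^2) 13 14" by (simp only:) simp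
qed simp

text \<open>Even orders are values of monomials. The odd ones above m each use another change: m + 2
  the reparametrized cusp, m + 4 the scaling, m + 6 and m + 8 the cusp equation in the second and in
  the first coordinate.\<close>

lemma W1_sharp_normal_form:
  assumes red: "reduces f 6 c m (m + 1)" and m: "6 < m" "odd m" "c \<noteq> 0"
  shows "A_equivalent f (\<lambda>t. (t^4, t^6 + t^m))"
proof -
  have mono: "reduces f 6 c m k'" if "reduces f 6 c m k" "even k" "m < k" "k' = Suc k" for k k'
  proof -
    have "8 \<le> k" using that(3) m(1) by linarith
    then obtain i j where "k = 4 * i + 6 * j" "2 \<le> i + j"
      using even_monomial[OF \<open>even k\<close>] by blast
    then show ?thesis using reduces_monomial[OF that(1)] that(3,4) m(1) by auto
  qed
  have "reduces f 6 c m (m + 2)" by (rule mono[OF red]) (use m in auto)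
  from reduces_cusp_step[OF this] have "reduces f 6 c m (m + 3)" using m by (simp add: eval_nat_numeral)
  then have "reduces f 6 c m (m + 4)" by (rule mono) (use m in auto)
  from reduces_scale_step[OF this] have "reduces f 6 c m (m + 5)" using m by (simp add: eval_nat_numeral)
  then have "reduces f 6 c m (m + 6)" by (rule mono) (use m in auto)
  from reduces_cusp_target[OF this] have "reduces f 6 c m (m + 7)" using m by (simp add: eval_nat_numeral)
  then have "reduces f 6 c m (m + 8)" by (rule mono) (use m in auto)
  from reduces_cusp_source[OF this] have "reduces f 6 c m (m + 9)" using m by (simp add: eval_nat_numeral)
  from reduces_imp_equivalent_cusp[OF this m]
  have "A_equivalent f (\<lambda>t. (t^4, t^6 + c * t^m))" .
  then show ?thesis by (rule normal_form_sign(4)) (use m in auto)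
qed

section \<open>Expansions of the curve\<close>

lemma smooth_on_antiderivative:
  fixes f :: "real \<Rightarrow> real"
  assumes "open U" "\<And>x. x \<in> U \<Longrightarrow> (f has_real_derivative f' x) (at x)" "smooth_on U f'"
  shows "smooth_on U f"
proof (rule smooth_on_coinduct[where P="\<lambda>g. g = f \<or> smooth_on U g"])
  fix g assume "g = f \<or> smooth_on U g"
  then show "\<exists>g'. (g' = f \<or> smooth_on U g') \<and> (\<forall>x\<in>U. (g has_real_derivative g' x) (at x))"
  proof
    assume "g = f"
    then show ?thesis using assms(2,3) by blast
  next
    assume "smooth_on U g"
    then show ?thesis using smooth_on_deriv[OF assms(1)] smooth_on_DERIV by blast
  qed
qed (use assms in auto)

lemma interval_integral_has_vector_derivative:
  fixes f :: "real \<Rightarrow> 'a::euclidean_space"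
  assumes "continuous_on (ball 0 e) f" "s \<in> ball 0 e"
  shows "((\<lambda>s. LBINT u=0..ereal s. f u) has_vector_derivative f s) (at s)"
proof -
  define r where "r = (\<bar>s\<bar> + e) / 2"
  have r: "\<bar>s\<bar> < r" "r < e" using assms(2) by (auto simp: r_def dist_real_def)
  have "continuous_on {- r..r} f" by (rule continuous_on_subset[OF assms(1)]) (use r in \<open>auto simp: dist_real_def\<close>)
  then have "((\<lambda>u. LBINT y=0..u. f y) has_vector_derivative f s) (at s within {- r..r})"
    using interval_integral_FTC2[of "- r" 0 r f s] r by (simp add: zero_ereal_def)
  then show ?thesis using r by (subst (asm) at_within_interior) auto
qed

lemma phi4_germs:
  assumes "smooth_germ \<kappa>"
  defines "\<theta> \<equiv> theta \<kappa>"
  defines "\<phi>1 \<equiv> \<lambda>s. fst (phi4 \<kappa> s)" and "\<phi>2 \<equiv> \<lambda>s. snd (phi4 \<kappa> s)"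
  shows "smooth_germ \<theta>" "\<theta> 0 = 0" "smooth_germ \<phi>1" "smooth_germ \<phi>2" "\<phi>1 0 = 0" "\<phi>2 0 = 0"
    "\<forall>\<^sub>F s in nhds 0. (\<phi>1 has_real_derivative s^3 / 6 * cos (\<theta> s)) (at s)"
    "\<forall>\<^sub>F s in nhds 0. (\<phi>2 has_real_derivative s^3 / 6 * sin (\<theta> s)) (at s)"
proof -
  obtain e where e: "e > 0" "smooth_on (ball 0 e) \<kappa>" using smooth_germ_ball[OF assms(1)] .
  have "(\<theta> has_real_derivative \<kappa> s) (at s)" if "s \<in> ball 0 e" for s
    using interval_integral_has_vector_derivative[OF smooth_on_continuous[OF e(2)] that]
    unfolding \<theta>_def theta_def[abs_def] has_real_derivative_iff_has_vector_derivative .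
  then have s\<theta>: "smooth_on (ball 0 e) \<theta>"
    by (rule smooth_on_antiderivative[OF open_ball _ e(2)])
  have c: "smooth_on (ball 0 e) (\<lambda>s. cos (\<theta> s))" "smooth_on (ball 0 e) (\<lambda>s. sin (\<theta> s))"
    using smooth_on_compose[OF open_ball open_UNIV _ s\<theta>] smooth_on_cos smooth_on_sin by blast+
  have p: "smooth_on (ball 0 e) (\<lambda>s::real. s^3 / 6)"
  proof -
    have "smooth_on (ball 0 e) (\<lambda>s::real. s)" by (simp add: smooth_on_def Ck_on_id)
    from smooth_on_power[OF open_ball this, of 3] have "smooth_on (ball 0 e) (\<lambda>s::real. s^3 * (1/6))"
      by (intro smooth_on_mult) (auto simp: smooth_on_def intro: Ck_on_const)
    then show ?thesis by simp
  qed
  let ?F = "\<lambda>u. (u^3 / fact 3) *\<^sub>R (cos (\<theta> u), sin (\<theta> u))"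
  have "continuous_on (ball 0 e) ?F"
    by (intro continuous_intros smooth_on_continuous c) auto
  then have D: "(phi4 \<kappa> has_vector_derivative ?F s) (at s)" if "s \<in> ball 0 e" for s
    using interval_integral_has_vector_derivative[OF _ that] unfolding phi4_def[abs_def] \<theta>_def by blast
  have D1: "(\<phi>1 has_real_derivative s^3 / 6 * cos (\<theta> s)) (at s)" if "s \<in> ball 0 e" for s
    using bounded_linear.has_vector_derivative[OF bounded_linear_fst D[OF that]]
    by (simp add: \<phi>1_def has_real_derivative_iff_has_vector_derivative fact_numeral)
  have D2: "(\<phi>2 has_real_derivative s^3 / 6 * sin (\<theta> s)) (at s)" if "s \<in> ball 0 e" for s
    using bounded_linear.has_vector_derivative[OF bounded_linear_snd D[OF that]]
    by (simp add: \<phi>2_def has_real_derivative_iff_has_vector_derivative fact_numeral)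
  have s1: "smooth_on (ball 0 e) \<phi>1"
    by (rule smooth_on_antiderivative[OF open_ball D1 smooth_on_mult[OF open_ball p c(1)]])
  have s2: "smooth_on (ball 0 e) \<phi>2"
    by (rule smooth_on_antiderivative[OF open_ball D2 smooth_on_mult[OF open_ball p c(2)]])
  show "smooth_germ \<theta>" "smooth_germ \<phi>1" "smooth_germ \<phi>2"
    unfolding smooth_germ_def using s\<theta> s1 s2 e(1) by (meson centre_in_ball open_ball)+
  have "\<forall>\<^sub>F s in nhds 0. s \<in> ball 0 e" using e(1) by (intro eventually_nhds_in_open) auto
  then show "\<forall>\<^sub>F s in nhds 0. (\<phi>1 has_real_derivative s^3 / 6 * cos (\<theta> s)) (at s)"
    "\<forall>\<^sub>F s in nhds 0. (\<phi>2 has_real_derivative s^3 / 6 * sin (\<theta> s)) (at s)"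
    using D1 D2 by (auto elim!: eventually_mono)
  show "\<theta> 0 = 0" "\<phi>1 0 = 0" "\<phi>2 0 = 0"
    by (simp_all add: \<theta>_def theta_def \<phi>1_def \<phi>2_def phi4_def zero_ereal_def [symmetric])
qed

lemma theta_coeff_eq: "theta_coeff \<kappa> i = fact i * tc (theta \<kappa>) i"
  by (simp add: theta_coeff_def tc_def)

lemma tc_cube_antiderivative:
  assumes g: "smooth_germ g" and f0: "f 0 = 0"
    and D: "\<forall>\<^sub>F s in nhds 0. (f has_real_derivative s^3 / 6 * g s) (at s)"
  shows "tc f (i + 4) = tc g i / (6 * real (i + 4))" "i < 4 \<Longrightarrow> tc f i = 0"
proof -
  have "\<forall>\<^sub>F s in nhds 0. deriv f s = s^3 * (1/6 * g s)"
    using D by eventually_elim (simp add: DERIV_imp_deriv)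
  then have "tc (deriv f) k = tc (\<lambda>s. s^3 * (1/6 * g s)) k" for k by (rule tc_cong)
  then have *: "tc (deriv f) k = (if k < 3 then 0 else 1/6 * tc g (k - 3))" for k
    using tc_power_times[OF smooth_germ_cmult[OF g, of "1/6"], of 3 k] tc_cmult[OF g, of "1/6"] by simp
  have "tc f (Suc (i + 3)) = tc (deriv f) (i + 3) / real (Suc (i + 3))" by (rule tc_Suc_deriv)
  then show "tc f (i + 4) = tc g i / (6 * real (i + 4))"
    unfolding * by (simp add: eval_nat_numeral)
  show "tc f i = 0" if "i < 4"
  proof (cases i)
    case (Suc k)
    then show ?thesis using that * by (simp add: tc_Suc_deriv)
  qed (simp add: f0)
qed

lemma deriv_trig:
  "deriv sin = (cos :: real \<Rightarrow> real)" "deriv cos = (\<lambda>x::real. - sin x)"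
  "deriv (\<lambda>x::real. - sin x) = (\<lambda>x. - cos x)" "deriv (\<lambda>x::real. - cos x) = sin"
  by (auto intro!: ext DERIV_imp_deriv derivative_eq_intros)

lemma sin_expand: "vord 5 (\<lambda>z. sin z - (z - z^3 / 6))"
  using taylor_vord[OF smooth_germ_sin, of 5]
  by (simp add: eval_nat_numeral tc_Suc_deriv deriv_trig)

lemma cos_expand: "vord 4 (\<lambda>z. cos z - (1 - z^2 / 2))"
  using taylor_vord[OF smooth_germ_cos, of 4]
  by (simp add: eval_nat_numeral tc_Suc_deriv deriv_trig)

text \<open>The cubic term of the sine is first felt at order 3j; it is the source of the
  corrections \<open>a 1 ^ 3 / 6\<close> and \<open>a 3 ^ 3 / 6\<close> in the jets below.\<close>

lemma tc_sin_compose: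
  assumes "vord j f" "0 < j"
  shows "i < 3 * j \<Longrightarrow> tc (\<lambda>s. sin (f s)) i = tc f i"
    and "tc (\<lambda>s. sin (f s)) (3 * j) = tc f (3 * j) - tc f j ^ 3 / 6"
proof -
  have f: "smooth_germ f" "f 0 = 0" using assms vord_smooth vord_zero by auto
  have s: "smooth_germ (\<lambda>s. sin (f s))" by (rule smooth_germ_compose[OF smooth_germ_sin f])
  have l: "lead (3 * j) (- 1/6 * tc f j ^ 3) (\<lambda>s. - 1/6 * f s ^ 3)"
    by (intro lead_cmult lead_power lead_of_vord assms)
  have s3: "smooth_germ (\<lambda>s. - 1/6 * f s ^ 3)" by (intro smooth_intros f)
  have "vord (5 * j) (\<lambda>s. sin (f s) - (f s + - 1/6 * f s ^ 3))"
    using vord_compose_vord[OF sin_expand assms] by simp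
  from vord_tc[OF this]
  have *: "tc (\<lambda>s. sin (f s)) i = tc f i + tc (\<lambda>s. - 1/6 * f s ^ 3) i" if "i < 5 * j" for i
    using that unfolding tc_diff[OF s smooth_germ_add[OF f(1) s3]] tc_add[OF f(1) s3] by simp
  show "tc (\<lambda>s. sin (f s)) i = tc f i" if "i < 3 * j"
    using *[of i] vord_tc[OF lead_vord[OF l] that] that by simp
  show "tc (\<lambda>s. sin (f s)) (3 * j) = tc f (3 * j) - tc f j ^ 3 / 6"
    using *[of "3 * j"] lead_tc[OF l] assms(2) by simp
qed

lemma tc_cos_compose:
  assumes "vord j f" "0 < j"
  shows "0 < i \<Longrightarrow> i < 2 * j \<Longrightarrow> tc (\<lambda>s. cos (f s)) i = 0"
    and "tc (\<lambda>s. cos (f s)) (2 * j) = - (tc f j ^ 2) / 2"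
proof -
  have f: "smooth_germ f" "f 0 = 0" using assms vord_smooth vord_zero by auto
  have s: "smooth_germ (\<lambda>s. cos (f s))" by (rule smooth_germ_compose[OF smooth_germ_cos f])
  have l: "lead (2 * j) (- 1/2 * tc f j ^ 2) (\<lambda>s. - 1/2 * f s ^ 2)"
    by (intro lead_cmult lead_power lead_of_vord assms)
  have s3: "smooth_germ (\<lambda>s. - 1/2 * f s ^ 2)" by (intro smooth_intros f)
  have c1: "tc (\<lambda>s. 1) i = (if i = 0 then 1 else 0)" for i using tc_monomial[of 1 0 i] by simp
  have "vord (4 * j) (\<lambda>s. cos (f s) - (1 + - 1/2 * f s ^ 2))"
    using vord_compose_vord[OF cos_expand assms] by simp
  from vord_tc[OF this]
  have *: "tc (\<lambda>s. cos (f s)) i = tc (\<lambda>s. 1) i + tc (\<lambda>s. - 1/2 * f s ^ 2) i" if "i < 4 * j" for i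
    using that unfolding tc_diff[OF s smooth_germ_add[OF smooth_germ_const s3]]
      tc_add[OF smooth_germ_const s3] by simp
  show "tc (\<lambda>s. cos (f s)) i = 0" if "0 < i" "i < 2 * j"
    using *[of i] vord_tc[OF lead_vord[OF l] that(2)] that by (simp add: c1)
  show "tc (\<lambda>s. cos (f s)) (2 * j) = - (tc f j ^ 2) / 2"
    using *[of "2 * j"] lead_tc[OF l] assms(2) by (simp add: c1)
qed

lemma phi4_smooth_map:
  assumes "smooth_germ \<kappa>"
  shows "smooth_map_germ (phi4 \<kappa>)"
proof -
  have "smooth_germ (\<lambda>s. (fst (phi4 \<kappa> s), snd (phi4 \<kappa> s)))"
    by (intro smooth_germ_Pair phi4_germs assms)
  moreover have "phi4 \<kappa> 0 = 0"
    using phi4_germs(5,6)[OF assms] by (simp add: prod_eq_iff)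
  ultimately show ?thesis by (simp add: smooth_map_germ_def)
qed

text \<open>The first component starts with s^4/24, so the factor 24 brings it to t^4 (1 + W), and
  integrating s^3/6 cos \<theta> gives the factor 4/(i + 4). The constant \<open>C\<close> is left
  free; it is used as 6 (j + 4)/a_j, with j the order of \<theta>, to make the second component
  start with t^(j+4).\<close>

lemma phi4_normalize:
  assumes \<kappa>: "smooth_germ \<kappa>" and C: "C \<noteq> 0"
  obtains W z where "smooth_germ W" "W 0 = 0"
    "\<And>i. 0 < i \<Longrightarrow> tc W i = 4 * tc (\<lambda>s. cos (theta \<kappa> s)) i / real (i + 4)"
    "smooth_germ z" "A_equivalent (phi4 \<kappa>) (\<lambda>t. (t^4, z t))"
    "\<And>k q. smooth_germ q \<Longrightarrow> vord k (\<lambda>t. C * snd (phi4 \<kappa> t) - q (t * (1 + W t) powr (1/4))) \<Longrightarrow> vord k (\<lambda>t. z t - q t)"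
proof -
  note ph = phi4_germs[OF \<kappa>]
  let ?\<phi>1 = "\<lambda>s. fst (phi4 \<kappa> s)" and ?\<phi>2 = "\<lambda>s. snd (phi4 \<kappa> s)"
  have sc: "smooth_germ (\<lambda>s. cos (theta \<kappa> s))" by (rule smooth_germ_compose[OF smooth_germ_cos ph(1,2)])
  have tc1: "tc ?\<phi>1 (i + 4) = tc (\<lambda>s. cos (theta \<kappa> s)) i / (6 * real (i + 4))" "i < 4 \<Longrightarrow> tc ?\<phi>1 i = 0" for i
    using tc_cube_antiderivative[OF sc ph(5,7)] by auto
  have "vord 4 ?\<phi>1" using ph(3) tc1(2) by (simp add: vord_iff_tc)
  then obtain u where u: "smooth_germ u" "\<forall>\<^sub>F t in nhds 0. ?\<phi>1 t = t^4 * u t" by (rule vordE)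
  have tu: "tc u i = tc ?\<phi>1 (i + 4)" for i
    using tc_cong[OF u(2), of "i + 4"] tc_power_times[OF u(1), of 4 "i + 4"] by simp
  define W where "W = (\<lambda>t. 24 * u t - 1)"
  have sW: "smooth_germ W" unfolding W_def by (intro smooth_intros u(1))
  have u0: "u 0 = 1 / 24" using tu[of 0] tc1(1)[of 0] ph(2) by simp
  have W0: "W 0 = 0" by (simp add: W_def u0)
  have tW: "tc W i = 4 * tc (\<lambda>s. cos (theta \<kappa> s)) i / real (i + 4)" if "0 < i" for i
  proof -
    have "tc W i = 24 * tc u i - tc (\<lambda>t. 1) i"
      unfolding W_def using tc_diff[OF smooth_germ_cmult[OF u(1)] smooth_germ_const] tc_cmult[OF u(1)] by simp
    also have "tc (\<lambda>t. 1) i = 0" using tc_monomial[of 1 0 i] that by simp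
    finally show ?thesis by (simp only: tu tc1(1)) (simp add: divide_simps del: of_nat_add)
  qed
  have "diffeo_germ (\<lambda>p::real\<times>real. (24 * fst p, C * snd p))"
  proof (rule diffeo_germ_plane[where a=24 and b=0 and c=0 and d=C])
    show "smooth_germ (\<lambda>p::real\<times>real. (24 * fst p, C * snd p))" by (intro smooth_intros)
    show "((\<lambda>p::real\<times>real. (24 * fst p, C * snd p)) has_derivative (\<lambda>p. (24 * fst p + 0 * snd p, 0 * fst p + C * snd p))) (at 0)"
      by (auto intro!: derivative_eq_intros)
  qed (use C in \<open>auto simp: zero_prod_def\<close>)
  from A_equivalent_target[OF phi4_smooth_map[OF \<kappa>] this]
  have "A_equivalent (phi4 \<kappa>) (\<lambda>t. (24 * ?\<phi>1 t, C * ?\<phi>2 t))" by simp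
  then have 1: "A_equivalent (phi4 \<kappa>) (\<lambda>t. (t^4 * (1 + W t), C * ?\<phi>2 t))"
    by (rule A_equivalent_cong) (use u(2) in \<open>eventually_elim, simp add: W_def\<close>)
  have s1W: "smooth_germ (\<lambda>t. 1 + W t)" by (intro smooth_intros sW)
  have "smooth_germ (\<lambda>t. C * ?\<phi>2 t)" "C * ?\<phi>2 0 = 0" using smooth_germ_cmult[OF ph(4)] ph(6) by auto
  from curve_normalize[OF s1W _ this]
  obtain z where "smooth_germ z" "A_equivalent (\<lambda>t. (t^4 * (1 + W t), C * ?\<phi>2 t)) (\<lambda>t. (t^4, z t))"
    "\<forall>k q. smooth_germ q \<longrightarrow> vord k (\<lambda>t. C * ?\<phi>2 t - q (t * (1 + W t) powr (1/4))) \<longrightarrow> vord k (\<lambda>t. z t - q t)"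
    using W0 by auto
  then show ?thesis using that[OF sW W0 tW] A_equivalent_trans[OF 1] by blast
qed

lemma tc_phi4_snd:
  assumes "smooth_germ \<kappa>"
  shows "tc (\<lambda>s. snd (phi4 \<kappa> s)) (i + 4) = tc (\<lambda>s. sin (theta \<kappa> s)) i / (6 * real (i + 4))"
    and "i < 4 \<Longrightarrow> tc (\<lambda>s. snd (phi4 \<kappa> s)) i = 0"
  using tc_cube_antiderivative[OF smooth_germ_compose[OF smooth_germ_sin phi4_germs(1,2)] phi4_germs(6,8)] assms by auto

lemma root_power_expand:
  assumes "vord w W" "0 < w"
  shows "vord (j + w) (\<lambda>t. (t * (1 + W t) powr (1/4)) ^ j - t^j)"
    and "vord (j + 2 * w) (\<lambda>t. (t * (1 + W t) powr (1/4)) ^ j - t^j * (1 + real j / 4 * W t))"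
proof -
  have W: "smooth_germ W" "W 0 = 0" using assms vord_smooth vord_zero by auto
  have pos: "\<forall>\<^sub>F t in nhds 0. 1 + W t > 0"
    using smooth_germ_tendsto[OF smooth_germ_add[OF smooth_germ_const W(1)], of 1] by (rule order_tendstoD) (simp add: W(2))
  have e: "vord (2 * w) (\<lambda>t. (1 + W t) powr (real j / 4) - (1 + real j / 4 * W t))"
    by (rule powr_expand_1[OF assms])
  have "vord (j + 2 * w) (\<lambda>t. t^j * ((1 + W t) powr (real j / 4) - (1 + real j / 4 * W t)))"
    by (intro vord_mult vord_power_t e)
  then show 2: "vord (j + 2 * w) (\<lambda>t. (t * (1 + W t) powr (1/4)) ^ j - t^j * (1 + real j / 4 * W t))"
    by (rule vord_cong) (use pos in \<open>eventually_elim, simp only: power_root_reparam right_diff_distrib\<close>)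
  have "vord (j + w) (\<lambda>t. t^j * (real j / 4 * W t))" by (intro vord_mult vord_power_t vord_cmult assms)
  from vord_add[OF vord_mono[OF 2] this]
  show "vord (j + w) (\<lambda>t. (t * (1 + W t) powr (1/4)) ^ j - t^j)" by (simp add: algebra_simps)
qed

lemma phi4_normalize_lead:
  assumes \<theta>: "vord j (theta \<kappa>)" "0 < j"
    and W: "smooth_germ W" "W 0 = 0"
      "\<And>i. 0 < i \<Longrightarrow> tc W i = 4 * tc (\<lambda>s. cos (theta \<kappa> s)) i / real (i + 4)"
  shows "lead (2 * j) (- (tc (theta \<kappa>) j ^ 2 / (real j + 2))) W"
proof -
  have "tc W i = 0" if "i < 2 * j" for i
    using W(2,3) tc_cos_compose(1)[OF \<theta>] that by (cases "i = 0") auto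
  moreover have "tc W (2 * j) = - (tc (theta \<kappa>) j ^ 2 / (real j + 2))"
  proof -
    have "tc W (2 * j) = 4 * (- (tc (theta \<kappa>) j ^ 2) / 2) / real (2 * j + 4)"
      using \<theta>(2) by (subst W(3)) (simp_all add: tc_cos_compose(2)[OF \<theta>])
    also have "real (2 * j + 4) = 2 * (real j + 2)" by simp
    moreover have "4 * (- x / 2) / (2 * r) = - (x / r)" for x r :: real by simp
    ultimately show ?thesis by (simp only:)
  qed
  ultimately show ?thesis using W(1) by (simp add: lead_iff vord_iff_tc)
qed

lemma target_shear:
  assumes f: "A_equivalent f (\<lambda>t. (t^4, y t))" and y: "smooth_germ y" "y 0 = 0"
    and \<mu>: "smooth_germ \<mu>" "\<mu> 0 = 0" "(\<mu> has_derivative (\<lambda>p. 0)) (at 0)"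
  shows "A_equivalent f (\<lambda>t. (t^4, y t - \<mu> (t^4, y t)))" "smooth_germ (\<lambda>t. y t - \<mu> (t^4, y t))"
proof -
  have g: "smooth_germ (\<lambda>t. (t^4, y t))" by (intro smooth_intros y(1))
  show "smooth_germ (\<lambda>t. y t - \<mu> (t^4, y t))"
    by (intro smooth_intros y(1) smooth_germ_compose[OF \<mu>(1) g]) (simp add: y(2) zero_prod_def)
  have "diffeo_germ (\<lambda>p. (fst p, snd p - \<mu> p))"
  proof (rule diffeo_germ_plane[where a=1 and b=0 and c=0 and d=1])
    show "smooth_germ (\<lambda>p. (fst p, snd p - \<mu> p))" by (intro smooth_intros \<mu>(1))
    show "((\<lambda>p. (fst p, snd p - \<mu> p)) has_derivative (\<lambda>p. (1 * fst p + 0 * snd p, 0 * fst p + 1 * snd p))) (at 0)"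
      by (auto intro!: derivative_eq_intros \<mu>(3))
  qed (use \<mu>(2) in \<open>auto simp: zero_prod_def\<close>)
  moreover have "smooth_map_germ (\<lambda>t. (t^4, y t))" using g y(2) by (simp add: smooth_map_germ_def zero_prod_def)
  ultimately have "A_equivalent (\<lambda>t. (t^4, y t)) (\<lambda>t. (\<lambda>p. (fst p, snd p - \<mu> p)) (t^4, y t))"
    by (intro A_equivalent_target)
  then show "A_equivalent f (\<lambda>t. (t^4, y t - \<mu> (t^4, y t)))"
    using A_equivalent_trans[OF f] by simp
qed

section \<open>Jets of the curve for W12 and W18\<close>

lemma sum_lessThan_8: "(\<Sum>i<8. f i) = f 0 + f 1 + f 2 + f 3 + f 4 + f 5 + f 6 + f 7"
  for f :: "nat \<Rightarrow> real"
  by (simp add: eval_nat_numeral)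

lemma sum_lessThan_14: "(\<Sum>i<14. f i) = f 0 + f 1 + f 2 + f 3 + f 4 + f 5 + f 6 + f 7 + f 8 + f 9 + f 10 + f 11 + f 12 + f 13"
  for f :: "nat \<Rightarrow> real"
  by (simp add: eval_nat_numeral)

text \<open>The factor in front of \<open>w12\<close> is positive, so \<open>w12\<close> carries the
  sign of the coefficient of t^7. After clearing it, 5/2 is 7/2 - 1, with 7/2 from the
  reparametrization and -1 from the cubic term of the sine, and 77/48 comes from 11/10 b^2.\<close>

lemma phi4_W12:
  assumes \<kappa>: "smooth_germ \<kappa>" and nz: "theta_coeff \<kappa> 1 \<noteq> 0"
  shows "A_equivalent (phi4 \<kappa>) (\<lambda>t. (t^4, t^5 + 5 / (42 * theta_coeff \<kappa> 1 ^ 2) * w12 \<kappa> * t^7))"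
proof -
  define a where "a = tc (theta \<kappa>)"
  have a1: "a 1 \<noteq> 0" using nz by (simp add: a_def theta_coeff_eq)
  note ph = phi4_germs[OF \<kappa>]
  have v\<theta>: "vord (Suc 0) (theta \<kappa>)" using ph(1,2) by (simp add: vord_Suc_0_iff)
  have C: "30 / a 1 \<noteq> 0" using a1 by simp
  let ?P = "\<lambda>t. 30 / a 1 * snd (phi4 \<kappa> t)"
  have sP: "smooth_germ ?P" by (rule smooth_germ_cmult[OF ph(4)])
  obtain W z where W: "smooth_germ W" "W 0 = 0"
      "\<And>i. 0 < i \<Longrightarrow> tc W i = 4 * tc (\<lambda>s. cos (theta \<kappa> s)) i / real (i + 4)"
    and z: "smooth_germ z" "A_equivalent (phi4 \<kappa>) (\<lambda>t. (t^4, z t))"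
      "\<And>k q. smooth_germ q \<Longrightarrow> vord k (\<lambda>t. ?P t - q (t * (1 + W t) powr (1/4))) \<Longrightarrow> vord k (\<lambda>t. z t - q t)"
    by (rule phi4_normalize[OF \<kappa> C], rule that)
  have lW: "lead 2 (- (a 1 ^ 2 / 3)) W"
    using phi4_normalize_lead[OF v\<theta> _ W] by (simp add: a_def numeral_2_eq_2)
  then have vW: "vord 2 W" by (rule lead_vord)
  have tP: "tc ?P (i + 4) = 30 / a 1 * (tc (\<lambda>s. sin (theta \<kappa> s)) i / (6 * real (i + 4)))" for i
    unfolding tc_cmult[OF ph(4)] tc_phi4_snd(1)[OF \<kappa>] ..
  have tP0: "tc ?P i = 0" if "i < 4" for i
    unfolding tc_cmult[OF ph(4)] tc_phi4_snd(2)[OF \<kappa> that] by simp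
  have tPz: "tc ?P 0 = 0" "tc ?P 1 = 0" "tc ?P 2 = 0" "tc ?P 3 = 0" by (rule tP0, simp)+
  have ts: "tc (\<lambda>s. sin (theta \<kappa> s)) 0 = 0" "tc (\<lambda>s. sin (theta \<kappa> s)) 1 = a 1" "tc (\<lambda>s. sin (theta \<kappa> s)) 2 = a 2"
    "tc (\<lambda>s. sin (theta \<kappa> s)) 3 = a 3 - a 1 ^ 3 / 6"
    using tc_sin_compose(1)[OF v\<theta>] tc_sin_compose(2)[OF v\<theta>] ph(2) by (auto simp: a_def)
  define b where "b = 5 * a 2 / (6 * a 1)"
  define c0 where "c0 = 5 / (7 * a 1) * (a 3 - a 1 ^ 3 / 6)"
  \<comment> \<open>In the new parameter X one has X^5 = t^5 (1 + 5/4 W + ...) with W = - a_1^2/3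
    t^2 + ..., so passing from t to X raises the coefficient of order 7 by 5/4 times
    a_1^2/3.\<close>
  define c where "c = c0 + 5/12 * a 1 ^ 2"
  have tP': "tc ?P 4 = 0" "tc ?P 5 = 1" "tc ?P 6 = b" "tc ?P 7 = c0"
    using tP[of 0] tP[of 1] tP[of 2] tP[of 3] a1
    by (simp_all add: ts ts[unfolded One_nat_def] b_def c0_def ph(2)) (simp_all add: field_simps)
  have e0: "vord 8 (\<lambda>t. ?P t - (t^5 + b * t^6 + c0 * t^7))"
    using taylor_vord[OF sP, of 8] unfolding sum_lessThan_8 tP' tPz by (simp add: add.assoc)
  have e5: "vord 8 (\<lambda>t. (t * (1 + W t) powr (1/4)) ^ 5 - t^5 * (1 + real 5 / 4 * W t))"
    by (rule vord_mono[OF root_power_expand(2)[OF vW]]) auto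
  have e6: "vord 8 (\<lambda>t. b * ((t * (1 + W t) powr (1/4)) ^ 6 - t^6))"
    by (rule vord_cmult, rule vord_mono[OF root_power_expand(1)[OF vW]]) auto
  have e7: "vord 8 (\<lambda>t. c * ((t * (1 + W t) powr (1/4)) ^ 7 - t^7))"
    by (rule vord_cmult, rule vord_mono[OF root_power_expand(1)[OF vW]]) auto
  have "vord (5 + Suc 2) (\<lambda>t. t^5 * (W t - (- (a 1 ^ 2 / 3)) * t^2))"
    by (intro vord_mult vord_power_t lW[unfolded lead_def])
  then have eW: "vord 8 (\<lambda>t. 5/4 * (t^5 * (W t - (- (a 1 ^ 2 / 3)) * t^2)))" by (intro vord_cmult) simp
  let ?q = "\<lambda>t. t^5 + b * t^6 + c * t^7"
  have "vord 8 (\<lambda>t. ?P t - ?q (t * (1 + W t) powr (1/4)))"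
  proof (rule vord_cong[OF vord_diff[OF vord_diff[OF vord_diff[OF vord_diff[OF e0 e5] e6] e7] eW]], intro always_eventually allI)
    fix t
    define X where "X = (t * (1 + W t) powr (1/4))"
    define P where "P = ?P t"
    show "?P t - (t^5 + b * t^6 + c0 * t^7) - ((t * (1 + W t) powr (1/4)) ^ 5 - t^5 * (1 + real 5 / 4 * W t))
      - b * ((t * (1 + W t) powr (1/4)) ^ 6 - t^6) - c * ((t * (1 + W t) powr (1/4)) ^ 7 - t^7)
      - 5/4 * (t^5 * (W t - (- (a 1 ^ 2 / 3)) * t^2)) = ?P t - ?q (t * (1 + W t) powr (1/4))"
      unfolding X_def [symmetric] P_def [symmetric] c_def
      by (simp add: algebra_simps power_add [symmetric]) (simp add: field_simps)
  qed
  then have "vord 8 (\<lambda>t. z t - ?q t)" by (intro z(3) smooth_intros)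
  from W12_normal_form[OF z(2,1) this]
  have "A_equivalent (phi4 \<kappa>) (\<lambda>t. (t^4, t^5 + (c - 11/10 * b^2) * t^7))" .
  moreover have "c - 11/10 * b^2 = 5 / (42 * theta_coeff \<kappa> 1 ^ 2) * w12 \<kappa>"
    using a1 unfolding w12_def theta_coeff_eq a_def [symmetric] c_def c0_def b_def
    by (simp add: fact_numeral field_simps power2_eq_square power3_eq_cube eval_nat_numeral)
  ultimately show ?thesis by simp
qed

text \<open>Here \<theta> has order 3, so both nonlinear effects are felt only at order 13: W starts
  at order 6 and meets t^7 at 7 + 6, and the cubic term of the sine starts at order 9, raised to 9 +
  4 by the integration. The summand 7/20 a_3^2 is 7/4 times the leading coefficient a_3^2/5 of
  -W.\<close>

lemma phi4_W18_jet:
  assumes \<kappa>: "smooth_germ \<kappa>"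
    and 0: "theta_coeff \<kappa> 1 = 0" "theta_coeff \<kappa> 2 = 0" and nz: "theta_coeff \<kappa> 3 \<noteq> 0"
  defines "a \<equiv> tc (theta \<kappa>)"
  defines "B8 \<equiv> 7 * a 4 / (8 * a 3)" and "B9 \<equiv> 7 * a 5 / (9 * a 3)" and "B10 \<equiv> 7 * a 6 / (10 * a 3)"
    and "B11 \<equiv> 7 * a 7 / (11 * a 3)" and "B12 \<equiv> 7 * a 8 / (12 * a 3)"
    and "B13 \<equiv> 7 * (a 9 - a 3 ^ 3 / 6) / (13 * a 3) + 7/20 * a 3 ^ 2"
  obtains z where "smooth_germ z" "A_equivalent (phi4 \<kappa>) (\<lambda>t. (t^4, z t))"
    "vord 14 (\<lambda>t. z t - (t^7 + B8 * t^8 + B9 * t^9 + B10 * t^10 + B11 * t^11 + B12 * t^12 + B13 * t^13))"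
proof -
  have a: "a 1 = 0" "a 2 = 0" "a 3 \<noteq> 0" using 0 nz by (simp_all add: a_def theta_coeff_eq)
  note ph = phi4_germs[OF \<kappa>]
  have v\<theta>: "vord 3 (theta \<kappa>)" unfolding vord_iff_tc
  proof (intro conjI allI impI ph(1))
    fix i :: nat assume "i < 3"
    then have "i = 0 \<or> i = 1 \<or> i = 2" by linarith
    then show "tc (theta \<kappa>) i = 0" using a ph(2) by (auto simp: a_def)
  qed
  have C: "42 / a 3 \<noteq> 0" using a(3) by simp
  let ?P = "\<lambda>t. 42 / a 3 * snd (phi4 \<kappa> t)"
  have sP: "smooth_germ ?P" by (rule smooth_germ_cmult[OF ph(4)])
  obtain W z where W: "smooth_germ W" "W 0 = 0"
      "\<And>i. 0 < i \<Longrightarrow> tc W i = 4 * tc (\<lambda>s. cos (theta \<kappa> s)) i / real (i + 4)"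
    and z: "smooth_germ z" "A_equivalent (phi4 \<kappa>) (\<lambda>t. (t^4, z t))"
      "\<And>k q. smooth_germ q \<Longrightarrow> vord k (\<lambda>t. ?P t - q (t * (1 + W t) powr (1/4))) \<Longrightarrow> vord k (\<lambda>t. z t - q t)"
    by (rule phi4_normalize[OF \<kappa> C], rule that)
  have lW: "lead 6 (- (a 3 ^ 2 / 5)) W"
    using phi4_normalize_lead[OF v\<theta> _ W] by (simp add: a_def)
  then have vW: "vord 6 W" by (rule lead_vord)
  have tP: "tc ?P (i + 4) = 42 / a 3 * (tc (\<lambda>s. sin (theta \<kappa> s)) i / (6 * real (i + 4)))" for i
    unfolding tc_cmult[OF ph(4)] tc_phi4_snd(1)[OF \<kappa>] ..
  have tP0: "tc ?P i = 0" if "i < 4" for i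
    unfolding tc_cmult[OF ph(4)] tc_phi4_snd(2)[OF \<kappa> that] by simp
  have tPz: "tc ?P 0 = 0" "tc ?P 1 = 0" "tc ?P 2 = 0" "tc ?P 3 = 0" by (rule tP0, simp)+
  have ts: "i < 9 \<Longrightarrow> tc (\<lambda>s. sin (theta \<kappa> s)) i = a i"
    "tc (\<lambda>s. sin (theta \<kappa> s)) 9 = a 9 - a 3 ^ 3 / 6" for i
    using tc_sin_compose(1)[OF v\<theta>] tc_sin_compose(2)[OF v\<theta>] by (auto simp: a_def)
  have a0: "a 0 = 0" using ph(2) by (simp add: a_def)
  define c13 where "c13 = 7 * (a 9 - a 3 ^ 3 / 6) / (13 * a 3)"
  have tP': "tc ?P 4 = 0" "tc ?P 5 = 0" "tc ?P 6 = 0" "tc ?P 7 = 1" "tc ?P 8 = B8" "tc ?P 9 = B9" "tc ?P 10 = B10"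
    "tc ?P 11 = B11" "tc ?P 12 = B12" "tc ?P 13 = c13"
    using tP[of 0] tP[of 1] tP[of 2] tP[of 3] tP[of 4] tP[of 5] tP[of 6] tP[of 7] tP[of 8] tP[of 9]
      a a0 a(1)[unfolded One_nat_def]
    by (simp_all add: ts B8_def B9_def B10_def B11_def B12_def c13_def ph(2)) (simp_all add: field_simps)
  let ?X = "\<lambda>t. t * (1 + W t) powr (1/4)"
  have e0: "vord 14 (\<lambda>t. ?P t - (t^7 + B8 * t^8 + B9 * t^9 + B10 * t^10 + B11 * t^11 + B12 * t^12 + c13 * t^13))"
    using taylor_vord[OF sP, of 14] unfolding sum_lessThan_14 tP' tPz by (simp add: add.assoc)
  have e7: "vord 14 (\<lambda>t. ?X t ^ 7 - t^7 * (1 + real 7 / 4 * W t))"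
    by (rule vord_mono[OF root_power_expand(2)[OF vW]]) auto
  have ej: "vord 14 (\<lambda>t. B * (?X t ^ j - t^j))" if "8 \<le> j" for B j
    by (rule vord_cmult, rule vord_mono[OF root_power_expand(1)[OF vW]]) (use that in auto)
  have "vord (7 + Suc 6) (\<lambda>t. t^7 * (W t - (- (a 3 ^ 2 / 5)) * t^6))"
    by (intro vord_mult vord_power_t lW[unfolded lead_def])
  then have eW: "vord 14 (\<lambda>t. 7/4 * (t^7 * (W t - (- (a 3 ^ 2 / 5)) * t^6)))" by (intro vord_cmult) simp
  let ?q = "\<lambda>t. t^7 + B8 * t^8 + B9 * t^9 + B10 * t^10 + B11 * t^11 + B12 * t^12 + B13 * t^13"
  have "vord 14 (\<lambda>t. (?P t - (t^7 + B8 * t^8 + B9 * t^9 + B10 * t^10 + B11 * t^11 + B12 * t^12 + c13 * t^13))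
      - (?X t ^ 7 - t^7 * (1 + real 7 / 4 * W t))
      - (B8 * (?X t ^ 8 - t^8) + B9 * (?X t ^ 9 - t^9) + B10 * (?X t ^ 10 - t^10) + B11 * (?X t ^ 11 - t^11)
         + B12 * (?X t ^ 12 - t^12) + B13 * (?X t ^ 13 - t^13))
      - 7/4 * (t^7 * (W t - (- (a 3 ^ 2 / 5)) * t^6)))"
    by (intro vord_diff vord_add e0 e7 ej eW) auto
  then have "vord 14 (\<lambda>t. ?P t - ?q (?X t))"
  proof (rule vord_cong, intro always_eventually allI)
    fix t
    define X where "X = ?X t"
    define P where "P = ?P t"
    have "B13 = c13 + 7/20 * a 3 ^ 2" by (simp add: B13_def c13_def)
    then show "(?P t - (t^7 + B8 * t^8 + B9 * t^9 + B10 * t^10 + B11 * t^11 + B12 * t^12 + c13 * t^13))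
      - (?X t ^ 7 - t^7 * (1 + real 7 / 4 * W t))
      - (B8 * (?X t ^ 8 - t^8) + B9 * (?X t ^ 9 - t^9) + B10 * (?X t ^ 10 - t^10) + B11 * (?X t ^ 11 - t^11)
         + B12 * (?X t ^ 12 - t^12) + B13 * (?X t ^ 13 - t^13))
      - 7/4 * (t^7 * (W t - (- (a 3 ^ 2 / 5)) * t^6)) = ?P t - ?q (?X t)"
      unfolding X_def [symmetric] P_def [symmetric]
      by (simp add: algebra_simps power_add [symmetric]) (simp add: field_simps)
  qed
  then have "vord 14 (\<lambda>t. z t - ?q t)" by (intro z(3) smooth_intros)
  then show ?thesis using that z(1,2) by blast
qed

lemma phi4_W18_9:
  assumes \<kappa>: "smooth_germ \<kappa>"
    and 0: "theta_coeff \<kappa> 1 = 0" "theta_coeff \<kappa> 2 = 0" and nz: "theta_coeff \<kappa> 3 \<noteq> 0"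
    and nz5: "theta_coeff \<kappa> 5 \<noteq> 0"
  shows "A_equivalent (phi4 \<kappa>) (\<lambda>t. (t^4, t^7 + 7/180 * (theta_coeff \<kappa> 5 / theta_coeff \<kappa> 3) * t^9))"
proof -
  obtain B8 B9 B10 B11 B12 B13 z where z: "smooth_germ z" "A_equivalent (phi4 \<kappa>) (\<lambda>t. (t^4, z t))"
    "vord 14 (\<lambda>t. z t - (t^7 + B8 * t^8 + B9 * t^9 + B10 * t^10 + B11 * t^11 + B12 * t^12 + B13 * t^13))"
    and B9: "B9 = 7 * tc (theta \<kappa>) 5 / (9 * tc (theta \<kappa>) 3)"
    by (rule phi4_W18_jet[OF \<kappa> 0 nz]) blast
  have B9': "B9 = 7/180 * (theta_coeff \<kappa> 5 / theta_coeff \<kappa> 3)"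
    by (simp add: B9 theta_coeff_eq fact_numeral)
  have z0: "z 0 = 0" using vord_zero[OF z(3)] by simp
  let ?\<mu> = "\<lambda>p::real\<times>real. B8 * fst p ^ 2"
  have m: "smooth_germ ?\<mu>" by (intro smooth_intros)
  have md: "(?\<mu> has_derivative (\<lambda>p. 0)) (at 0)" by (auto intro!: derivative_eq_intros)
  note s = target_shear[OF z(2,1) z0 m _ md]
  have "vord 10 (\<lambda>t. (z t - (t^7 + B8 * t^8 + B9 * t^9 + B10 * t^10 + B11 * t^11 + B12 * t^12 + B13 * t^13))
      + (B10 * t^10 + B11 * t^11 + B12 * t^12 + B13 * t^13))"
    by (intro vord_add vord_cmult vord_mono[OF z(3)] vord_mono[OF vord_power_t]) auto
  then have "vord 10 (\<lambda>t. (z t - ?\<mu> (t^4, z t)) - (t^7 + B9 * t^9))"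
    by (simp add: algebra_simps power_mult [symmetric])
  then have "reduces (phi4 \<kappa>) 7 B9 9 10" unfolding reduces_def using s by auto
  moreover have "B9 \<noteq> 0" unfolding B9' using nz nz5 by simp
  ultimately have "A_equivalent (phi4 \<kappa>) (\<lambda>t. (t^4, t^7 + B9 * t^9))" by (rule W18_normal_form_9)
  then show ?thesis by (simp only: B9')
qed

text \<open>With \<theta>_5 = 0 there is no t^9 and the gap term of order 10 is removed at the cost
  17/14 B10^2, which gives 4641/1000. The constant 812 is 1092 - 280: the reparametrization against
  the cubic term of the sine.\<close>

lemma phi4_W18_13:
  assumes \<kappa>: "smooth_germ \<kappa>"
    and 0: "theta_coeff \<kappa> 1 = 0" "theta_coeff \<kappa> 2 = 0" and nz: "theta_coeff \<kappa> 3 \<noteq> 0"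
    and 5: "theta_coeff \<kappa> 5 = 0"
  shows "A_equivalent (phi4 \<kappa>) (\<lambda>t. (t^4, t^7 + 1 / (112320 * theta_coeff \<kappa> 3 ^ 2) * w18 \<kappa> * t^13))"
proof -
  define a where "a = tc (theta \<kappa>)"
  obtain B8 B9 B10 B11 B12 B13 z where z: "smooth_germ z" "A_equivalent (phi4 \<kappa>) (\<lambda>t. (t^4, z t))"
    "vord 14 (\<lambda>t. z t - (t^7 + B8 * t^8 + B9 * t^9 + B10 * t^10 + B11 * t^11 + B12 * t^12 + B13 * t^13))"
    and B: "B9 = 7 * a 5 / (9 * a 3)" "B10 = 7 * a 6 / (10 * a 3)"
      "B13 = 7 * (a 9 - a 3 ^ 3 / 6) / (13 * a 3) + 7/20 * a 3 ^ 2"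
    unfolding a_def by (rule phi4_W18_jet[OF \<kappa> 0 nz]) blast
  have B9: "B9 = 0" using 5 by (simp add: B a_def theta_coeff_eq)
  have a3: "a 3 \<noteq> 0" using nz by (simp add: a_def theta_coeff_eq)
  have z0: "z 0 = 0" using vord_zero[OF z(3)] by simp
  \<comment> \<open>The three terms remove the orders 8, 11 and 12. The second uses y - B8 x^2
    because x y alone also contains B8 t^12, which would disturb order 12.\<close>
  let ?\<mu> = "\<lambda>p::real\<times>real. B8 * fst p ^ 2 + B11 * (fst p * (snd p - B8 * fst p ^ 2)) + B12 * fst p ^ 3"
  have m: "smooth_germ ?\<mu>" by (intro smooth_intros)
  have md: "(?\<mu> has_derivative (\<lambda>p. 0)) (at 0)" by (auto intro!: derivative_eq_intros)
  note s = target_shear[OF z(2,1) z0 m _ md]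
  let ?r = "\<lambda>t. z t - (t^7 + B8 * t^8 + B9 * t^9 + B10 * t^10 + B11 * t^11 + B12 * t^12 + B13 * t^13)"
  have "vord 10 (\<lambda>t. ?r t + (B10 * t^10 + B11 * t^11 + B12 * t^12 + B13 * t^13))"
    by (intro vord_add vord_cmult vord_mono[OF z(3)] vord_mono[OF vord_power_t]) auto
  from vord_mult[OF vord_power_t[of 4] this]
  have "vord 14 (\<lambda>t. t^4 * (?r t + (B10 * t^10 + B11 * t^11 + B12 * t^12 + B13 * t^13)))" by simp
  from vord_diff[OF z(3) vord_cmult[OF this, of B11]]
  have "vord 14 (\<lambda>t. (z t - ?\<mu> (t^4, z t)) - (t^7 + B10 * t^10 + B13 * t^13))"
    by (rule vord_cong) (simp add: B9 algebra_simps power_mult [symmetric] power_add [symmetric])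
  from W18_normal_form_13[OF s this]
  have "A_equivalent (phi4 \<kappa>) (\<lambda>t. (t^4, t^7 + (B13 - 17/14 * B10^2) * t^13))" by simp
  moreover have "B13 - 17/14 * B10^2 = 1 / (112320 * theta_coeff \<kappa> 3 ^ 2) * w18 \<kappa>"
    using a3 unfolding w18_def theta_coeff_eq a_def [symmetric] B
    by (simp add: fact_numeral field_simps power2_eq_square power3_eq_cube eval_nat_numeral)
  ultimately show ?thesis by simp
qed

section \<open>Even and odd parts\<close>

lemma smooth_germ_reflect: "smooth_germ f \<Longrightarrow> smooth_germ (\<lambda>s. f (- s))" for f :: "real \<Rightarrow> real"
  by (rule smooth_germ_compose[of f uminus]) (auto intro!: smooth_intros)

lemma tc_reflect:
  assumes "smooth_germ f"
  shows "tc (\<lambda>s. f (- s)) i = (-1)^i * tc f i"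
  using assms
proof (induction i arbitrary: f)
  case (Suc i)
  have m: "smooth_germ (\<lambda>s::real. - s)" by (intro smooth_intros)
  have "\<forall>\<^sub>F s in nhds 0. (f has_real_derivative deriv f (- s)) (at (- s))"
    by (rule smooth_germ_eventually[OF m _ smooth_germ_DERIV[OF Suc.prems]]) simp
  then have "\<forall>\<^sub>F s in nhds 0. deriv (\<lambda>s. f (- s)) s = -1 * deriv f (- s)"
  proof eventually_elim
    case (elim s)
    have "((\<lambda>s. f (- s)) has_real_derivative deriv f (- s) * (-1)) (at s)"
      by (rule DERIV_chain2[where f=f and g=uminus, OF elim]) (auto intro!: derivative_eq_intros)
    then show ?case by (simp add: DERIV_imp_deriv)
  qed
  then have "tc (deriv (\<lambda>s. f (- s))) i = tc (\<lambda>s. -1 * deriv f (- s)) i" by (rule tc_cong)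
  also have "\<dots> = -1 * ((-1)^i * tc (deriv f) i)"
    unfolding tc_cmult[OF smooth_germ_reflect[OF smooth_germ_deriv[OF Suc.prems]]]
      Suc.IH[OF smooth_germ_deriv[OF Suc.prems]] ..
  finally show ?case by (simp add: tc_Suc_deriv)
qed simp

lemma tc_reflect_diff:
  assumes "smooth_germ f"
  shows "tc (\<lambda>s. f (- s) - f s) i = (if even i then 0 else - 2 * tc f i)"
  using tc_diff[OF smooth_germ_reflect[OF assms] assms] tc_reflect[OF assms] by simp

lemma vord_reflect_diff:
  assumes "smooth_germ f"
  shows "vord k (\<lambda>s. f (- s) - f s) \<longleftrightarrow> (\<forall>i<k. odd i \<longrightarrow> tc f i = 0)"
  using smooth_germ_diff[OF smooth_germ_reflect[OF assms] assms] tc_reflect_diff[OF assms]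
  by (auto simp: vord_iff_tc)

lemma vord_sin: "vord k f \<Longrightarrow> 0 < k \<Longrightarrow> vord k (\<lambda>s. sin (f s))"
  using vord_compose_vord[of 1 sin k f] by (simp add: vord_Suc_0_iff smooth_germ_sin)

lemma vord_sin_diff: "vord k f \<Longrightarrow> 0 < k \<Longrightarrow> vord (3 * k) (\<lambda>s. sin (f s) - f s)"
proof -
  have "vord 3 (\<lambda>z. (sin z - (z - z^3 / 6)) - 1/6 * z^3)"
    by (intro vord_diff vord_mono[OF sin_expand] vord_cmult vord_power_t) simp
  then have "vord 3 (\<lambda>z. sin z - z)" by simp
  then show "vord k f \<Longrightarrow> 0 < k \<Longrightarrow> vord (3 * k) (\<lambda>s. sin (f s) - f s)"
    by (rule vord_compose_vord)
qed

lemma vord_cos_diff: "vord k f \<Longrightarrow> 0 < k \<Longrightarrow> vord (2 * k) (\<lambda>s. cos (f s) - 1)"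
proof -
  have "vord 2 (\<lambda>z. (cos z - (1 - z^2 / 2)) - 1/2 * z^2)"
    by (intro vord_diff vord_mono[OF cos_expand] vord_cmult vord_power_t) simp
  then have "vord 2 (\<lambda>z. cos z - 1)" by simp
  then show "vord k f \<Longrightarrow> 0 < k \<Longrightarrow> vord (2 * k) (\<lambda>s. cos (f s) - 1)"
    by (rule vord_compose_vord)
qed

text \<open>With D = \<theta>(-s) - \<theta>(s) and the addition formulas, the cosines differ by sin
  D sin \<theta> up to terms quadratic in D, so two orders are gained from sin \<theta>; the sines
  differ by D itself up to the same order p + 2.\<close>

lemma trig_reflect:
  assumes \<theta>: "vord 2 \<theta>" and p: "2 \<le> p" and D: "vord p (\<lambda>s. \<theta> (- s) - \<theta> s)"
  shows "vord (p + 2) (\<lambda>s. cos (\<theta> (- s)) - cos (\<theta> s))"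
    and "vord (p + 2) (\<lambda>s. (sin (\<theta> (- s)) - sin (\<theta> s)) - (\<theta> (- s) - \<theta> s))"
proof -
  let ?D = "\<lambda>s. \<theta> (- s) - \<theta> s"
  have p0: "0 < p" using p by simp
  have s: "vord 2 (\<lambda>s. sin (\<theta> s))" by (rule vord_sin[OF \<theta>]) simp
  have c: "vord 4 (\<lambda>s. cos (\<theta> s) - 1)" using vord_cos_diff[OF \<theta>] by simp
  have sc: "smooth_germ (\<lambda>s. cos (\<theta> s))" "smooth_germ (\<lambda>s. sin (\<theta> s))"
    using smooth_germ_add[OF vord_smooth[OF c] smooth_germ_const, of 1] vord_smooth[OF s] by auto
  have cD: "vord (p + 2) (\<lambda>s. cos (?D s) - 1)" by (rule vord_mono[OF vord_cos_diff[OF D p0]]) (use p in simp)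
  have sD: "vord p (\<lambda>s. sin (?D s))" by (rule vord_sin[OF D p0])
  have sD': "vord (p + 2) (\<lambda>s. sin (?D s) - ?D s)" by (rule vord_mono[OF vord_sin_diff[OF D p0]]) (use p in simp)
  have "vord (p + 2) (\<lambda>s. (cos (?D s) - 1) * cos (\<theta> s) - sin (?D s) * sin (\<theta> s))"
    by (intro vord_diff vord_mult_smooth[OF cD] sc vord_mult[OF sD s])
  moreover have "(cos (?D s) - 1) * cos (\<theta> s) - sin (?D s) * sin (\<theta> s) = cos (\<theta> (- s)) - cos (\<theta> s)" for s
  proof -
    have "cos (\<theta> (- s)) = cos (?D s + \<theta> s)" by simp
    then show ?thesis unfolding cos_add by (simp add: algebra_simps)
  qed
  ultimately show "vord (p + 2) (\<lambda>s. cos (\<theta> (- s)) - cos (\<theta> s))" by simp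
  have x: "vord (p + 2) (\<lambda>s. sin (?D s) * (cos (\<theta> s) - 1))" by (rule vord_mono[OF vord_mult[OF sD c]]) simp
  have "vord (p + 2) (\<lambda>s. (cos (?D s) - 1) * sin (\<theta> s) + sin (?D s) * (cos (\<theta> s) - 1) + (sin (?D s) - ?D s))"
    by (rule vord_add[OF vord_add[OF vord_mult_smooth[OF cD sc(2)] x] sD'])
  moreover have "(cos (?D s) - 1) * sin (\<theta> s) + sin (?D s) * (cos (\<theta> s) - 1) + (sin (?D s) - ?D s)
      = (sin (\<theta> (- s)) - sin (\<theta> s)) - ?D s" for s
  proof -
    have "sin (\<theta> (- s)) = sin (?D s + \<theta> s)" by simp
    then show ?thesis unfolding sin_add by (simp add: algebra_simps)
  qed
  ultimately show "vord (p + 2) (\<lambda>s. (sin (\<theta> (- s)) - sin (\<theta> s)) - ?D s)" by simp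
qed

text \<open>The first odd coefficient of \<theta> thus passes unchanged into sin \<theta>, while cos
  \<theta> stays even two orders longer. This is why the asymmetry of the curve appears in the
  second component first.\<close>

lemma theta_odd_coefficients:
  assumes \<theta>: "vord 2 \<theta>" and p: "2 \<le> p" and z: "\<And>i. odd i \<Longrightarrow> i < p \<Longrightarrow> tc \<theta> i = 0"
    and i: "odd i" "i < p + 2"
  shows "tc (\<lambda>s. cos (\<theta> s)) i = 0" "tc (\<lambda>s. sin (\<theta> s)) i = tc \<theta> i"
proof -
  have \<theta>s: "smooth_germ \<theta>" "\<theta> 0 = 0" using vord_smooth[OF \<theta>] vord_zero[OF \<theta>] by auto
  have "vord p (\<lambda>s. \<theta> (- s) - \<theta> s)" using vord_reflect_diff[OF \<theta>s(1), of p] z by blast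
  note tr = trig_reflect[OF \<theta> p this]
  have sc: "smooth_germ (\<lambda>s. cos (\<theta> s))" and ss: "smooth_germ (\<lambda>s. sin (\<theta> s))"
    by (rule smooth_germ_compose[OF smooth_germ_cos \<theta>s], rule smooth_germ_compose[OF smooth_germ_sin \<theta>s])
  show "tc (\<lambda>s. cos (\<theta> s)) i = 0"
    using tr(1) vord_reflect_diff[OF sc, of "p + 2"] i by simp
  have "tc (\<lambda>s. (sin (\<theta> (- s)) - sin (\<theta> s)) - (\<theta> (- s) - \<theta> s)) i = 0"
    by (rule vord_tc[OF tr(2) i(2)])
  then show "tc (\<lambda>s. sin (\<theta> s)) i = tc \<theta> i"
    unfolding tc_diff[OF smooth_germ_diff[OF smooth_germ_reflect[OF ss] ss] smooth_germ_diff[OF smooth_germ_reflect[OF \<theta>s(1)] \<theta>s(1)]]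
      tc_reflect_diff[OF ss] tc_reflect_diff[OF \<theta>s(1)]
    using i(1) by simp
qed

lemma vord_compose_diff:
  fixes f :: "real \<Rightarrow> real"
  assumes f: "smooth_germ f" and a: "smooth_germ a" "a 0 = 0" and b: "smooth_germ b" "b 0 = 0"
    and d: "vord k (\<lambda>t. a t - b t)"
  shows "vord k (\<lambda>t. f (a t) - f (b t))"
proof -
  \<comment> \<open>\<open>f\<close> is viewed as a function on the plane so that
    \<open>strict_derivative_plane\<close> supplies the Lipschitz bound.\<close>
  let ?R = "\<lambda>p::real\<times>real. f (fst p)"
  have sR: "smooth_germ ?R" by (rule smooth_germ_compose[OF f]) (intro smooth_intros, simp)
  obtain u v where D: "(?R has_derivative (\<lambda>p. u * fst p + v * snd p)) (at 0)"
    using smooth_germ_plane_derivative[OF sR] .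
  obtain C e where e: "e > 0" "C > 0"
    "\<And>p p' d. norm p \<le> d \<Longrightarrow> norm p' \<le> d \<Longrightarrow> d < e \<Longrightarrow>
      \<bar>?R p - ?R p' - (u * fst (p - p') + v * snd (p - p'))\<bar> \<le> C * d * norm (p - p')"
    by (rule strict_derivative_plane[OF sR D], rule that)
  obtain K where K: "K > 0" "\<forall>\<^sub>F t in nhds 0. \<bar>a t - b t\<bar> \<le> K * \<bar>t\<bar>^k" using vord_bound[OF d] .
  have "\<forall>\<^sub>F t in nhds 0. \<bar>a t\<bar> < e / 2"
    by (rule order_tendstoD(2)[OF tendsto_rabs[OF smooth_germ_tendsto[OF a(1)]]]) (use e(1) a(2) in simp)
  moreover have "\<forall>\<^sub>F t in nhds 0. \<bar>b t\<bar> < e / 2"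
    by (rule order_tendstoD(2)[OF tendsto_rabs[OF smooth_germ_tendsto[OF b(1)]]]) (use e(1) b(2) in simp)
  moreover note K(2)
  ultimately have "\<forall>\<^sub>F t in nhds 0. \<bar>f (a t) - f (b t)\<bar> \<le> (\<bar>u\<bar> + C * (e/2)) * K * \<bar>t\<bar>^k"
  proof eventually_elim
    case (elim t)
    have "\<bar>f (a t) - f (b t) - u * (a t - b t)\<bar> \<le> C * (e/2) * \<bar>a t - b t\<bar>"
      using e(3)[of "(a t, 0)" "e/2" "(b t, 0)"] elim e(1) by (simp add: norm_Pair)
    then have "\<bar>f (a t) - f (b t)\<bar> \<le> C * (e/2) * \<bar>a t - b t\<bar> + \<bar>u * (a t - b t)\<bar>" by linarith
    also have "\<dots> = (\<bar>u\<bar> + C * (e/2)) * \<bar>a t - b t\<bar>" by (simp only: abs_mult distrib_right add.commute)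
    also have "\<dots> \<le> (\<bar>u\<bar> + C * (e/2)) * (K * \<bar>t\<bar>^k)" using e elim by (intro mult_left_mono) auto
    finally show ?case by (simp add: mult.assoc)
  qed
  moreover have "smooth_germ (\<lambda>t. f (a t) - f (b t))"
    by (rule smooth_germ_diff[OF smooth_germ_compose[OF f a] smooth_germ_compose[OF f b]])
  ultimately show ?thesis by (intro vord_of_bound)
qed

lemma root_power_reflect:
  assumes W: "smooth_germ W" "W 0 = 0" "vord l (\<lambda>s. W (- s) - W s)" and j: "even j"
  defines "X \<equiv> \<lambda>s. s * (1 + W s) powr (1/4)"
  shows "vord (j + l) (\<lambda>s. X (- s) ^ j - X s ^ j)"
proof -
  let ?f = "\<lambda>z::real. (1 + z) powr (real j / 4)"
  have "vord l (\<lambda>s. ?f (W (- s)) - ?f (W s))"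
    by (rule vord_compose_diff[OF smooth_germ_powr smooth_germ_reflect[OF W(1)] _ W(1) _ W(3)]) (auto simp: W(2))
  then have v: "vord (j + l) (\<lambda>s. s^j * (?f (W (- s)) - ?f (W s)))" by (intro vord_mult vord_power_t)
  have pos: "\<forall>\<^sub>F t in nhds 0. 1 + W t > 0"
    using smooth_germ_tendsto[OF smooth_germ_add[OF smooth_germ_const W(1)], of 1] by (rule order_tendstoD) (simp add: W(2))
  have m: "smooth_germ (\<lambda>s::real. - s)" by (intro smooth_intros)
  have pos': "\<forall>\<^sub>F t in nhds 0. 1 + W (- t) > 0"
    by (rule smooth_germ_eventually[OF m _ pos]) simp
  show ?thesis
  proof (rule vord_cong[OF v])
    show "\<forall>\<^sub>F s in nhds 0. s^j * (?f (W (- s)) - ?f (W s)) = X (- s) ^ j - X s ^ j"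
      using pos pos'
    proof eventually_elim
      case (elim s)
      then show ?case unfolding X_def power_root_reparam[OF elim(1)] power_root_reparam[OF elim(2)]
        using j by (simp add: algebra_simps)
    qed
  qed
qed

text \<open>Every even exponent from 6 on is 6 + 4l or 8 + 4l, so the even terms of \<open>P\<close>
  can be collected as x^2 A(x) + y B(x) with x = X^4, y = X^6. Subtracting one even power of X at a
  time leaves the odd coefficients up to \<open>m\<close> unchanged, because even powers of X are
  even functions to that order.\<close>

lemma even_part_elimination:
  assumes W: "vord 2 W" "vord l (\<lambda>s. W (- s) - W s)" and l: "m < l + 6"
    and P: "lead 6 1 P" "\<And>i. odd i \<Longrightarrow> i < m \<Longrightarrow> tc P i = 0"
  defines "X \<equiv> \<lambda>s. s * (1 + W s) powr (1/4)"
  assumes K: "3 \<le> K" "2 * K + 1 \<le> m"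
  shows "\<exists>A B. smooth_germ A \<and> smooth_germ B \<and> B 0 = 1 \<and>
    vord (2 * K + 1) (\<lambda>s. P s - (X s ^ 8 * A (X s ^ 4) + X s ^ 6 * B (X s ^ 4))) \<and>
    (\<forall>i\<le>m. odd i \<longrightarrow> tc (\<lambda>s. P s - (X s ^ 8 * A (X s ^ 4) + X s ^ 6 * B (X s ^ 4))) i = tc P i)"
proof -
  have sW: "smooth_germ W" "W 0 = 0" using vord_smooth[OF W(1)] vord_zero[OF W(1)] by auto
  have X: "vord (j + 2) (\<lambda>s. X s ^ j - s ^ j)" for j
    unfolding X_def using root_power_expand(1)[OF W(1)] by simp
  have sX: "smooth_germ (\<lambda>s. X s ^ j)" for j
    using smooth_germ_add[OF vord_smooth[OF X[of j]] smooth_germ_power[OF smooth_germ_ident, of j]] by simp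
  have tX: "tc (\<lambda>s. X s ^ j) i = 0" if "even j" "6 \<le> j" "odd i" "i \<le> m" for i j
  proof -
    have "vord (j + l) (\<lambda>s. X (- s) ^ j - X s ^ j)"
      unfolding X_def using root_power_reflect[OF sW W(2) that(1)] .
    then show ?thesis using that l vord_reflect_diff[OF sX, of "j + l" j] by auto
  qed
  have sP: "smooth_germ P" by (rule lead_smooth[OF P(1)])
  define R where "R = (\<lambda>A B s. P s - (X s ^ 8 * A (X s ^ 4) + X s ^ 6 * B (X s ^ 4)))"
  have "\<exists>A B. smooth_germ A \<and> smooth_germ B \<and> B 0 = 1 \<and> vord (2 * K + 1) (R A B) \<and>
    (\<forall>i\<le>m. odd i \<longrightarrow> tc (R A B) i = tc P i)"
    using K
  proof (induction K rule: nat_induct_at_least)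
    case base
    have R: "R (\<lambda>x. 0) (\<lambda>x. 1) = (\<lambda>s. P s - X s ^ 6)" by (simp add: R_def)
    have p7: "vord 7 (\<lambda>s. P s - 1 * s^6)" using P(1) by (simp add: lead_def)
    have "vord 7 (\<lambda>s. (P s - 1 * s^6) - (X s ^ 6 - s ^ 6))"
      by (rule vord_diff[OF p7 vord_mono[OF X[of 6]]]) simp
    then have "vord 7 (R (\<lambda>x. 0) (\<lambda>x. 1))" by (simp add: R)
    moreover have "tc (R (\<lambda>x. 0) (\<lambda>x. 1)) i = tc P i" if "odd i" "i \<le> m" for i
      unfolding R using tc_diff[OF sP sX] tX[of 6 i] that by simp
    ultimately show ?case
      by (intro exI[of _ "\<lambda>x. 0"] exI[of _ "\<lambda>x. 1"]) (auto intro: smooth_intros)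
  next
    case (Suc K)
    then obtain A B where AB: "smooth_germ A" "smooth_germ B" "B 0 = 1" "vord (2 * K + 1) (R A B)"
      "\<And>i. i \<le> m \<Longrightarrow> odd i \<Longrightarrow> tc (R A B) i = tc P i" by auto
    have sR: "smooth_germ (R A B)" by (rule vord_smooth[OF AB(4)])
    define j where "j = 2 * K + 2"
    have j: "even j" "6 \<le> j" using Suc.hyps by (auto simp: j_def)
    \<comment> \<open>The odd coefficient is that of \<open>P\<close>, which vanishes below m; so
      each even power subtracted raises the order by two.\<close>
    have "tc (R A B) (2 * K + 1) = 0" using AB(5) P(2) Suc.prems by simp
    then have vj: "vord j (R A B)" using vord_step[OF AB(4)] by (simp add: j_def)
    define c where "c = tc (R A B) j"
    have "vord (Suc j) (\<lambda>s. (R A B s - c * s ^ j) - c * (X s ^ j - s ^ j))"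
      unfolding c_def by (intro vord_diff vord_step[OF vj] vord_cmult vord_mono[OF X]) simp
    then have v': "vord (Suc j) (\<lambda>s. R A B s - c * X s ^ j)" by (simp add: algebra_simps)
    have t': "tc (\<lambda>s. R A B s - c * X s ^ j) i = tc P i" if "odd i" "i \<le> m" for i
      using tc_diff[OF sR smooth_germ_cmult[OF sX]] tc_cmult[OF sX] tX[OF j that] AB(5) that by simp
    have "\<exists>A' B'. smooth_germ A' \<and> smooth_germ B' \<and> B' 0 = 1 \<and> R A' B' = (\<lambda>s. R A B s - c * X s ^ j)"
    proof (cases "even (K + 1)")
      case True
      then obtain i where i: "K + 1 = 2 * i" by blast
      then have "2 \<le> i" using Suc.hyps by simp
      then obtain l where "i = 2 + l" using le_Suc_ex by blast
      then have ji: "j = 8 + 4 * l" using i by (simp add: j_def)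
      have "R (\<lambda>x. A x + c * x ^ l) B = (\<lambda>s. R A B s - c * X s ^ j)"
        unfolding R_def ji power_add power_mult by (auto simp: algebra_simps)
      moreover have "smooth_germ (\<lambda>x. A x + c * x ^ l)" by (intro smooth_intros AB(1))
      ultimately show ?thesis using AB by blast
    next
      case False
      then obtain i where i: "K + 1 = 2 * i + 1" by (meson oddE)
      then have "2 \<le> i" using Suc.hyps by simp
      then obtain l where l: "i = 2 + l" using le_Suc_ex by blast
      then have ji: "j = 6 + 4 * (l + 1)" using i by (simp add: j_def)
      have "R A (\<lambda>x. B x + c * x ^ (l + 1)) = (\<lambda>s. R A B s - c * X s ^ j)"
        unfolding R_def ji power_add power_mult by (auto simp: algebra_simps)
      moreover have "smooth_germ (\<lambda>x. B x + c * x ^ (l + 1))" by (intro smooth_intros AB(2))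
      moreover have "B 0 + c * 0 ^ (l + 1) = 1" using AB(3) by simp
      ultimately show ?thesis using AB by blast
    qed
    then show ?case using v' t' by (metis (no_types, lifting) Suc_1 add.commute add_2_eq_Suc j_def mult_Suc_right plus_1_eq_Suc)
  qed
  then show ?thesis unfolding R_def .
qed

lemma phi4_W1_sharp:
  assumes \<kappa>: "smooth_germ \<kappa>" and q: "1 \<le> q"
    and t1: "theta_coeff \<kappa> 1 = 0" and t2: "theta_coeff \<kappa> 2 \<noteq> 0"
    and odd_zero: "\<And>j. 1 \<le> j \<Longrightarrow> j < q \<Longrightarrow> theta_coeff \<kappa> (2 * j + 1) = 0"
    and nz: "theta_coeff \<kappa> (2 * q + 1) \<noteq> 0"
  shows "A_equivalent (phi4 \<kappa>) (\<lambda>t. (t^4, t^6 + t^(2 * q + 5)))"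
proof -
  define a where "a = tc (theta \<kappa>)"
  define p where "p = 2 * q + 1"
  define m where "m = p + 4"
  have p: "3 \<le> p" "odd p" and m: "odd m" "7 \<le> m" using q by (auto simp: p_def m_def)
  have a1: "a 1 = 0" and a2: "a 2 \<noteq> 0" and ap: "a p \<noteq> 0"
    using t1 t2 nz by (simp_all add: a_def p_def theta_coeff_eq)
  have ao: "a i = 0" if i: "odd i" "i < p" for i
  proof -
    obtain j where j: "i = 2 * j + 1" using i(1) by (rule oddE)
    show ?thesis
    proof (cases "j = 0")
      case False
      then have "theta_coeff \<kappa> (2 * j + 1) = 0" using i(2) j by (intro odd_zero) (auto simp: p_def)
      then show ?thesis by (simp add: a_def theta_coeff_eq j)
    qed (use a1 j in simp)
  qed
  note ph = phi4_germs[OF \<kappa>]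
  have v\<theta>: "vord 2 (theta \<kappa>)"
    using ph(1,2) a1 by (auto simp: vord_iff_tc a_def less_2_cases_iff)
  have p2: "2 \<le> p" using p by simp
  note odd_coeffs = theta_odd_coefficients[OF v\<theta> p2 ao[unfolded a_def]]
  have tcos: "tc (\<lambda>s. cos (theta \<kappa> s)) i = 0" if "odd i" "i < p + 2" for i
    by (rule odd_coeffs(1)) (use that in auto)
  have tsin: "tc (\<lambda>s. sin (theta \<kappa> s)) i = a i" if "odd i" "i < p + 2" for i
    unfolding a_def by (rule odd_coeffs(2)) (use that in auto)
  have C: "36 / a 2 \<noteq> 0" using a2 by simp
  let ?P = "\<lambda>t. 36 / a 2 * snd (phi4 \<kappa> t)"
  have sP: "smooth_germ ?P" by (rule smooth_germ_cmult[OF ph(4)])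
  obtain W z where W: "smooth_germ W" "W 0 = 0"
      "\<And>i. 0 < i \<Longrightarrow> tc W i = 4 * tc (\<lambda>s. cos (theta \<kappa> s)) i / real (i + 4)"
    and z: "smooth_germ z" "A_equivalent (phi4 \<kappa>) (\<lambda>t. (t^4, z t))"
      "\<And>k q. smooth_germ q \<Longrightarrow> vord k (\<lambda>t. ?P t - q (t * (1 + W t) powr (1/4))) \<Longrightarrow> vord k (\<lambda>t. z t - q t)"
    by (rule phi4_normalize[OF \<kappa> C], rule that)
  have vW: "vord 2 W"
    using vord_mono[OF lead_vord[OF phi4_normalize_lead[OF v\<theta> _ W]], of 2] by simp
  have tW: "tc W i = 0" if "odd i" "i < p + 2" for i
    using W(3)[of i] tcos[OF that] that by (cases "i = 0") auto
  have WD: "vord (p + 2) (\<lambda>s. W (- s) - W s)" using vord_reflect_diff[OF W(1)] tW by simp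
  have tP: "tc ?P (i + 4) = 36 / a 2 * (tc (\<lambda>s. sin (theta \<kappa> s)) i / (6 * real (i + 4)))" for i
    unfolding tc_cmult[OF ph(4)] tc_phi4_snd(1)[OF \<kappa>] ..
  have tP0: "tc ?P i = 0" if "i < 4" for i
    unfolding tc_cmult[OF ph(4)] tc_phi4_snd(2)[OF \<kappa> that] by simp
  have tP_odd: "tc ?P i = 0" if "odd i" "i < m" for i
  proof (cases "i < 4")
    case False
    then obtain k where k: "i = k + 4" by (metis add.commute le_add_diff_inverse not_less)
    then show ?thesis using that tP[of k] tsin[of k] ao[of k] by (simp add: m_def)
  qed (rule tP0)
  define c where "c = tc ?P m"
  have "c = 36 / a 2 * (a p / (6 * real m))" using tP[of p] tsin[of p] p by (simp add: c_def m_def)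
  then have c0: "c \<noteq> 0" using ap a2 m by simp
  have lP: "lead 6 1 ?P"
  proof -
    have ts: "tc (\<lambda>s. sin (theta \<kappa> s)) i = a i" if "i < 6" for i
      using tc_sin_compose(1)[OF v\<theta>, of i] that by (simp add: a_def)
    have "tc ?P i = 0" if "i < 6" for i
    proof (cases "i < 4")
      case False
      then have "i = 0 + 4 \<or> i = 1 + 4" using that by linarith
      then show ?thesis using tP[of 0] tP[of 1] ts[of 0] ts[of 1] a1 ph(2) by (auto simp: a_def)
    qed (rule tP0)
    moreover have "tc ?P 6 = 1" using tP[of 2] ts[of 2] a2 by simp
    ultimately show ?thesis using sP by (simp add: lead_iff vord_iff_tc)
  qed
  let ?X = "\<lambda>s. s * (1 + W s) powr (1/4)"
  have qm: "2 * (q + 2) + 1 = m" by (simp add: m_def p_def)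
  have E: "m < (p + 2) + 6" "3 \<le> q + 2" "2 * (q + 2) + 1 \<le> m" using q qm by (auto simp: m_def)
  obtain A B where AB: "smooth_germ A" "smooth_germ B" "B 0 = 1"
    "vord m (\<lambda>s. ?P s - (?X s ^ 8 * A (?X s ^ 4) + ?X s ^ 6 * B (?X s ^ 4)))"
    "\<forall>i\<le>m. odd i \<longrightarrow> tc (\<lambda>s. ?P s - (?X s ^ 8 * A (?X s ^ 4) + ?X s ^ 6 * B (?X s ^ 4))) i = tc ?P i"
    using even_part_elimination[OF vW WD E(1) lP _ E(2,3), unfolded qm] tP_odd by blast
  have tcm: "tc (\<lambda>s. ?P s - (?X s ^ 8 * A (?X s ^ 4) + ?X s ^ 6 * B (?X s ^ 4))) m = c"
    using AB(5) m unfolding c_def by blast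
  let ?Q = "\<lambda>t. t ^ 8 * A (t ^ 4) + t ^ 6 * B (t ^ 4) + c * t ^ m"
  have s4: "smooth_germ (\<lambda>t::real. t^4)" by (intro smooth_intros)
  have sA: "smooth_germ (\<lambda>t. A (t ^ 4))" and sB: "smooth_germ (\<lambda>t. B (t ^ 4))"
    by (rule smooth_germ_compose[OF AB(1) s4], simp, rule smooth_germ_compose[OF AB(2) s4], simp)
  have sQ: "smooth_germ ?Q" by (intro smooth_intros sA sB)
  have "vord (Suc m) (\<lambda>s. (?P s - (?X s ^ 8 * A (?X s ^ 4) + ?X s ^ 6 * B (?X s ^ 4)) - c * s ^ m) - c * (?X s ^ m - s ^ m))"
    by (rule vord_diff[OF vord_step[OF AB(4), unfolded tcm] vord_cmult[OF vord_mono[OF root_power_expand(1)[OF vW]]]]) simp_all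
  then have "vord (Suc m) (\<lambda>t. ?P t - ?Q (?X t))"
    by (simp only: right_diff_distrib diff_diff_eq add.assoc diff_add_cancel add_diff_cancel_left')
      (simp add: algebra_simps)
  then have vz: "vord (Suc m) (\<lambda>t. z t - ?Q t)" by (rule z(3)[OF sQ])
  have z0: "z 0 = 0" using vord_zero[OF vz] m by (simp add: zero_power)
  \<comment> \<open>The inverse of y \<mapsto> x^2 A(x) + y B(x) for fixed x. It sends the collected
    even part back to t^6, and since B(0) = 1 it leaves the coefficient of t^m equal to
    \<open>c\<close>.\<close>
  let ?Y = "\<lambda>p::real\<times>real. (snd p - fst p ^ 2 * A (fst p)) * (1 / B (fst p))"
  have sf: "smooth_germ (\<lambda>p::real\<times>real. fst p)" by (intro smooth_intros)
  have sAf: "smooth_germ (\<lambda>p::real\<times>real. A (fst p))" and sBf: "smooth_germ (\<lambda>p::real\<times>real. B (fst p))"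
    by (rule smooth_germ_compose[OF AB(1) sf], simp, rule smooth_germ_compose[OF AB(2) sf], simp)
  have siB: "smooth_germ (\<lambda>p::real\<times>real. 1 / B (fst p))"
    by (rule smooth_germ_divide[OF smooth_germ_const sBf]) (simp add: AB(3))
  have "reduces (phi4 \<kappa>) 6 c m (Suc m)"
  proof (rule reduces_coordinate_change[where X=fst and Y="?Y" and v="\<lambda>t. 1" and b=0 and d=1, OF z(2)])
    show "smooth_germ (fst :: real \<times> real \<Rightarrow> real)" "smooth_germ (\<lambda>t::real. 1 :: real)" by (intro smooth_intros)+
    show "smooth_germ ?Y" by (intro smooth_intros sAf siB)
    show "(fst has_derivative (\<lambda>p. fst p + 0 * snd p)) (at (0 :: real \<times> real))"
      by (rule has_derivative_fst_plane)
    show "(?Y has_derivative (\<lambda>p. 1 * snd p)) (at 0)"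
    proof -
      have d1: "((\<lambda>p::real\<times>real. fst p * (fst p * A (fst p))) has_derivative (\<lambda>p. 0)) (at 0)"
        by (rule has_derivative_product_zero) (intro smooth_intros sAf, intro smooth_intros sAf, auto)
      have d2: "((\<lambda>p::real\<times>real. snd p * (1 / B (fst p) - 1)) has_derivative (\<lambda>p. 0)) (at 0)"
        by (rule has_derivative_product_zero) (intro smooth_intros, intro smooth_intros siB, auto simp: AB(3))
      have d3: "((\<lambda>p::real\<times>real. (fst p * (fst p * A (fst p))) * (1 / B (fst p) - 1)) has_derivative (\<lambda>p. 0)) (at 0)"
        by (rule has_derivative_product_zero) (intro smooth_intros sAf, intro smooth_intros siB, auto simp: AB(3))
      have "((\<lambda>p::real\<times>real. snd p + snd p * (1 / B (fst p) - 1) - (fst p * (fst p * A (fst p)))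
          - (fst p * (fst p * A (fst p))) * (1 / B (fst p) - 1)) has_derivative (\<lambda>p. 1 * snd p + 0 - 0 - 0)) (at 0)"
        by (intro has_derivative_diff has_derivative_add d1 d2 d3 has_derivative_snd_plane)
      moreover have "(\<lambda>p::real\<times>real. snd p + snd p * (1 / B (fst p) - 1) - (fst p * (fst p * A (fst p)))
          - (fst p * (fst p * A (fst p))) * (1 / B (fst p) - 1)) = ?Y"
        by (auto simp: algebra_simps power2_eq_square)
      ultimately show ?thesis by simp
    qed
    show "vord (Suc m) (\<lambda>t. ?Y (t^4, z t) - (t^6 * 1 powr (real 6 / 4) + c * (t^m * 1 powr (real m / 4))))"
    proof -
      have siB4: "smooth_germ (\<lambda>t. 1 / B (t ^ 4))"
        by (rule smooth_germ_divide[OF smooth_germ_const sB]) (simp add: AB(3))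
      have "vord 1 (\<lambda>t. 1 / B (t^4) - 1)"
        unfolding One_nat_def vord_Suc_0_iff by (intro conjI smooth_intros siB4) (simp add: AB(3))
      from vord_mult[OF vord_power_t[of m] this]
      have "vord (Suc m) (\<lambda>t. t^m * (1 / B (t^4) - 1))" by simp
      from vord_add[OF vord_cmult[OF this, of c] vord_mult_smooth[OF vz siB4]]
      show ?thesis
      proof (rule vord_cong)
        have "\<forall>\<^sub>F t in nhds 0. B (t^4) \<noteq> 0"
          using smooth_germ_tendsto[OF sB] by (rule tendsto_imp_eventually_ne) (simp add: AB(3))
        then show "\<forall>\<^sub>F t in nhds 0. c * (t^m * (1 / B (t^4) - 1)) + (z t - ?Q t) * (1 / B (t^4))
          = ?Y (t^4, z t) - (t^6 * 1 powr (real 6 / 4) + c * (t^m * 1 powr (real m / 4)))"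
          by eventually_elim (simp add: field_simps power_mult [symmetric])
      qed
    qed
  qed (use z(1) z0 AB(3) in auto)
  then have "A_equivalent (phi4 \<kappa>) (\<lambda>t. (t^4, t^6 + t^m))"
    using m c0 by (intro W1_sharp_normal_form[where c=c]) auto
  then show ?thesis by (simp add: m_def p_def add.commute)
qed

section \<open>Necessary conditions\<close>

lemma lead_compose:
  assumes f: "lead n b f" and h: "lead 1 l h"
  shows "lead n (b * l^n) (\<lambda>t. f (h t))"
proof -
  obtain u where u: "smooth_germ u" "u 0 = b" "\<forall>\<^sub>F t in nhds 0. f t = t^n * u t" using f by (rule leadE)
  obtain w where w: "smooth_germ w" "w 0 = l" "\<forall>\<^sub>F t in nhds 0. h t = t^1 * w t" using h by (rule leadE)
  have sh: "smooth_germ h" "h 0 = 0" using lead_smooth[OF h] vord_zero[OF lead_vord[OF h]] by auto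
  have "smooth_germ (\<lambda>t. u (h t) * w t ^ n)" by (intro smooth_intros w(1) smooth_germ_compose[OF u(1) sh])
  moreover have "\<forall>\<^sub>F t in nhds 0. f (h t) = t^n * (u (h t) * w t ^ n)"
    using smooth_germ_eventually[OF sh u(3)] w(3)
    by eventually_elim (simp add: power_mult_distrib)
  ultimately show ?thesis by (intro leadI[where u="\<lambda>t. u (h t) * w t ^ n"]) (auto simp: sh(2) u(2) w(2))
qed

lemma diffeo_germ_lead:
  fixes h :: "real \<Rightarrow> real"
  assumes "diffeo_germ h"
  obtains l where "l \<noteq> 0" "lead 1 l h"
proof -
  have h: "smooth_germ h" "h 0 = 0" using diffeo_germ_smooth[OF assms] by (auto simp: smooth_map_germ_def)
  have D: "(h has_derivative (*) (deriv h 0)) (at 0)"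
    using eventually_nhds_x_imp_x[OF smooth_germ_DERIV[OF h(1)]] by (simp add: has_field_derivative_def)
  have "deriv h 0 \<noteq> 0" using diffeo_germ_derivative_inj[OF assms D, of 1] by auto
  moreover have "lead 1 (deriv h 0) h"
    unfolding lead_iff using h by (simp add: vord_Suc_0_iff tc_Suc_deriv)
  ultimately show ?thesis by (rule that)
qed

lemma diffeo_germ_plane_snd_derivative:
  fixes \<psi> :: "real \<times> real \<Rightarrow> real \<times> real"
  assumes \<psi>: "diffeo_germ \<psi>" and D: "((\<lambda>p. snd (\<psi> p)) has_derivative (\<lambda>p. a * fst p + b * snd p)) (at 0)"
    and a: "a = 0"
  shows "b \<noteq> 0"
proof
  assume b: "b = 0"
  have s\<psi>: "smooth_germ \<psi>" using diffeo_germ_smooth[OF \<psi>] by (simp add: smooth_map_germ_def)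
  obtain u v where F: "((\<lambda>p. fst (\<psi> p)) has_derivative (\<lambda>p. u * fst p + v * snd p)) (at 0)"
    using smooth_germ_plane_derivative[OF smooth_germ_fst[OF s\<psi>]] .
  let ?A = "\<lambda>p. (u * fst p + v * snd p, a * fst p + b * snd p)"
  have A: "(\<psi> has_derivative ?A) (at 0)" using has_derivative_Pair[OF F D] by simp
  show False
  proof (cases "u = 0 \<and> v = 0")
    case True
    then have "?A (1, 0) = 0" using a b by (simp add: zero_prod_def)
    then show False using diffeo_germ_derivative_inj[OF \<psi> A, of "(1, 0)"] by (simp add: zero_prod_def)
  next
    case False
    have "?A (v, - u) = 0" using a b by (simp add: zero_prod_def)
    then show False using diffeo_germ_derivative_inj[OF \<psi> A, of "(v, - u)"] False by (auto simp: zero_prod_def)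
  qed
qed

text \<open>The two points have equal first coordinate, so the linear part of \<open>R\<close>
  contributes only b (g1 - g2), and the error carries the radius O(t) as an extra factor. No higher
  derivative of \<open>R\<close> enters.\<close>

lemma strict_curve_difference:
  fixes R :: "real \<times> real \<Rightarrow> real"
  assumes R: "smooth_germ R" "(R has_derivative (\<lambda>p. a * fst p + b * snd p)) (at 0)"
    and f: "vord 1 f" and g: "vord 1 g1" "vord 1 g2" and d: "vord k (\<lambda>t. g1 t - g2 t)"
  shows "vord (k + 1) (\<lambda>t. R (f t, g1 t) - R (f t, g2 t) - b * (g1 t - g2 t))"
proof -
  have s: "smooth_germ f" "smooth_germ g1" "smooth_germ g2" using f g vord_smooth by auto
  have z: "f 0 = 0" "g1 0 = 0" "g2 0 = 0" using vord_zero[OF f] vord_zero[OF g(1)] vord_zero[OF g(2)] by auto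
  obtain C e where e: "e > 0" "C > 0"
    "\<And>p p' d. norm p \<le> d \<Longrightarrow> norm p' \<le> d \<Longrightarrow> d < e \<Longrightarrow>
      \<bar>R p - R p' - (a * fst (p - p') + b * snd (p - p'))\<bar> \<le> C * d * norm (p - p')"
    by (rule strict_derivative_plane[OF R], rule that)
  obtain K0 where K0: "K0 > 0" "\<forall>\<^sub>F t in nhds 0. \<bar>f t\<bar> \<le> K0 * \<bar>t\<bar>^1" using vord_bound[OF f] .
  obtain K1 where K1: "K1 > 0" "\<forall>\<^sub>F t in nhds 0. \<bar>g1 t\<bar> \<le> K1 * \<bar>t\<bar>^1" using vord_bound[OF g(1)] .
  obtain K2 where K2: "K2 > 0" "\<forall>\<^sub>F t in nhds 0. \<bar>g2 t\<bar> \<le> K2 * \<bar>t\<bar>^1" using vord_bound[OF g(2)] .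
  obtain K where K: "K > 0" "\<forall>\<^sub>F t in nhds 0. \<bar>g1 t - g2 t\<bar> \<le> K * \<bar>t\<bar>^k" using vord_bound[OF d] .
  define M where "M = K0 + K1 + K2"
  have "((\<lambda>t::real. M * \<bar>t\<bar>) \<longlongrightarrow> M * \<bar>0\<bar>) (nhds 0)"
    by (intro tendsto_intros filterlim_ident)
  then have "\<forall>\<^sub>F t in nhds 0. M * \<bar>t\<bar> < e" by (rule order_tendstoD) (use e(1) in simp)
  with K0(2) K1(2) K2(2) K(2)
  have "\<forall>\<^sub>F t in nhds 0. \<bar>R (f t, g1 t) - R (f t, g2 t) - b * (g1 t - g2 t)\<bar> \<le> C * M * K * \<bar>t\<bar>^(k + 1)"
  proof eventually_elim
    case (elim t)
    have "norm (f t, g1 t) \<le> K0 * \<bar>t\<bar> + K1 * \<bar>t\<bar>" "norm (f t, g2 t) \<le> K0 * \<bar>t\<bar> + K2 * \<bar>t\<bar>"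
      using norm_Pair_le[of "f t" "g1 t"] norm_Pair_le[of "f t" "g2 t"] elim by auto
    moreover have "K1 * \<bar>t\<bar> \<ge> 0" "K2 * \<bar>t\<bar> \<ge> 0" using K1 K2 by auto
    ultimately have n: "norm (f t, g1 t) \<le> M * \<bar>t\<bar>" "norm (f t, g2 t) \<le> M * \<bar>t\<bar>"
      by (auto simp: M_def distrib_right)
    have "\<bar>R (f t, g1 t) - R (f t, g2 t) - b * (g1 t - g2 t)\<bar> \<le> C * (M * \<bar>t\<bar>) * \<bar>g1 t - g2 t\<bar>"
      using e(3)[OF n elim(5)] by (simp add: norm_Pair)
    also have "\<dots> \<le> C * (M * \<bar>t\<bar>) * (K * \<bar>t\<bar>^k)"
      using elim(4) e(2) K0(1) K1(1) K2(1) by (intro mult_left_mono) (auto simp: M_def)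
    finally show ?case by (simp add: mult_ac)
  qed
  moreover have "smooth_germ (\<lambda>t. R (f t, g1 t) - R (f t, g2 t) - b * (g1 t - g2 t))"
    by (intro smooth_germ_diff smooth_germ_cmult s smooth_germ_compose[OF R(1) smooth_germ_Pair[OF s(1,2)]]
        smooth_germ_compose[OF R(1) smooth_germ_Pair[OF s(1,3)]]) (auto simp: z zero_prod_def)
  ultimately show ?thesis by (intro vord_of_bound)
qed

text \<open>Below order 8 the second component of the target map is its linear part a t^4 + b (t^n +
  ...). The order bound 5 forces a = 0, invertibility then forces b \<noteq> 0, and the order
  \<open>n\<close> becomes visible.\<close>

lemma A_equivalent_normal_formE:
  assumes eq: "A_equivalent f (\<lambda>t. (t^4, t^n + c * t^m))" and n: "4 < n" "n < 8" "n < m"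
    and f: "vord 5 (\<lambda>t. snd (f t))"
  obtains h \<psi> a b where "diffeo_germ h" "diffeo_germ \<psi>"
    "\<forall>\<^sub>F t in nhds 0. f (h t) = \<psi> (t^4, t^n + c * t^m)"
    "((\<lambda>p. snd (\<psi> p)) has_derivative (\<lambda>p. a * fst p + b * snd p)) (at 0)" "b \<noteq> 0"
    "lead n b (\<lambda>t. snd (f (h t)))"
proof -
  obtain h \<psi> where h: "diffeo_germ h" "diffeo_germ \<psi>" "\<forall>\<^sub>F t in nhds 0. f (h t) = \<psi> (t^4, t^n + c * t^m)"
    using eq by (auto simp: A_equivalent_def)
  have sh: "smooth_germ h" "h 0 = 0" using diffeo_germ_smooth[OF h(1)] by (auto simp: smooth_map_germ_def)
  have s\<psi>: "smooth_germ \<psi>" "\<psi> 0 = 0" using diffeo_germ_smooth[OF h(2)] by (auto simp: smooth_map_germ_def)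
  have sR: "smooth_germ (\<lambda>p. snd (\<psi> p))" by (intro smooth_intros s\<psi>)
  obtain a b where D: "((\<lambda>p. snd (\<psi> p)) has_derivative (\<lambda>p. a * fst p + b * snd p)) (at 0)"
    using smooth_germ_plane_derivative[OF sR] .
  let ?q = "\<lambda>t::real. t^n + c * t^m"
  have lq: "lead n 1 ?q" by (rule normal_form_lead[OF n(3)])
  have "vord 8 (\<lambda>t. snd (\<psi> (t^4, ?q t)) - (a * t^4 + b * ?q t))"
    by (rule curve_linear_part[OF sR _ D vord_power_t vord_mono[OF lead_vord[OF lq]]]) (use n s\<psi>(2) in auto)
  then have L: "vord 8 (\<lambda>t. snd (f (h t)) - (a * t^4 + b * ?q t))"
    by (rule vord_cong) (use h(3) in \<open>eventually_elim, simp\<close>)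
  have "vord 5 (\<lambda>t. snd (f (h t)) - (snd (f (h t)) - (a * t^4 + b * ?q t)) - b * ?q t)"
    by (intro vord_diff vord_compose[OF f sh] vord_mono[OF L] vord_cmult vord_mono[OF lead_vord[OF lq]]) (use n in auto)
  then have "vord 5 (\<lambda>t. a * t^4)" by simp
  from vord_tc[OF this, of 4] have a: "a = 0" by (simp add: tc_monomial)
  have b: "b \<noteq> 0" by (rule diffeo_germ_plane_snd_derivative[OF h(2) D a])
  have "lead n (b * 1) (\<lambda>t. b * ?q t + (snd (f (h t)) - (a * t^4 + b * ?q t)))"
    by (intro lead_add_higher lead_cmult lq vord_mono[OF L]) (use n in simp)
  then have "lead n b (\<lambda>t. snd (f (h t)))" by (simp add: a)
  then show ?thesis by (rule that[OF h D b])
qed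

lemma A_equivalent_normal_form_order:
  assumes eq: "A_equivalent f (\<lambda>t. (t^4, t^n + c * t^m))" and n: "4 < n" "n < 8" "n < m"
    and f: "vord 5 (\<lambda>t. snd (f t))"
  obtains d where "d \<noteq> 0" "lead n d (\<lambda>t. snd (f t))"
proof -
  obtain h b where h: "diffeo_germ h" "b \<noteq> 0" "lead n b (\<lambda>t. snd (f (h t)))"
    by (rule A_equivalent_normal_formE[OF assms]) blast
  obtain k where k: "diffeo_germ k" "\<forall>\<^sub>F t in nhds 0. h (k t) = t"
    using diffeo_germ_inverse[OF h(1)] by blast
  obtain l where l: "l \<noteq> 0" "lead 1 l k" using diffeo_germ_lead[OF k(1)] .
  have "lead n (b * l^n) (\<lambda>t. snd (f (h (k t))))" by (rule lead_compose[OF h(3) l(2)])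
  then have "lead n (b * l^n) (\<lambda>t. snd (f t))"
    by (rule lead_cong) (use k(2) in \<open>eventually_elim, simp\<close>)
  then show ?thesis by (rule that[rotated]) (use h(2) l(1) in simp)
qed

section \<open>Order of the angle and the chord estimate\<close>

lemma phi4_snd_tc:
  assumes \<kappa>: "smooth_germ \<kappa>" and j: "vord j (theta \<kappa>)" "0 < j"
  shows "tc (\<lambda>s. snd (phi4 \<kappa> s)) (j + 4) = tc (theta \<kappa>) j / (6 * real (j + 4))"
  using tc_sin_compose(1)[OF j, of j] j(2) tc_phi4_snd(1)[OF \<kappa>, of j] by simp

lemma phi4_snd_vord_5:
  assumes \<kappa>: "smooth_germ \<kappa>"
  shows "vord 5 (\<lambda>s. snd (phi4 \<kappa> s))"
proof -
  note ph = phi4_germs[OF \<kappa>]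
  have "tc (\<lambda>s. snd (phi4 \<kappa> s)) i = 0" if "i < 5" for i
  proof (cases "i < 4")
    case False
    then have "i = 0 + 4" using that by simp
    then show ?thesis using tc_phi4_snd(1)[OF \<kappa>, of 0] ph(2) by simp
  qed (rule tc_phi4_snd(2)[OF \<kappa>])
  then show ?thesis using ph(4) by (simp add: vord_iff_tc)
qed

lemma phi4_normal_form_imp:
  assumes \<kappa>: "smooth_germ \<kappa>" and eq: "A_equivalent (phi4 \<kappa>) (\<lambda>t. (t^4, t^(j + 4) + c * t^m))"
    and j: "0 < j" "j < 4" "j + 4 < m"
  shows "vord j (theta \<kappa>)" "tc (theta \<kappa>) j \<noteq> 0"
proof -
  obtain d where d: "d \<noteq> 0" "lead (j + 4) d (\<lambda>s. snd (phi4 \<kappa> s))"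
    by (rule A_equivalent_normal_form_order[OF eq _ _ j(3) phi4_snd_vord_5[OF \<kappa>]]) (use j in auto)
  have *: "vord (Suc 0) (theta \<kappa>)" using phi4_germs(1,2)[OF \<kappa>] by (simp add: vord_Suc_0_iff)
  have "0 < i \<Longrightarrow> i \<le> j \<Longrightarrow> vord i (theta \<kappa>)" for i
  proof (induction i)
    case (Suc i)
    show ?case
    proof (cases "i = 0")
      case False
      then have v: "vord i (theta \<kappa>)" using Suc by simp
      have "tc (\<lambda>s. snd (phi4 \<kappa> s)) (i + 4) = 0"
        using vord_tc[OF lead_vord[OF d(2)], of "i + 4"] Suc.prems by simp
      then have "tc (theta \<kappa>) i = 0" using phi4_snd_tc[OF \<kappa> v] False by auto
      then show ?thesis using vord_step[OF v] by simp
    qed (use * in simp)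
  qed simp
  then show v: "vord j (theta \<kappa>)" using j(1) by simp
  show "tc (theta \<kappa>) j \<noteq> 0"
    using phi4_snd_tc[OF \<kappa> v j(1)] lead_tc[OF d(2)] d(1) by auto
qed

lemma cauchy_mean_value:
  fixes f g :: "real \<Rightarrow> real"
  assumes "x \<noteq> y" "\<And>z. z \<in> closed_segment x y \<Longrightarrow> (f has_real_derivative f' z) (at z)"
    "\<And>z. z \<in> closed_segment x y \<Longrightarrow> (g has_real_derivative g' z) (at z)"
  obtains z where "z \<in> closed_segment x y" "(f x - f y) * g' z = (g x - g y) * f' z"
proof -
  have *: "\<exists>z\<in>{a..b}. (f b - f a) * g' z = (g b - g a) * f' z"
    if "a < b" "closed_segment x y = {a..b}" for a b
  proof -
    have df: "DERIV f z :> f' z" "DERIV g z :> g' z" if "a \<le> z" "z \<le> b" for z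
      using assms(2,3)[of z] that \<open>closed_segment x y = {a..b}\<close> by auto
    have "\<forall>z. a \<le> z \<and> z \<le> b \<longrightarrow> isCont f z" "\<forall>z. a \<le> z \<and> z \<le> b \<longrightarrow> isCont g z"
      using df DERIV_isCont by blast+
    moreover have "\<forall>z. a < z \<and> z < b \<longrightarrow> f differentiable (at z)" "\<forall>z. a < z \<and> z < b \<longrightarrow> g differentiable (at z)"
      unfolding real_differentiable_def using df less_imp_le by blast+
    ultimately have "\<exists>g'c f'c c. DERIV g c :> g'c \<and> DERIV f c :> f'c \<and> a < c \<and> c < b \<and> (f b - f a) * g'c = (g b - g a) * f'c"
      using \<open>a < b\<close> by (intro GMVT) auto
    then obtain g'c f'c c where c: "DERIV g c :> g'c" "DERIV f c :> f'c" "a < c" "c < b"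
      "(f b - f a) * g'c = (g b - g a) * f'c" by blast
    then have "g'c = g' c" "f'c = f' c" using DERIV_unique assms(2,3)[of c] that by auto
    then show ?thesis using c by (intro bexI[of _ c]) auto
  qed
  show ?thesis
  proof (cases "x < y")
    case True
    then obtain z where "z \<in> {x..y}" "(f y - f x) * g' z = (g y - g x) * f' z"
      using *[of x y] by (auto simp: closed_segment_eq_real_ivl)
    then show ?thesis using True that[of z] by (simp add: closed_segment_eq_real_ivl algebra_simps)
  next
    case False
    then have "y < x" using assms(1) by simp
    then obtain z where "z \<in> {y..x}" "(f x - f y) * g' z = (g x - g y) * f' z"
      using *[of y x] by (auto simp: closed_segment_eq_real_ivl)
    then show ?thesis using \<open>y < x\<close> that[of z] by (simp add: closed_segment_eq_real_ivl)
  qed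
qed

text \<open>The tangent of the curve at \<open>s\<close> has slope \<open>tan (\<theta> s)\<close>, which is small of second order.\<close>

lemma phi4_chord:
  assumes \<kappa>: "smooth_germ \<kappa>" and \<theta>: "vord 2 (theta \<kappa>)"
    and x: "lead 1 l x" and y: "lead 1 l y" and l: "l \<noteq> 0"
    and k: "vord k (\<lambda>t. fst (phi4 \<kappa> (x t)) - fst (phi4 \<kappa> (y t)))"
  shows "vord (k + 2) (\<lambda>t. snd (phi4 \<kappa> (x t)) - snd (phi4 \<kappa> (y t)))"
proof -
  note ph = phi4_germs[OF \<kappa>]
  let ?\<theta> = "theta \<kappa>" and ?\<phi>1 = "\<lambda>s. fst (phi4 \<kappa> s)" and ?\<phi>2 = "\<lambda>s. snd (phi4 \<kappa> s)"
  have sx: "smooth_germ x" "x 0 = 0" using lead_smooth[OF x] vord_zero[OF lead_vord[OF x]] by auto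
  have sy: "smooth_germ y" "y 0 = 0" using lead_smooth[OF y] vord_zero[OF lead_vord[OF y]] by auto
  obtain u where u: "smooth_germ u" "u 0 = l" "\<forall>\<^sub>F t in nhds 0. x t = t^1 * u t" using x by (rule leadE)
  obtain w where w: "smooth_germ w" "w 0 = l" "\<forall>\<^sub>F t in nhds 0. y t = t^1 * w t" using y by (rule leadE)
  have uw: "\<forall>\<^sub>F t in nhds 0. u t * w t > 0"
    using smooth_germ_tendsto[OF smooth_germ_mult[OF u(1) w(1)]]
    by (rule order_tendstoD) (use l in \<open>auto simp: u(2) w(2) zero_less_mult_iff\<close>)
  obtain M1 where M1: "M1 > 0" "\<forall>\<^sub>F t in nhds 0. \<bar>x t\<bar> \<le> M1 * \<bar>t\<bar>^1" using vord_bound[OF lead_vord[OF x]] .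
  obtain M2 where M2: "M2 > 0" "\<forall>\<^sub>F t in nhds 0. \<bar>y t\<bar> \<le> M2 * \<bar>t\<bar>^1" using vord_bound[OF lead_vord[OF y]] .
  obtain K where K: "K > 0" "\<forall>\<^sub>F s in nhds 0. \<bar>sin (?\<theta> s)\<bar> \<le> K * \<bar>s\<bar>^2"
    using vord_bound[OF vord_sin[OF \<theta>]] by auto
  have sc: "smooth_germ (\<lambda>s. cos (?\<theta> s))" by (rule smooth_germ_compose[OF smooth_germ_cos ph(1,2)])
  have "\<forall>\<^sub>F s in nhds 0. cos (?\<theta> s) > 1/2"
    using smooth_germ_tendsto[OF sc] by (rule order_tendstoD) (simp add: ph(2))
  with K(2) ph(7,8) have "\<forall>\<^sub>F s in nhds 0. \<bar>sin (?\<theta> s)\<bar> \<le> K * \<bar>s\<bar>^2 \<and> cos (?\<theta> s) > 1/2 \<and>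
      (?\<phi>1 has_real_derivative s^3 / 6 * cos (?\<theta> s)) (at s) \<and> (?\<phi>2 has_real_derivative s^3 / 6 * sin (?\<theta> s)) (at s)"
    by eventually_elim auto
  then obtain e where e: "e > 0" "\<And>s. \<bar>s\<bar> < e \<Longrightarrow> \<bar>sin (?\<theta> s)\<bar> \<le> K * \<bar>s\<bar>^2" "\<And>s. \<bar>s\<bar> < e \<Longrightarrow> cos (?\<theta> s) > 1/2"
      "\<And>s. \<bar>s\<bar> < e \<Longrightarrow> (?\<phi>1 has_real_derivative s^3 / 6 * cos (?\<theta> s)) (at s)"
      "\<And>s. \<bar>s\<bar> < e \<Longrightarrow> (?\<phi>2 has_real_derivative s^3 / 6 * sin (?\<theta> s)) (at s)"
    unfolding eventually_nhds_metric by (auto simp: dist_real_def)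
  have xe: "\<forall>\<^sub>F t in nhds 0. \<bar>x t\<bar> < e"
    by (rule order_tendstoD(2)[OF tendsto_rabs[OF smooth_germ_tendsto[OF sx(1)]]]) (use e(1) sx(2) in simp)
  have ye: "\<forall>\<^sub>F t in nhds 0. \<bar>y t\<bar> < e"
    by (rule order_tendstoD(2)[OF tendsto_rabs[OF smooth_germ_tendsto[OF sy(1)]]]) (use e(1) sy(2) in simp)
  obtain C where C: "C > 0" "\<forall>\<^sub>F t in nhds 0. \<bar>?\<phi>1 (x t) - ?\<phi>1 (y t)\<bar> \<le> C * \<bar>t\<bar>^k" using vord_bound[OF k] .
  define M where "M = max M1 M2"
  have "\<forall>\<^sub>F t in nhds 0. \<bar>?\<phi>2 (x t) - ?\<phi>2 (y t)\<bar> \<le> 2 * C * K * M^2 * \<bar>t\<bar>^(k + 2)"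
    using u(3) w(3) uw M1(2) M2(2) xe ye C(2)
  proof eventually_elim
    case (elim t)
    have pos: "0 \<le> 2 * C * K * M^2 * \<bar>t\<bar>^(k + 2)" using C K by simp
    show ?case
    proof (cases "x t = y t")
      case False
      have t0: "t \<noteq> 0" using False sx(2) sy(2) by auto
      \<comment> \<open>Equal nonzero leading coefficients put x(t) and y(t) on the same side of 0.
        The segment between them avoids 0, so that the factor z^3/6 common to both derivatives can
        be cancelled.\<close>
      have seg: "\<bar>z\<bar> < e \<and> z \<noteq> 0 \<and> \<bar>z\<bar> \<le> M * \<bar>t\<bar>" if "z \<in> closed_segment (x t) (y t)" for z
      proof -
        have "x t * y t = t^2 * (u t * w t)" using elim(1,2) by (simp add: power2_eq_square)
        then have "x t * y t > 0" using elim(3) t0 by simp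
        moreover have "M1 * \<bar>t\<bar> \<le> M * \<bar>t\<bar>" "M2 * \<bar>t\<bar> \<le> M * \<bar>t\<bar>" by (auto simp: M_def intro: mult_right_mono)
        ultimately show ?thesis using that elim(4-7)
          by (auto simp: closed_segment_eq_real_ivl zero_less_mult_iff split: if_splits)
      qed
      obtain z where z: "z \<in> closed_segment (x t) (y t)"
        "(?\<phi>1 (x t) - ?\<phi>1 (y t)) * (z^3 / 6 * sin (?\<theta> z)) = (?\<phi>2 (x t) - ?\<phi>2 (y t)) * (z^3 / 6 * cos (?\<theta> z))"
        by (rule cauchy_mean_value[OF False, where f="?\<phi>1" and g="?\<phi>2" and f'="\<lambda>z. z^3 / 6 * cos (?\<theta> z)" and g'="\<lambda>z. z^3 / 6 * sin (?\<theta> z)"])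
          (use seg e(4,5) in auto)
      note sz = seg[OF z(1)]
      have "(z^3 / 6) * ((?\<phi>1 (x t) - ?\<phi>1 (y t)) * sin (?\<theta> z)) = (z^3 / 6) * ((?\<phi>2 (x t) - ?\<phi>2 (y t)) * cos (?\<theta> z))"
        using z(2) by (simp only: mult_ac)
      then have eq: "(?\<phi>1 (x t) - ?\<phi>1 (y t)) * sin (?\<theta> z) = (?\<phi>2 (x t) - ?\<phi>2 (y t)) * cos (?\<theta> z)"
        using sz by simp
      have "\<bar>?\<phi>2 (x t) - ?\<phi>2 (y t)\<bar> * (1/2) \<le> \<bar>?\<phi>2 (x t) - ?\<phi>2 (y t)\<bar> * cos (?\<theta> z)"
        using e(3)[of z] sz by (intro mult_left_mono) auto
      also have "\<dots> = \<bar>(?\<phi>2 (x t) - ?\<phi>2 (y t)) * cos (?\<theta> z)\<bar>" using e(3)[of z] sz by (simp add: abs_mult)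
      also have "\<dots> = \<bar>?\<phi>1 (x t) - ?\<phi>1 (y t)\<bar> * \<bar>sin (?\<theta> z)\<bar>" by (simp only: eq [symmetric] abs_mult)
      also have "\<dots> \<le> (C * \<bar>t\<bar>^k) * (K * (M * \<bar>t\<bar>)^2)"
      proof (intro mult_mono elim(8))
        have "\<bar>sin (?\<theta> z)\<bar> \<le> K * \<bar>z\<bar>^2" using e(2) sz by blast
        also have "\<dots> \<le> K * (M * \<bar>t\<bar>)^2" using sz K(1) by (intro mult_left_mono power_mono) auto
        finally show "\<bar>sin (?\<theta> z)\<bar> \<le> K * (M * \<bar>t\<bar>)^2" .
      qed (use C in auto)
      also have "\<dots> = C * K * M^2 * \<bar>t\<bar>^(k + 2)" by (simp only: power_mult_distrib power_add mult_ac)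
      finally show ?thesis by simp
    qed (use pos in simp)
  qed
  moreover have "smooth_germ (\<lambda>t. ?\<phi>2 (x t) - ?\<phi>2 (y t))"
    by (rule smooth_germ_diff[OF smooth_germ_compose[OF ph(4) sx] smooth_germ_compose[OF ph(4) sy]])
  ultimately show ?thesis by (intro vord_of_bound)
qed

text \<open>The difference of the second component at h(-t) and h(t) has order exactly m. It is
  split at -h(t): the part between -h(t) and h(t) shows the first odd coefficient a_J of \<theta> at
  order J + 4, and the part between h(-t) and -h(t) is a chord, two orders smaller than the
  corresponding difference of first components.\<close>

lemma phi4_W1_sharp_imp:
  assumes \<kappa>: "smooth_germ \<kappa>" and q: "1 \<le> q"
    and eq: "A_equivalent (phi4 \<kappa>) (\<lambda>t. (t^4, t^6 + t^(2 * q + 5)))"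
  shows "tc (theta \<kappa>) 1 = 0" "tc (theta \<kappa>) 2 \<noteq> 0"
    "\<And>i. odd i \<Longrightarrow> i < 2 * q + 1 \<Longrightarrow> tc (theta \<kappa>) i = 0" "tc (theta \<kappa>) (2 * q + 1) \<noteq> 0"
proof -
  define p where "p = 2 * q + 1"
  define m where "m = p + 4"
  have p: "3 \<le> p" "odd p" and m: "odd m" "7 \<le> m" using q by (auto simp: p_def m_def)
  have mq: "2 * q + 5 = m" by (simp add: m_def p_def)
  define a where "a = tc (theta \<kappa>)"
  note ph = phi4_germs[OF \<kappa>]
  have eq': "A_equivalent (phi4 \<kappa>) (\<lambda>t. (t^4, t^6 + 1 * t^m))" using eq by (simp add: mq)
  have v2: "vord 2 (theta \<kappa>)" and a2: "tc (theta \<kappa>) 2 \<noteq> 0"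
    using phi4_normal_form_imp[OF \<kappa>, of 2 1 m] eq' m by auto
  show "tc (theta \<kappa>) 1 = 0" using vord_tc[OF v2] by simp
  show "tc (theta \<kappa>) 2 \<noteq> 0" by (rule a2)
  obtain h \<psi> b1 b where h: "diffeo_germ h" "diffeo_germ \<psi>"
    "\<forall>\<^sub>F t in nhds 0. phi4 \<kappa> (h t) = \<psi> (t^4, t^6 + 1 * t^m)"
    and D: "((\<lambda>p. snd (\<psi> p)) has_derivative (\<lambda>p. b1 * fst p + b * snd p)) (at 0)" and b: "b \<noteq> 0"
    by (rule A_equivalent_normal_formE[OF eq' _ _ _ phi4_snd_vord_5[OF \<kappa>]]) (use m in auto)
  have s\<psi>: "smooth_germ \<psi>" "\<psi> 0 = 0" using diffeo_germ_smooth[OF h(2)] by (auto simp: smooth_map_germ_def)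
  obtain u v where D1: "((\<lambda>p. fst (\<psi> p)) has_derivative (\<lambda>p. u * fst p + v * snd p)) (at 0)"
    using smooth_germ_plane_derivative[OF smooth_germ_fst[OF s\<psi>(1)]] .
  obtain l where l: "l \<noteq> 0" "lead 1 l h" using diffeo_germ_lead[OF h(1)] .
  have sh: "smooth_germ h" "h 0 = 0" using diffeo_germ_smooth[OF h(1)] by (auto simp: smooth_map_germ_def)
  let ?q = "\<lambda>t::real. t^6 + 1 * t^m"
  let ?\<phi>1 = "\<lambda>s. fst (phi4 \<kappa> s)" and ?\<phi>2 = "\<lambda>s. snd (phi4 \<kappa> s)"
  have neg: "smooth_germ (\<lambda>t::real. - t)" by (intro smooth_intros)
  have q1: "vord 1 ?q" using vord_mono[OF lead_vord[OF normal_form_lead[of 6 m 1]]] m by simp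
  have q1': "vord 1 (\<lambda>t. ?q (- t))" by (rule vord_compose[OF q1 neg]) simp
  have qd: "?q (- t) - ?q t = - 2 * t^m" for t using m(1) by simp
  have v4: "vord 1 (\<lambda>t::real. t^4)" by (rule vord_mono[OF vord_power_t]) simp
  have vq: "vord m (\<lambda>t. ?q (- t) - ?q t)" unfolding qd by (intro vord_cmult vord_power_t)
  have hm: "\<forall>\<^sub>F t in nhds 0. phi4 \<kappa> (h (- t)) = \<psi> (t^4, ?q (- t))"
    using smooth_germ_eventually[OF neg _ h(3)] by simp
  have F1: "vord m (\<lambda>t. ?\<phi>1 (h (- t)) - ?\<phi>1 (h t))"
  proof -
    have "vord (m + 1) (\<lambda>t. fst (\<psi> (t^4, ?q (- t))) - fst (\<psi> (t^4, ?q t)) - v * (?q (- t) - ?q t))"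
      by (rule strict_curve_difference[OF smooth_germ_fst[OF s\<psi>(1)] D1 v4 q1' q1 vq])
    from vord_add[OF vord_mono[OF this] vord_cmult[OF vq, of v]]
    have "vord m (\<lambda>t. fst (\<psi> (t^4, ?q (- t))) - fst (\<psi> (t^4, ?q t)))" by simp
    then show ?thesis by (rule vord_cong) (use h(3) hm in \<open>eventually_elim, simp\<close>)
  qed
  have F2: "lead m (- 2 * b) (\<lambda>t. ?\<phi>2 (h (- t)) - ?\<phi>2 (h t))"
  proof -
    have "vord (m + 1) (\<lambda>t. snd (\<psi> (t^4, ?q (- t))) - snd (\<psi> (t^4, ?q t)) - b * (?q (- t) - ?q t))"
      by (rule strict_curve_difference[OF smooth_germ_snd[OF s\<psi>(1)] D v4 q1' q1 vq])
    then have "vord (m + 1) (\<lambda>t. snd (\<psi> (t^4, ?q (- t))) - snd (\<psi> (t^4, ?q t)) - (- 2 * b) * t^m)"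
      unfolding qd by (simp add: mult.assoc mult.left_commute)
    then have "lead m (- 2 * b) (\<lambda>t. snd (\<psi> (t^4, ?q (- t))) - snd (\<psi> (t^4, ?q t)))" by (simp add: lead_def)
    then show ?thesis by (rule lead_cong) (use h(3) hm in \<open>eventually_elim, simp\<close>)
  qed
  \<comment> \<open>Both h(-t) and -h(t) start with -l t, as the chord estimate requires.\<close>
  have lx: "lead 1 (- l) (\<lambda>t. h (- t))"
  proof -
    have "lead 1 (-1) (\<lambda>t::real. - t)" using lead_monomial[of 1 "-1"] by simp
    from lead_compose[OF l(2) this] show ?thesis by simp
  qed
  have ly: "lead 1 (- l) (\<lambda>t. - h t)" using lead_cmult[OF l(2), of "-1"] by simp
  have main: "vord (J + 4) (\<lambda>s. ?\<phi>2 (- s) - ?\<phi>2 s) \<and> tc (\<lambda>s. ?\<phi>2 (- s) - ?\<phi>2 s) (J + 4) = - 2 * (a J / (6 * real (J + 4)))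
      \<and> (\<forall>k. k \<le> m \<longrightarrow> k \<le> J + 6 \<longrightarrow> vord (k + 2) (\<lambda>t. ?\<phi>2 (h (- t)) - ?\<phi>2 (- h t)))"
    if J: "odd J" "3 \<le> J" and z: "\<And>i. odd i \<Longrightarrow> i < J \<Longrightarrow> a i = 0" for J
  proof -
    have J2: "2 \<le> J" using J by simp
    note odd_coeffs = theta_odd_coefficients[OF v2 J2 z[unfolded a_def]]
    have sc: "smooth_germ (\<lambda>s. cos (theta \<kappa> s))" by (rule smooth_germ_compose[OF smooth_germ_cos ph(1,2)])
    have tcos: "tc (\<lambda>s. cos (theta \<kappa> s)) i = 0" if "odd i" "i < J + 2" for i
      by (rule odd_coeffs(1)) (use that in auto)
    have tsin: "tc (\<lambda>s. sin (theta \<kappa> s)) i = a i" if "odd i" "i < J + 2" for i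
      unfolding a_def by (rule odd_coeffs(2)) (use that in auto)
    have t1: "tc ?\<phi>1 i = 0" if "odd i" "i < J + 6" for i
    proof (cases "i < 4")
      case False
      then obtain k where k: "i = k + 4" by (metis add.commute le_add_diff_inverse not_less)
      then show ?thesis using that tc_cube_antiderivative(1)[OF sc ph(5,7), of k] tcos[of k] by simp
    qed (rule tc_cube_antiderivative(2)[OF sc ph(5,7)])
    have t2: "tc ?\<phi>2 i = 0" if "odd i" "i < J + 4" for i
    proof (cases "i < 4")
      case False
      then obtain k where k: "i = k + 4" by (metis add.commute le_add_diff_inverse not_less)
      then show ?thesis using that tc_phi4_snd(1)[OF \<kappa>, of k] tsin[of k] z[of k] by simp
    qed (rule tc_phi4_snd(2)[OF \<kappa>])
    have V2: "vord (J + 4) (\<lambda>s. ?\<phi>2 (- s) - ?\<phi>2 s)" using vord_reflect_diff[OF ph(4)] t2 by blast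
    have T2: "tc (\<lambda>s. ?\<phi>2 (- s) - ?\<phi>2 s) (J + 4) = - 2 * (a J / (6 * real (J + 4)))"
      using tc_reflect_diff[OF ph(4), of "J + 4"] tc_phi4_snd(1)[OF \<kappa>, of J] tsin[of J] J by simp
    have V1: "vord (J + 6) (\<lambda>s. ?\<phi>1 (- s) - ?\<phi>1 s)" using vord_reflect_diff[OF ph(3)] t1 by blast
    have "vord (k + 2) (\<lambda>t. ?\<phi>2 (h (- t)) - ?\<phi>2 (- h t))" if k: "k \<le> m" "k \<le> J + 6" for k
    \<comment> \<open>The first components at h(-t) and -h(t) are compared through h(t): one
      difference has order m by \<open>F1\<close>, the other order J + 6 because the first component
      is even to that order.\<close>
    proof (rule phi4_chord[OF \<kappa> v2 lx ly])
      have "vord k (\<lambda>t. (?\<phi>1 (h (- t)) - ?\<phi>1 (h t)) - (?\<phi>1 (- h t) - ?\<phi>1 (h t)))"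
        by (rule vord_diff[OF vord_mono[OF F1 k(1)] vord_mono[OF vord_compose[OF V1 sh] k(2)]])
      then show "vord k (\<lambda>t. ?\<phi>1 (h (- t)) - ?\<phi>1 (- h t))" by simp
    qed (use l in simp)
    then show ?thesis using V2 T2 by blast
  qed
  have F2': "lead n d (\<lambda>t. (?\<phi>2 (h (- t)) - ?\<phi>2 (h t)) - (?\<phi>2 (h (- t)) - ?\<phi>2 (- h t)))
      \<longleftrightarrow> lead n d (\<lambda>t. ?\<phi>2 (- h t) - ?\<phi>2 (h t))" for n d by simp
  have refl: "lead (J + 4) (- 2 * (a J / (6 * real (J + 4))) * l^(J + 4)) (\<lambda>t. ?\<phi>2 (- h t) - ?\<phi>2 (h t))"
    if J: "odd J" "3 \<le> J" and z: "\<And>i. odd i \<Longrightarrow> i < J \<Longrightarrow> a i = 0" for J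
    using main[OF that] lead_compose[OF _ l(2), of "J + 4" _ "\<lambda>s. ?\<phi>2 (- s) - ?\<phi>2 s"] by (simp add: lead_iff)
  have zero: "odd i \<Longrightarrow> i < p \<Longrightarrow> a i = 0" for i
  proof (induction i rule: less_induct)
    case (less i)
    show ?case
    proof (cases "i = 1")
      case True
      then show ?thesis using vord_tc[OF v2] by (simp add: a_def)
    next
      case False
      then have i3: "3 \<le> i" using less.prems(1) by (cases i rule: nat.exhaust) (auto elim!: oddE)
      \<comment> \<open>Both i and p are odd, so i + 6 \<le> m. The full difference then has order
        at least i + 6 and the chord order at least i + 8, which leaves no room for a_i at order i +
        4.\<close>
      have i2: "i + 2 \<le> p" using less.prems p by presburger
      have z: "\<And>j. odd j \<Longrightarrow> j < i \<Longrightarrow> a j = 0" using less by auto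
      have "vord (i + 5) (\<lambda>t. (?\<phi>2 (h (- t)) - ?\<phi>2 (h t)) - (?\<phi>2 (h (- t)) - ?\<phi>2 (- h t)))"
      proof (rule vord_diff)
        show "vord (i + 5) (\<lambda>t. ?\<phi>2 (h (- t)) - ?\<phi>2 (h t))"
          by (rule vord_mono[OF lead_vord[OF F2]]) (use i2 in \<open>simp add: m_def\<close>)
        have "i + 6 \<le> m" using i2 by (simp add: m_def)
        then have "vord ((i + 6) + 2) (\<lambda>t. ?\<phi>2 (h (- t)) - ?\<phi>2 (- h t))"
          using main[OF less.prems(1) i3 z] by blast
        then show "vord (i + 5) (\<lambda>t. ?\<phi>2 (h (- t)) - ?\<phi>2 (- h t))" by (rule vord_mono) simp
      qed
      then have "vord (Suc (i + 4)) (\<lambda>t. ?\<phi>2 (- h t) - ?\<phi>2 (h t))" by (simp add: eval_nat_numeral)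
      from vord_tc[OF this, of "i + 4"] lead_tc[OF refl[OF less.prems(1) i3 z]]
      show ?thesis using l(1) by simp
    qed
  qed
  then show "\<And>i. odd i \<Longrightarrow> i < 2 * q + 1 \<Longrightarrow> tc (theta \<kappa>) i = 0" by (simp add: a_def p_def)
  \<comment> \<open>At J = p the chord has order m + 2, so at order m = p + 4 the coefficient -2b
    comes from a_p alone.\<close>
  have A: "vord (Suc m) (\<lambda>t. -1 * (?\<phi>2 (h (- t)) - ?\<phi>2 (- h t)))"
  proof -
    have "vord (m + 2) (\<lambda>t. ?\<phi>2 (h (- t)) - ?\<phi>2 (- h t))" using main[OF p(2,1) zero] by (auto simp: m_def)
    then show ?thesis by (intro vord_cmult) (erule vord_mono, simp)
  qed
  have "lead m (- 2 * b) (\<lambda>t. ?\<phi>2 (- h t) - ?\<phi>2 (h t))"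
    using lead_add_higher[OF F2 A] by simp
  from lead_tc[OF this] lead_tc[OF refl[OF p(2,1) zero]]
  have "- 2 * (a p / (6 * real (p + 4))) * l^(p + 4) = - 2 * b" by (simp add: m_def)
  then have "a p \<noteq> 0" using b by auto
  then show "tc (theta \<kappa>) (2 * q + 1) \<noteq> 0" by (simp add: a_def p_def)
qed

theorem theorem3p11:
  fixes \<kappa> :: "real \<Rightarrow> real"
  assumes "smooth_germ \<kappa>"
  shows
    "(W12_singularity (phi4 \<kappa>) \<longleftrightarrow> theta_coeff \<kappa> 1 \<noteq> 0) \<and>
     (theta_coeff \<kappa> 1 \<noteq> 0 \<longrightarrow>
        (w12 \<kappa> > 0 \<longrightarrow> A_equivalent (phi4 \<kappa>) (\<lambda>t. (t^4, t^5 + t^7))) \<and>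
        (w12 \<kappa> < 0 \<longrightarrow> A_equivalent (phi4 \<kappa>) (\<lambda>t. (t^4, t^5 - t^7))) \<and>
        (w12 \<kappa> = 0 \<longrightarrow> A_equivalent (phi4 \<kappa>) (\<lambda>t. (t^4, t^5))))
     \<and>
     (\<forall>q\<ge>1. W1_sharp_singularity q (phi4 \<kappa>) \<longleftrightarrow>
        theta_coeff \<kappa> 1 = 0 \<and> theta_coeff \<kappa> 2 \<noteq> 0 \<and>
        (\<forall>j. 1 \<le> j \<and> j < q \<longrightarrow> theta_coeff \<kappa> (2*j+1) = 0) \<and>
        theta_coeff \<kappa> (2*q+1) \<noteq> 0)
     \<and>
     (W18_singularity (phi4 \<kappa>) \<longleftrightarrow>
        theta_coeff \<kappa> 1 = 0 \<and> theta_coeff \<kappa> 2 = 0 \<and> theta_coeff \<kappa> 3 \<noteq> 0) \<and>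
     (theta_coeff \<kappa> 1 = 0 \<and> theta_coeff \<kappa> 2 = 0 \<and> theta_coeff \<kappa> 3 \<noteq> 0 \<longrightarrow>
        (theta_coeff \<kappa> 5 / theta_coeff \<kappa> 3 > 0 \<longrightarrow>
           A_equivalent (phi4 \<kappa>) (\<lambda>t. (t^4, t^7 + t^9))) \<and>
        (theta_coeff \<kappa> 5 / theta_coeff \<kappa> 3 < 0 \<longrightarrow>
           A_equivalent (phi4 \<kappa>) (\<lambda>t. (t^4, t^7 - t^9))) \<and>
        (theta_coeff \<kappa> 5 = 0 \<and> w18 \<kappa> > 0 \<longrightarrow>
           A_equivalent (phi4 \<kappa>) (\<lambda>t. (t^4, t^7 + t^13))) \<and>
        (theta_coeff \<kappa> 5 = 0 \<and> w18 \<kappa> < 0 \<longrightarrow>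
           A_equivalent (phi4 \<kappa>) (\<lambda>t. (t^4, t^7 - t^13))) \<and>
        (theta_coeff \<kappa> 5 = 0 \<and> w18 \<kappa> = 0 \<longrightarrow>
           A_equivalent (phi4 \<kappa>) (\<lambda>t. (t^4, t^7))))"
proof -
  note \<kappa> = assms
  \<comment> \<open>The values c = 1, -1, 0 give the three normal forms of the type W12.\<close>
  have 1: "theta_coeff \<kappa> 1 \<noteq> 0" if "A_equivalent (phi4 \<kappa>) (\<lambda>t. (t^4, t^5 + c * t^7))" for c
    using phi4_normal_form_imp(2)[OF \<kappa>, of 1 c 7] that by (simp add: theta_coeff_eq)
  have 2: "(w12 \<kappa> > 0 \<longrightarrow> A_equivalent (phi4 \<kappa>) (\<lambda>t. (t^4, t^5 + t^7))) \<and>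
        (w12 \<kappa> < 0 \<longrightarrow> A_equivalent (phi4 \<kappa>) (\<lambda>t. (t^4, t^5 - t^7))) \<and>
        (w12 \<kappa> = 0 \<longrightarrow> A_equivalent (phi4 \<kappa>) (\<lambda>t. (t^4, t^5)))" if nz: "theta_coeff \<kappa> 1 \<noteq> 0"
  proof -
    define c where "c = 5 / (42 * theta_coeff \<kappa> 1 ^ 2)"
    have c: "c > 0" using nz by (simp add: c_def)
    have "A_equivalent (phi4 \<kappa>) (\<lambda>t. (t^4, t^5 + (c * w12 \<kappa>) * t^7))"
      using phi4_W12[OF \<kappa> nz] by (simp only: c_def)
    note s = normal_form_sign[OF this]
    show ?thesis using s(1-3) c by (auto simp: zero_less_mult_iff mult_less_0_iff)
  qed
  have W12: "W12_singularity (phi4 \<kappa>) \<longleftrightarrow> theta_coeff \<kappa> 1 \<noteq> 0"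
  proof
    assume "W12_singularity (phi4 \<kappa>)"
    then show "theta_coeff \<kappa> 1 \<noteq> 0"
      unfolding W12_singularity_def using 1[of 1] 1[of "-1"] 1[of 0] by auto
  next
    assume "theta_coeff \<kappa> 1 \<noteq> 0"
    from 2[OF this] show "W12_singularity (phi4 \<kappa>)"
      unfolding W12_singularity_def by (meson linorder_neqE_linordered_idom)
  qed
  have W1: "W1_sharp_singularity q (phi4 \<kappa>) \<longleftrightarrow>
        theta_coeff \<kappa> 1 = 0 \<and> theta_coeff \<kappa> 2 \<noteq> 0 \<and>
        (\<forall>j. 1 \<le> j \<and> j < q \<longrightarrow> theta_coeff \<kappa> (2*j+1) = 0) \<and>
        theta_coeff \<kappa> (2*q+1) \<noteq> 0" if q: "q \<ge> 1" for q
  proof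
    assume "W1_sharp_singularity q (phi4 \<kappa>)"
    then have "A_equivalent (phi4 \<kappa>) (\<lambda>t. (t^4, t^6 + t^(2 * q + 5)))" by (simp only: W1_sharp_singularity_def)
    note i = phi4_W1_sharp_imp[OF \<kappa> q this]
    show "theta_coeff \<kappa> 1 = 0 \<and> theta_coeff \<kappa> 2 \<noteq> 0 \<and>
        (\<forall>j. 1 \<le> j \<and> j < q \<longrightarrow> theta_coeff \<kappa> (2*j+1) = 0) \<and> theta_coeff \<kappa> (2*q+1) \<noteq> 0"
      using i(1,2,4) i(3)[of "2 * j + 1" for j] by (simp add: theta_coeff_eq)
  next
    assume "theta_coeff \<kappa> 1 = 0 \<and> theta_coeff \<kappa> 2 \<noteq> 0 \<and>
        (\<forall>j. 1 \<le> j \<and> j < q \<longrightarrow> theta_coeff \<kappa> (2*j+1) = 0) \<and> theta_coeff \<kappa> (2*q+1) \<noteq> 0"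
    then show "W1_sharp_singularity q (phi4 \<kappa>)"
      unfolding W1_sharp_singularity_def by (intro phi4_W1_sharp[OF \<kappa> q]) auto
  qed
  let ?c = "theta_coeff \<kappa> 1 = 0 \<and> theta_coeff \<kappa> 2 = 0 \<and> theta_coeff \<kappa> 3 \<noteq> 0"
  have 3: "?c" if "A_equivalent (phi4 \<kappa>) (\<lambda>t. (t^4, t^7 + c * t^m))" "7 < m" for c m
  proof -
    have e: "A_equivalent (phi4 \<kappa>) (\<lambda>t. (t^4, t^(3 + 4) + c * t^m))" using that(1) by simp
    have "vord 3 (theta \<kappa>)" "tc (theta \<kappa>) 3 \<noteq> 0" using phi4_normal_form_imp[OF \<kappa> e] that(2) by auto
    then show ?thesis using vord_tc[of 3 "theta \<kappa>" 1] vord_tc[of 3 "theta \<kappa>" 2] by (simp add: theta_coeff_eq)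
  qed
  have 4: "(theta_coeff \<kappa> 5 / theta_coeff \<kappa> 3 > 0 \<longrightarrow>
           A_equivalent (phi4 \<kappa>) (\<lambda>t. (t^4, t^7 + t^9))) \<and>
        (theta_coeff \<kappa> 5 / theta_coeff \<kappa> 3 < 0 \<longrightarrow>
           A_equivalent (phi4 \<kappa>) (\<lambda>t. (t^4, t^7 - t^9)))" if nz: ?c
  proof (cases "theta_coeff \<kappa> 5 = 0")
    case False
    define x where "x = theta_coeff \<kappa> 5 / theta_coeff \<kappa> 3"
    have "A_equivalent (phi4 \<kappa>) (\<lambda>t. (t^4, t^7 + (7/180 * x) * t^9))"
      unfolding x_def by (rule phi4_W18_9[OF \<kappa>]) (use nz False in auto)
    from normal_form_sign(1,2)[OF this] show ?thesis unfolding x_def [symmetric] by simp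
  qed simp
  have 5: "(w18 \<kappa> > 0 \<longrightarrow> A_equivalent (phi4 \<kappa>) (\<lambda>t. (t^4, t^7 + t^13))) \<and>
        (w18 \<kappa> < 0 \<longrightarrow> A_equivalent (phi4 \<kappa>) (\<lambda>t. (t^4, t^7 - t^13))) \<and>
        (w18 \<kappa> = 0 \<longrightarrow> A_equivalent (phi4 \<kappa>) (\<lambda>t. (t^4, t^7)))" if nz: ?c "theta_coeff \<kappa> 5 = 0"
  proof -
    define c where "c = 1 / (112320 * theta_coeff \<kappa> 3 ^ 2)"
    have c: "c > 0" using nz by (simp add: c_def)
    have "A_equivalent (phi4 \<kappa>) (\<lambda>t. (t^4, t^7 + (c * w18 \<kappa>) * t^13))"
      unfolding c_def by (rule phi4_W18_13[OF \<kappa>]) (use nz in auto)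
    note s = normal_form_sign[OF this]
    show ?thesis using s(1-3) c by (auto simp: zero_less_mult_iff mult_less_0_iff)
  qed
  have W18: "W18_singularity (phi4 \<kappa>) \<longleftrightarrow> ?c"
  proof
    assume "W18_singularity (phi4 \<kappa>)"
    then show ?c unfolding W18_singularity_def
      using 3[of 1 9] 3[of "-1" 9] 3[of 1 13] 3[of "-1" 13] 3[of 0 13] by auto
  next
    assume c: ?c
    show "W18_singularity (phi4 \<kappa>)"
    proof (cases "theta_coeff \<kappa> 5 = 0")
      case True
      from 5[OF c True] show ?thesis
        unfolding W18_singularity_def by (meson linorder_neqE_linordered_idom)
    next
      case False
      then have "theta_coeff \<kappa> 5 / theta_coeff \<kappa> 3 \<noteq> 0" using c by simp
      with 4[OF c] show ?thesis
        unfolding W18_singularity_def by (meson linorder_neqE_linordered_idom)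
    qed
  qed
  show ?thesis using W12 W1 W18 2 4 5 by blast
qed

end
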